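(* Let $B$ be a doubly degenerate tricategory, and also denote by $B$ the monoidal category associated to its single (degenerate) hom-bicategory. Then $B$ is a braided monoidal category.
   Context: Tricategories are weak, in Gurski's fully algebraic version of the Gordon–Power–Street definition. A tricategory is doubly degenerate if it has exactly one 0-cell $\star$ and exactly one 1-cell. Its hom-bicategory $B(\star,\star)$ then has one object, so it is a monoidal category $(B,\otimes,U)$: objects are 2-cells, morphisms are 3-cells, $\otimes$ is composition of 2-cells along the 1-cell, $U$ is the identity 2-cell. The composition functor of the tricategory is a monoidal functor $\boxtimes:B\times B\to B$. The unit functor $1\to B(\star,\star)$ gives a monoid $I$ in $B$ with an isomorphism of monoids $I\cong U$. The left unit adjoint equivalence $\mathbf l$ has as its component an object $L$ with dual $L^{\cdot}$ (with invertible unit and counit) and natural isomorphisms $L\otimes(I\boxtimes X)\cong X\otimes L$; the right unit adjoint equivalence $\mathbf r$ likewise gives $R$, $R^{\cdot}$ and $R\otimes(X\boxtimes I)\cong X\otimes R$. A multiplication on a monoidal category $M$ (unit $E$) is a monoidal functor $\varphi:M\times M\to M$ with invertible monoidal transformations $\rho:\varphi(-,E)\Rightarrow\mathrm{id}$ and $\lambda:\varphi(E,-)\Rightarrow\mathrm{id}$. By Joyal–Street, a multiplication induces a braiding, the composite $$ab\xrightarrow{\lambda^{-1}\rho^{-1}}\varphi(E,a)\varphi(b,E)\cong\varphi(Eb,aE)\cong\varphi(b,a)\cong\varphi(bE,Ea)\cong\varphi(b,E)\varphi(E,a)\xrightarrow{\rho\lambda}ba.$$ The braiding meant in the corollary is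 the one induced in this way, for the given monoidal structure $\otimes$, by a multiplication on $B$ with $\varphi(X,Y)=R\otimes((X\boxtimes Y)\otimes L^{\cdot})$. *)

theory Defs
  imports Main
begin

section \<open>Bicategories\<close>

text \<open>
  Sources and targets of cells are functions, and the operations are only constrained on
  composable cells. Composition is written in functional order: \<open>g \<odot> f\<close> is \<open>g\<close> after \<open>f\<close>, and
  likewise \<open>\<beta> \<bullet> \<alpha>\<close> (vertical) and \<open>\<beta> \<star> \<alpha>\<close> (horizontal).
\<close>

record ('o, 'f, 'c) bicat =
  Obj :: "'o set"
  Arr :: "'f set"
  Cell :: "'c set"
  Src :: "'f \<Rightarrow> 'o"
  Tgt :: "'f \<Rightarrow> 'o"
  Dom :: "'c \<Rightarrow> 'f"
  Cod :: "'c \<Rightarrow> 'f"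
  Id1 :: "'o \<Rightarrow> 'f"
  Comp1 :: "'f \<Rightarrow> 'f \<Rightarrow> 'f" (infixr "\<odot>\<index>" 75)
  Id2 :: "'f \<Rightarrow> 'c"
  VComp :: "'c \<Rightarrow> 'c \<Rightarrow> 'c" (infixr "\<bullet>\<index>" 60)
  HComp :: "'c \<Rightarrow> 'c \<Rightarrow> 'c" (infixr "\<star>\<index>" 70)
  Assoc :: "'f \<Rightarrow> 'f \<Rightarrow> 'f \<Rightarrow> 'c"
  LUnit :: "'f \<Rightarrow> 'c"
  RUnit :: "'f \<Rightarrow> 'c"

definition hom1 :: "('o, 'f, 'c) bicat \<Rightarrow> 'o \<Rightarrow> 'o \<Rightarrow> 'f set" where
  "hom1 B x y = {f \<in> Arr B. Src B f = x \<and> Tgt B f = y}"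

definition hom2 :: "('o, 'f, 'c) bicat \<Rightarrow> 'f \<Rightarrow> 'f \<Rightarrow> 'c set" where
  "hom2 B f g = {\<alpha> \<in> Cell B. Dom B \<alpha> = f \<and> Cod B \<alpha> = g}"

definition inverse2 :: "('o, 'f, 'c) bicat \<Rightarrow> 'c \<Rightarrow> 'c \<Rightarrow> bool" where
  "inverse2 B \<alpha> \<beta> \<longleftrightarrow> \<alpha> \<in> Cell B \<and> \<beta> \<in> hom2 B (Cod B \<alpha>) (Dom B \<alpha>) \<and>
     \<beta> \<bullet>\<^bsub>B\<^esub> \<alpha> = Id2 B (Dom B \<alpha>) \<and> \<alpha> \<bullet>\<^bsub>B\<^esub> \<beta> = Id2 B (Cod B \<alpha>)"

definition iso2 :: "('o, 'f, 'c) bicat \<Rightarrow> 'c \<Rightarrow> bool" where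
  "iso2 B \<alpha> \<longleftrightarrow> (\<exists>\<beta>. inverse2 B \<alpha> \<beta>)"

definition inv2 :: "('o, 'f, 'c) bicat \<Rightarrow> 'c \<Rightarrow> 'c" where
  "inv2 B \<alpha> = (THE \<beta>. inverse2 B \<alpha> \<beta>)"

locale bicategory =
  fixes B :: "('o, 'f, 'c) bicat" (structure)
  assumes src_tgt: "f \<in> Arr B \<Longrightarrow> Src B f \<in> Obj B \<and> Tgt B f \<in> Obj B"
    and dom_cod: "\<alpha> \<in> Cell B \<Longrightarrow> Dom B \<alpha> \<in> Arr B \<and> Cod B \<alpha> \<in> Arr B \<and>
      Src B (Dom B \<alpha>) = Src B (Cod B \<alpha>) \<and> Tgt B (Dom B \<alpha>) = Tgt B (Cod B \<alpha>)"
    and id1: "x \<in> Obj B \<Longrightarrow> Id1 B x \<in> hom1 B x x"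
    and comp1: "\<lbrakk>g \<in> hom1 B y z; f \<in> hom1 B x y\<rbrakk> \<Longrightarrow> g \<odot> f \<in> hom1 B x z"
    and id2: "f \<in> Arr B \<Longrightarrow> Id2 B f \<in> hom2 B f f"
    and vcomp: "\<lbrakk>\<beta> \<in> hom2 B g h; \<alpha> \<in> hom2 B f g\<rbrakk> \<Longrightarrow> \<beta> \<bullet> \<alpha> \<in> hom2 B f h"
    and vcomp_id: "\<alpha> \<in> hom2 B f g \<Longrightarrow> \<alpha> \<bullet> Id2 B f = \<alpha> \<and> Id2 B g \<bullet> \<alpha> = \<alpha>"
    and vcomp_assoc: "\<lbrakk>\<gamma> \<in> hom2 B h k; \<beta> \<in> hom2 B g h; \<alpha> \<in> hom2 B f g\<rbrakk>
      \<Longrightarrow> (\<gamma> \<bullet> \<beta>) \<bullet> \<alpha> = \<gamma> \<bullet> (\<beta> \<bullet> \<alpha>)"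
    and hcomp: "\<lbrakk>\<beta> \<in> hom2 B g g'; \<alpha> \<in> hom2 B f f'; Src B g = Tgt B f\<rbrakk>
      \<Longrightarrow> \<beta> \<star> \<alpha> \<in> hom2 B (g \<odot> f) (g' \<odot> f')"
    and hcomp_id: "\<lbrakk>g \<in> hom1 B y z; f \<in> hom1 B x y\<rbrakk> \<Longrightarrow> Id2 B g \<star> Id2 B f = Id2 B (g \<odot> f)"
    and interchange: "\<lbrakk>\<beta>' \<in> hom2 B g' g''; \<beta> \<in> hom2 B g g'; \<alpha>' \<in> hom2 B f' f''; \<alpha> \<in> hom2 B f f';
        Src B g = Tgt B f\<rbrakk>
      \<Longrightarrow> (\<beta>' \<bullet> \<beta>) \<star> (\<alpha>' \<bullet> \<alpha>) = (\<beta>' \<star> \<alpha>') \<bullet> (\<beta> \<star> \<alpha>)"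
    and assoc: "\<lbrakk>h \<in> hom1 B y z; g \<in> hom1 B x y; f \<in> hom1 B w x\<rbrakk>
      \<Longrightarrow> Assoc B h g f \<in> hom2 B ((h \<odot> g) \<odot> f) (h \<odot> (g \<odot> f)) \<and> iso2 B (Assoc B h g f)"
    and assoc_nat: "\<lbrakk>\<gamma> \<in> hom2 B h h'; \<beta> \<in> hom2 B g g'; \<alpha> \<in> hom2 B f f';
        Src B h = Tgt B g; Src B g = Tgt B f\<rbrakk>
      \<Longrightarrow> Assoc B h' g' f' \<bullet> ((\<gamma> \<star> \<beta>) \<star> \<alpha>) = (\<gamma> \<star> (\<beta> \<star> \<alpha>)) \<bullet> Assoc B h g f"
    and lunit: "f \<in> hom1 B x y
      \<Longrightarrow> LUnit B f \<in> hom2 B (Id1 B y \<odot> f) f \<and> iso2 B (LUnit B f)"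
    and lunit_nat: "\<lbrakk>\<alpha> \<in> hom2 B f f'; Tgt B f = y\<rbrakk>
      \<Longrightarrow> LUnit B f' \<bullet> (Id2 B (Id1 B y) \<star> \<alpha>) = \<alpha> \<bullet> LUnit B f"
    and runit: "f \<in> hom1 B x y
      \<Longrightarrow> RUnit B f \<in> hom2 B (f \<odot> Id1 B x) f \<and> iso2 B (RUnit B f)"
    and runit_nat: "\<lbrakk>\<alpha> \<in> hom2 B f f'; Src B f = x\<rbrakk>
      \<Longrightarrow> RUnit B f' \<bullet> (\<alpha> \<star> Id2 B (Id1 B x)) = \<alpha> \<bullet> RUnit B f"
    and pentagon: "\<lbrakk>k \<in> hom1 B y z; h \<in> hom1 B x y; g \<in> hom1 B w x; f \<in> hom1 B v w\<rbrakk>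
      \<Longrightarrow> (Id2 B k \<star> Assoc B h g f) \<bullet> Assoc B k (h \<odot> g) f \<bullet> (Assoc B k h g \<star> Id2 B f)
        = Assoc B k h (g \<odot> f) \<bullet> Assoc B (k \<odot> h) g f"
    and triangle: "\<lbrakk>g \<in> hom1 B y z; f \<in> hom1 B x y\<rbrakk>
      \<Longrightarrow> (Id2 B g \<star> LUnit B f) \<bullet> Assoc B g (Id1 B y) f = RUnit B g \<star> Id2 B f"

definition unit_bicat :: "(unit, unit, unit) bicat" where
  "unit_bicat = \<lparr> Obj = UNIV, Arr = UNIV, Cell = UNIV,
     Src = (\<lambda>_. ()), Tgt = (\<lambda>_. ()), Dom = (\<lambda>_. ()), Cod = (\<lambda>_. ()),
     Id1 = (\<lambda>_. ()), Comp1 = (\<lambda>_ _. ()), Id2 = (\<lambda>_. ()),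
     VComp = (\<lambda>_ _. ()), HComp = (\<lambda>_ _. ()),
     Assoc = (\<lambda>_ _ _. ()), LUnit = (\<lambda>_. ()), RUnit = (\<lambda>_. ()) \<rparr>"

definition prod_bicat ::
    "('o, 'f, 'c) bicat \<Rightarrow> ('p, 'g, 'd) bicat \<Rightarrow> ('o \<times> 'p, 'f \<times> 'g, 'c \<times> 'd) bicat"
    (infixr "\<times>\<^sub>b" 80) where
  "A \<times>\<^sub>b B = \<lparr> Obj = Obj A \<times> Obj B, Arr = Arr A \<times> Arr B, Cell = Cell A \<times> Cell B,
     Src = map_prod (Src A) (Src B), Tgt = map_prod (Tgt A) (Tgt B),
     Dom = map_prod (Dom A) (Dom B), Cod = map_prod (Cod A) (Cod B),
     Id1 = map_prod (Id1 A) (Id1 B),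
     Comp1 = (\<lambda>(g, g') (f, f'). (g \<odot>\<^bsub>A\<^esub> f, g' \<odot>\<^bsub>B\<^esub> f')),
     Id2 = map_prod (Id2 A) (Id2 B),
     VComp = (\<lambda>(\<beta>, \<beta>') (\<alpha>, \<alpha>'). (\<beta> \<bullet>\<^bsub>A\<^esub> \<alpha>, \<beta>' \<bullet>\<^bsub>B\<^esub> \<alpha>')),
     HComp = (\<lambda>(\<beta>, \<beta>') (\<alpha>, \<alpha>'). (\<beta> \<star>\<^bsub>A\<^esub> \<alpha>, \<beta>' \<star>\<^bsub>B\<^esub> \<alpha>')),
     Assoc = (\<lambda>(h, h') (g, g') (f, f'). (Assoc A h g f, Assoc B h' g' f')),
     LUnit = map_prod (LUnit A) (LUnit B),
     RUnit = map_prod (RUnit A) (RUnit B) \<rparr>"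


section \<open>Pseudofunctors\<close>

text \<open>
  \<open>FComp F g f\<close> is the constraint \<open>F g \<odot> F f \<Rightarrow> F (g \<odot> f)\<close> and \<open>FUnit F x\<close> the constraint
  \<open>1\<^bsub>F x\<^esub> \<Rightarrow> F 1\<^sub>x\<close>.
\<close>

record ('o, 'f, 'c, 'p, 'g, 'd) psfun =
  PDom :: "('o, 'f, 'c) bicat"
  PCod :: "('p, 'g, 'd) bicat"
  F0 :: "'o \<Rightarrow> 'p"
  F1 :: "'f \<Rightarrow> 'g"
  F2 :: "'c \<Rightarrow> 'd"
  FComp :: "'f \<Rightarrow> 'f \<Rightarrow> 'd"
  FUnit :: "'o \<Rightarrow> 'd"

locale pseudofunctor = S: bicategory S + T: bicategory T
  for S :: "('o, 'f, 'c) bicat" and T :: "('p, 'g, 'd) bicat" +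
  fixes F :: "('o, 'f, 'c, 'p, 'g, 'd) psfun"
  assumes pdom: "PDom F = S" and pcod: "PCod F = T"
    and f0: "x \<in> Obj S \<Longrightarrow> F0 F x \<in> Obj T"
    and f1: "f \<in> hom1 S x y \<Longrightarrow> F1 F f \<in> hom1 T (F0 F x) (F0 F y)"
    and f2: "\<alpha> \<in> hom2 S f g \<Longrightarrow> F2 F \<alpha> \<in> hom2 T (F1 F f) (F1 F g)"
    and f2_id: "f \<in> Arr S \<Longrightarrow> F2 F (Id2 S f) = Id2 T (F1 F f)"
    and f2_vcomp: "\<lbrakk>\<beta> \<in> hom2 S g h; \<alpha> \<in> hom2 S f g\<rbrakk>
      \<Longrightarrow> F2 F (\<beta> \<bullet>\<^bsub>S\<^esub> \<alpha>) = F2 F \<beta> \<bullet>\<^bsub>T\<^esub> F2 F \<alpha>"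
    and fcomp: "\<lbrakk>g \<in> hom1 S y z; f \<in> hom1 S x y\<rbrakk>
      \<Longrightarrow> FComp F g f \<in> hom2 T (F1 F g \<odot>\<^bsub>T\<^esub> F1 F f) (F1 F (g \<odot>\<^bsub>S\<^esub> f)) \<and> iso2 T (FComp F g f)"
    and fcomp_nat: "\<lbrakk>\<beta> \<in> hom2 S g g'; \<alpha> \<in> hom2 S f f'; Src S g = Tgt S f\<rbrakk>
      \<Longrightarrow> FComp F g' f' \<bullet>\<^bsub>T\<^esub> (F2 F \<beta> \<star>\<^bsub>T\<^esub> F2 F \<alpha>) = F2 F (\<beta> \<star>\<^bsub>S\<^esub> \<alpha>) \<bullet>\<^bsub>T\<^esub> FComp F g f"
    and funit: "x \<in> Obj S
      \<Longrightarrow> FUnit F x \<in> hom2 T (Id1 T (F0 F x)) (F1 F (Id1 S x)) \<and> iso2 T (FUnit F x)"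
    and fassoc: "\<lbrakk>h \<in> hom1 S y z; g \<in> hom1 S x y; f \<in> hom1 S w x\<rbrakk>
      \<Longrightarrow> F2 F (Assoc S h g f) \<bullet>\<^bsub>T\<^esub> FComp F (h \<odot>\<^bsub>S\<^esub> g) f \<bullet>\<^bsub>T\<^esub> (FComp F h g \<star>\<^bsub>T\<^esub> Id2 T (F1 F f))
        = FComp F h (g \<odot>\<^bsub>S\<^esub> f) \<bullet>\<^bsub>T\<^esub> (Id2 T (F1 F h) \<star>\<^bsub>T\<^esub> FComp F g f)
            \<bullet>\<^bsub>T\<^esub> Assoc T (F1 F h) (F1 F g) (F1 F f)"
    and flunit: "f \<in> hom1 S x y
      \<Longrightarrow> F2 F (LUnit S f) \<bullet>\<^bsub>T\<^esub> FComp F (Id1 S y) f \<bullet>\<^bsub>T\<^esub> (FUnit F y \<star>\<^bsub>T\<^esub> Id2 T (F1 F f))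
        = LUnit T (F1 F f)"
    and frunit: "f \<in> hom1 S x y
      \<Longrightarrow> F2 F (RUnit S f) \<bullet>\<^bsub>T\<^esub> FComp F f (Id1 S x) \<bullet>\<^bsub>T\<^esub> (Id2 T (F1 F f) \<star>\<^bsub>T\<^esub> FUnit F x)
        = RUnit T (F1 F f)"

definition pid :: "('o, 'f, 'c) bicat \<Rightarrow> ('o, 'f, 'c, 'o, 'f, 'c) psfun" where
  "pid S = \<lparr> PDom = S, PCod = S, F0 = (\<lambda>x. x), F1 = (\<lambda>f. f), F2 = (\<lambda>\<alpha>. \<alpha>),
     FComp = (\<lambda>g f. Id2 S (g \<odot>\<^bsub>S\<^esub> f)), FUnit = (\<lambda>x. Id2 S (Id1 S x)) \<rparr>"

definition pcomp ::
    "('p, 'g, 'd, 'q, 'h, 'e) psfun \<Rightarrow> ('o, 'f, 'c, 'p, 'g, 'd) psfun \<Rightarrow> ('o, 'f, 'c, 'q, 'h, 'e) psfun"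
    (infixr "\<circ>\<^sub>p" 75) where
  "G \<circ>\<^sub>p F = \<lparr> PDom = PDom F, PCod = PCod G,
     F0 = (\<lambda>x. F0 G (F0 F x)), F1 = (\<lambda>f. F1 G (F1 F f)), F2 = (\<lambda>\<alpha>. F2 G (F2 F \<alpha>)),
     FComp = (\<lambda>g f. F2 G (FComp F g f) \<bullet>\<^bsub>PCod G\<^esub> FComp G (F1 F g) (F1 F f)),
     FUnit = (\<lambda>x. F2 G (FUnit F x) \<bullet>\<^bsub>PCod G\<^esub> FUnit G (F0 F x)) \<rparr>"

definition pfst ::
    "('o, 'f, 'c) bicat \<Rightarrow> ('p, 'g, 'd) bicat \<Rightarrow> ('o \<times> 'p, 'f \<times> 'g, 'c \<times> 'd, 'o, 'f, 'c) psfun" where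
  "pfst A B = \<lparr> PDom = A \<times>\<^sub>b B, PCod = A, F0 = fst, F1 = fst, F2 = fst,
     FComp = (\<lambda>g f. Id2 A (fst g \<odot>\<^bsub>A\<^esub> fst f)), FUnit = (\<lambda>x. Id2 A (Id1 A (fst x))) \<rparr>"

definition psnd ::
    "('o, 'f, 'c) bicat \<Rightarrow> ('p, 'g, 'd) bicat \<Rightarrow> ('o \<times> 'p, 'f \<times> 'g, 'c \<times> 'd, 'p, 'g, 'd) psfun" where
  "psnd A B = \<lparr> PDom = A \<times>\<^sub>b B, PCod = B, F0 = snd, F1 = snd, F2 = snd,
     FComp = (\<lambda>g f. Id2 B (snd g \<odot>\<^bsub>B\<^esub> snd f)), FUnit = (\<lambda>x. Id2 B (Id1 B (snd x))) \<rparr>"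

definition ppair ::
    "('o, 'f, 'c, 'p, 'g, 'd) psfun \<Rightarrow> ('o, 'f, 'c, 'q, 'h, 'e) psfun
      \<Rightarrow> ('o, 'f, 'c, 'p \<times> 'q, 'g \<times> 'h, 'd \<times> 'e) psfun" where
  "ppair F G = \<lparr> PDom = PDom F, PCod = PCod F \<times>\<^sub>b PCod G,
     F0 = (\<lambda>x. (F0 F x, F0 G x)), F1 = (\<lambda>f. (F1 F f, F1 G f)), F2 = (\<lambda>\<alpha>. (F2 F \<alpha>, F2 G \<alpha>)),
     FComp = (\<lambda>g f. (FComp F g f, FComp G g f)), FUnit = (\<lambda>x. (FUnit F x, FUnit G x)) \<rparr>"

definition pconst ::
    "('o, 'f, 'c) bicat \<Rightarrow> ('p, 'g, 'd) bicat \<Rightarrow> 'p \<Rightarrow> ('o, 'f, 'c, 'p, 'g, 'd) psfun" where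
  "pconst S T y = \<lparr> PDom = S, PCod = T, F0 = (\<lambda>_. y), F1 = (\<lambda>_. Id1 T y),
     F2 = (\<lambda>_. Id2 T (Id1 T y)),
     FComp = (\<lambda>_ _. LUnit T (Id1 T y)), FUnit = (\<lambda>_. Id2 T (Id1 T y)) \<rparr>"

definition pbang :: "('o, 'f, 'c) bicat \<Rightarrow> ('o, 'f, 'c, unit, unit, unit) psfun" where
  "pbang S = \<lparr> PDom = S, PCod = unit_bicat, F0 = (\<lambda>_. ()), F1 = (\<lambda>_. ()), F2 = (\<lambda>_. ()),
     FComp = (\<lambda>_ _. ()), FUnit = (\<lambda>_. ()) \<rparr>"


section \<open>Pseudonatural transformations and modifications\<close>

text \<open>
  The naturality constraint of \<open>\<tau> : F \<Rightarrow> G\<close> at \<open>f : x \<rightarrow> y\<close> is an invertible 2-cell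
  \<open>\<tau>\<^sub>y \<odot> F f \<Rightarrow> G f \<odot> \<tau>\<^sub>x\<close>.
\<close>

record ('o, 'f, 'c, 'p, 'g, 'd) pstrans =
  TSrc :: "('o, 'f, 'c, 'p, 'g, 'd) psfun"
  TTgt :: "('o, 'f, 'c, 'p, 'g, 'd) psfun"
  TObj :: "'o \<Rightarrow> 'g"
  TArr :: "'f \<Rightarrow> 'd"

locale pseudo_transformation = F: pseudofunctor S T F + G: pseudofunctor S T G
  for S :: "('o, 'f, 'c) bicat" and T :: "('p, 'g, 'd) bicat"
    and F :: "('o, 'f, 'c, 'p, 'g, 'd) psfun" and G :: "('o, 'f, 'c, 'p, 'g, 'd) psfun" +
  fixes \<tau> :: "('o, 'f, 'c, 'p, 'g, 'd) pstrans"
  assumes tsrc: "TSrc \<tau> = F" and ttgt: "TTgt \<tau> = G"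
    and tobj: "x \<in> Obj S \<Longrightarrow> TObj \<tau> x \<in> hom1 T (F0 F x) (F0 G x)"
    and tarr: "f \<in> hom1 S x y
      \<Longrightarrow> TArr \<tau> f \<in> hom2 T (TObj \<tau> y \<odot>\<^bsub>T\<^esub> F1 F f) (F1 G f \<odot>\<^bsub>T\<^esub> TObj \<tau> x) \<and> iso2 T (TArr \<tau> f)"
    and tarr_nat: "\<lbrakk>f \<in> hom1 S x y; \<alpha> \<in> hom2 S f f'\<rbrakk>
      \<Longrightarrow> TArr \<tau> f' \<bullet>\<^bsub>T\<^esub> (Id2 T (TObj \<tau> y) \<star>\<^bsub>T\<^esub> F2 F \<alpha>)
        = (F2 G \<alpha> \<star>\<^bsub>T\<^esub> Id2 T (TObj \<tau> x)) \<bullet>\<^bsub>T\<^esub> TArr \<tau> f"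
    and tarr_comp: "\<lbrakk>g \<in> hom1 S y z; f \<in> hom1 S x y\<rbrakk>
      \<Longrightarrow> TArr \<tau> (g \<odot>\<^bsub>S\<^esub> f) \<bullet>\<^bsub>T\<^esub> (Id2 T (TObj \<tau> z) \<star>\<^bsub>T\<^esub> FComp F g f)
            \<bullet>\<^bsub>T\<^esub> Assoc T (TObj \<tau> z) (F1 F g) (F1 F f)
        = (FComp G g f \<star>\<^bsub>T\<^esub> Id2 T (TObj \<tau> x))
            \<bullet>\<^bsub>T\<^esub> inv2 T (Assoc T (F1 G g) (F1 G f) (TObj \<tau> x))
            \<bullet>\<^bsub>T\<^esub> (Id2 T (F1 G g) \<star>\<^bsub>T\<^esub> TArr \<tau> f)
            \<bullet>\<^bsub>T\<^esub> Assoc T (F1 G g) (TObj \<tau> y) (F1 F f)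
            \<bullet>\<^bsub>T\<^esub> (TArr \<tau> g \<star>\<^bsub>T\<^esub> Id2 T (F1 F f))"
    and tarr_unit: "x \<in> Obj S
      \<Longrightarrow> TArr \<tau> (Id1 S x) \<bullet>\<^bsub>T\<^esub> (Id2 T (TObj \<tau> x) \<star>\<^bsub>T\<^esub> FUnit F x)
        = (FUnit G x \<star>\<^bsub>T\<^esub> Id2 T (TObj \<tau> x))
            \<bullet>\<^bsub>T\<^esub> inv2 T (LUnit T (TObj \<tau> x)) \<bullet>\<^bsub>T\<^esub> RUnit T (TObj \<tau> x)"

definition tid :: "('o, 'f, 'c, 'p, 'g, 'd) psfun \<Rightarrow> ('o, 'f, 'c, 'p, 'g, 'd) pstrans" where
  "tid F = (let T = PCod F in
     \<lparr> TSrc = F, TTgt = F, TObj = (\<lambda>x. Id1 T (F0 F x)),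
       TArr = (\<lambda>f. inv2 T (RUnit T (F1 F f)) \<bullet>\<^bsub>T\<^esub> LUnit T (F1 F f)) \<rparr>)"

definition tcomp ::
    "('o, 'f, 'c, 'p, 'g, 'd) pstrans \<Rightarrow> ('o, 'f, 'c, 'p, 'g, 'd) pstrans
      \<Rightarrow> ('o, 'f, 'c, 'p, 'g, 'd) pstrans" (infixr "\<circ>\<^sub>t" 70) where
  "\<tau> \<circ>\<^sub>t \<sigma> = (let S = PDom (TSrc \<sigma>); T = PCod (TSrc \<sigma>); F = TSrc \<sigma>; G = TTgt \<sigma>; H = TTgt \<tau> in
     \<lparr> TSrc = F, TTgt = H,
       TObj = (\<lambda>x. TObj \<tau> x \<odot>\<^bsub>T\<^esub> TObj \<sigma> x),
       TArr = (\<lambda>f. let x = Src S f; y = Tgt S f in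
         Assoc T (F1 H f) (TObj \<tau> x) (TObj \<sigma> x)
         \<bullet>\<^bsub>T\<^esub> (TArr \<tau> f \<star>\<^bsub>T\<^esub> Id2 T (TObj \<sigma> x))
         \<bullet>\<^bsub>T\<^esub> inv2 T (Assoc T (TObj \<tau> y) (F1 G f) (TObj \<sigma> x))
         \<bullet>\<^bsub>T\<^esub> (Id2 T (TObj \<tau> y) \<star>\<^bsub>T\<^esub> TArr \<sigma> f)
         \<bullet>\<^bsub>T\<^esub> Assoc T (TObj \<tau> y) (TObj \<sigma> y) (F1 F f)) \<rparr>)"

definition twhisk_l ::
    "('p, 'g, 'd, 'q, 'h, 'e) psfun \<Rightarrow> ('o, 'f, 'c, 'p, 'g, 'd) pstrans
      \<Rightarrow> ('o, 'f, 'c, 'q, 'h, 'e) pstrans" where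
  "twhisk_l G \<tau> = (let S = PDom (TSrc \<tau>); U = PCod G in
     \<lparr> TSrc = G \<circ>\<^sub>p TSrc \<tau>, TTgt = G \<circ>\<^sub>p TTgt \<tau>,
       TObj = (\<lambda>x. F1 G (TObj \<tau> x)),
       TArr = (\<lambda>f. inv2 U (FComp G (F1 (TTgt \<tau>) f) (TObj \<tau> (Src S f)))
         \<bullet>\<^bsub>U\<^esub> F2 G (TArr \<tau> f)
         \<bullet>\<^bsub>U\<^esub> FComp G (TObj \<tau> (Tgt S f)) (F1 (TSrc \<tau>) f)) \<rparr>)"

definition twhisk_r ::
    "('p, 'g, 'd, 'q, 'h, 'e) pstrans \<Rightarrow> ('o, 'f, 'c, 'p, 'g, 'd) psfun
      \<Rightarrow> ('o, 'f, 'c, 'q, 'h, 'e) pstrans" (infixl "\<cdot>\<^sub>t" 80) where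
  "\<tau> \<cdot>\<^sub>t F = \<lparr> TSrc = TSrc \<tau> \<circ>\<^sub>p F, TTgt = TTgt \<tau> \<circ>\<^sub>p F,
     TObj = (\<lambda>x. TObj \<tau> (F0 F x)), TArr = (\<lambda>f. TArr \<tau> (F1 F f)) \<rparr>"

definition tpair ::
    "('o, 'f, 'c, 'p, 'g, 'd) pstrans \<Rightarrow> ('o, 'f, 'c, 'q, 'h, 'e) pstrans
      \<Rightarrow> ('o, 'f, 'c, 'p \<times> 'q, 'g \<times> 'h, 'd \<times> 'e) pstrans" where
  "tpair \<tau> \<sigma> = \<lparr> TSrc = ppair (TSrc \<tau>) (TSrc \<sigma>), TTgt = ppair (TTgt \<tau>) (TTgt \<sigma>),
     TObj = (\<lambda>x. (TObj \<tau> x, TObj \<sigma> x)), TArr = (\<lambda>f. (TArr \<tau> f, TArr \<sigma> f)) \<rparr>"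

text \<open>
  Invertible modifications \<open>\<sigma> \<Rrightarrow> \<tau>\<close>. The source functors of \<open>\<sigma>\<close> and \<open>\<tau>\<close> are not compared as
  records: in the uses below they agree on all cells but are bracketed differently as composites.
\<close>

definition invertible_modification ::
    "('o, 'f, 'c, 'p, 'g, 'd) pstrans \<Rightarrow> ('o, 'f, 'c, 'p, 'g, 'd) pstrans \<Rightarrow> ('o \<Rightarrow> 'd) \<Rightarrow> bool" where
  "invertible_modification \<sigma> \<tau> m \<longleftrightarrow>
    (let S = PDom (TSrc \<sigma>); T = PCod (TSrc \<sigma>); F = TSrc \<sigma>; G = TTgt \<sigma> in
      (\<forall>x \<in> Obj S. m x \<in> hom2 T (TObj \<sigma> x) (TObj \<tau> x) \<and> iso2 T (m x)) \<and>
      (\<forall>x y. \<forall>f \<in> hom1 S x y.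
        TArr \<tau> f \<bullet>\<^bsub>T\<^esub> (m y \<star>\<^bsub>T\<^esub> Id2 T (F1 F f)) = (Id2 T (F1 G f) \<star>\<^bsub>T\<^esub> m x) \<bullet>\<^bsub>T\<^esub> TArr \<sigma> f))"

text \<open>
  Adjoint equivalences in the bicategory of pseudofunctors, pseudonatural transformations and
  modifications from \<open>S\<close> to \<open>T\<close>; all operations on modifications, hence the triangle identities,
  are componentwise.
\<close>

record ('o, 'f, 'c, 'p, 'g, 'd) adjeq =
  Fwd :: "('o, 'f, 'c, 'p, 'g, 'd) pstrans"
  Bwd :: "('o, 'f, 'c, 'p, 'g, 'd) pstrans"
  Eta :: "'o \<Rightarrow> 'd"
  Eps :: "'o \<Rightarrow> 'd"

locale adjoint_equivalence =
  fwd: pseudo_transformation S T F G "Fwd E" + bwd: pseudo_transformation S T G F "Bwd E"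
  for S :: "('o, 'f, 'c) bicat" and T :: "('p, 'g, 'd) bicat"
    and F :: "('o, 'f, 'c, 'p, 'g, 'd) psfun" and G :: "('o, 'f, 'c, 'p, 'g, 'd) psfun"
    and E :: "('o, 'f, 'c, 'p, 'g, 'd) adjeq" +
  assumes eta: "invertible_modification (tid F) (Bwd E \<circ>\<^sub>t Fwd E) (Eta E)"
    and eps: "invertible_modification (Fwd E \<circ>\<^sub>t Bwd E) (tid G) (Eps E)"
    and triangle_fwd: "x \<in> Obj S \<Longrightarrow>
      (let u = TObj (Fwd E) x; v = TObj (Bwd E) x in
        LUnit T u \<bullet>\<^bsub>T\<^esub> (Eps E x \<star>\<^bsub>T\<^esub> Id2 T u) \<bullet>\<^bsub>T\<^esub> inv2 T (Assoc T u v u) \<bullet>\<^bsub>T\<^esub> (Id2 T u \<star>\<^bsub>T\<^esub> Eta E x)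
        = RUnit T u)"
    and triangle_bwd: "x \<in> Obj S \<Longrightarrow>
      (let u = TObj (Fwd E) x; v = TObj (Bwd E) x in
        RUnit T v \<bullet>\<^bsub>T\<^esub> (Id2 T v \<star>\<^bsub>T\<^esub> Eps E x) \<bullet>\<^bsub>T\<^esub> Assoc T v u v \<bullet>\<^bsub>T\<^esub> (Eta E x \<star>\<^bsub>T\<^esub> Id2 T v)
        = LUnit T v)"


section \<open>Pasting along paths of 1-cells\<close>

text \<open>
  The tricategory axioms equate pasting diagrams. A pasting diagram is evaluated by bracketing all
  paths of 1-cells to the right and rebracketing explicitly with the associators. A path
  \<open>[f\<^sub>n, \<dots>, f\<^sub>1]\<close> is listed in functional order.
\<close>

fun path :: "('o, 'f, 'c) bicat \<Rightarrow> 'f list \<Rightarrow> 'f" where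
  "path B [] = undefined"
| "path B [f] = f"
| "path B (g # f # fs) = g \<odot>\<^bsub>B\<^esub> path B (f # fs)"

text \<open>The canonical 2-cell \<open>path B ps \<odot> path B qs \<Rightarrow> path B (ps @ qs)\<close>, for nonempty \<open>ps\<close>, \<open>qs\<close>.\<close>

fun path_append :: "('o, 'f, 'c) bicat \<Rightarrow> 'f list \<Rightarrow> 'f list \<Rightarrow> 'c" where
  "path_append B [] qs = undefined"
| "path_append B [p] qs = Id2 B (p \<odot>\<^bsub>B\<^esub> path B qs)"
| "path_append B (p # p' # ps) qs =
    (Id2 B p \<star>\<^bsub>B\<^esub> path_append B (p' # ps) qs) \<bullet>\<^bsub>B\<^esub> Assoc B p (path B (p' # ps)) (path B qs)"

text \<open>
  For \<open>\<alpha> : path B ps \<Rightarrow> path B qs\<close>, the 2-cell \<open>path B (xs @ ps @ zs) \<Rightarrow> path B (xs @ qs @ zs)\<close>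
  obtained by whiskering \<open>\<alpha>\<close> on both sides (\<open>xs\<close> and \<open>zs\<close> may be empty).
\<close>

definition paste ::
    "('o, 'f, 'c) bicat \<Rightarrow> 'f list \<Rightarrow> 'f list \<Rightarrow> 'c \<Rightarrow> 'f list \<Rightarrow> 'f list \<Rightarrow> 'c" where
  "paste B xs ps \<alpha> qs zs = foldr (\<lambda>x \<beta>. Id2 B x \<star>\<^bsub>B\<^esub> \<beta>) xs
     (if zs = [] then \<alpha>
      else path_append B qs zs \<bullet>\<^bsub>B\<^esub> (\<alpha> \<star>\<^bsub>B\<^esub> Id2 B (path B zs)) \<bullet>\<^bsub>B\<^esub> inv2 B (path_append B ps zs))"

text \<open>The canonical 2-cell \<open>path T (map (F1 F) ps) \<Rightarrow> F1 F (path S ps)\<close>.\<close>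

fun fpath :: "('o, 'f, 'c, 'p, 'g, 'd) psfun \<Rightarrow> 'f list \<Rightarrow> 'd" where
  "fpath F [] = undefined"
| "fpath F [f] = Id2 (PCod F) (F1 F f)"
| "fpath F (g # f # fs) =
    FComp F g (path (PDom F) (f # fs)) \<bullet>\<^bsub>PCod F\<^esub> (Id2 (PCod F) (F1 F g) \<star>\<^bsub>PCod F\<^esub> fpath F (f # fs))"

text \<open>
  For \<open>\<alpha> : path S ps \<Rightarrow> path S qs\<close>, the image of \<open>\<alpha>\<close> under \<open>F\<close>, rebracketed to a 2-cell
  \<open>path T (map (F1 F) ps) \<Rightarrow> path T (map (F1 F) qs)\<close>.
\<close>

definition fcell :: "('o, 'f, 'c, 'p, 'g, 'd) psfun \<Rightarrow> 'f list \<Rightarrow> 'c \<Rightarrow> 'f list \<Rightarrow> 'd" where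
  "fcell F ps \<alpha> qs = inv2 (PCod F) (fpath F qs) \<bullet>\<^bsub>PCod F\<^esub> F2 F \<alpha> \<bullet>\<^bsub>PCod F\<^esub> fpath F ps"


section \<open>Tricategories\<close>

text \<open>
  Gurski's algebraic definition. The composition functor \<open>Ten T a b c\<close> goes from
  \<open>Hom T b c \<times> Hom T a b\<close> to \<open>Hom T a c\<close>; \<open>UnF T a\<close> is the unit functor \<open>1 \<rightarrow> Hom T a a\<close>; \<open>AEq\<close>, \<open>LEq\<close>,
  \<open>REq\<close> are the adjoint equivalences \<open>a\<close>, \<open>l\<close>, \<open>r\<close>; \<open>TPi\<close>, \<open>TMu\<close>, \<open>TLam\<close>, \<open>TRho\<close> are the invertible
  modifications. Tuples of composable 1-cells are listed in functional order and
  object arguments in diagrammatic order, so for \<open>f : a \<rightarrow> b\<close>, \<open>g : b \<rightarrow> c\<close>, \<open>h : c \<rightarrow> d\<close> the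
  associator component is indexed by \<open>a b c d\<close> and \<open>(h, g, f)\<close>.
\<close>

record ('o, 'f, 'g, 'h) tricat =
  TOb :: "'o set"
  Hom :: "'o \<Rightarrow> 'o \<Rightarrow> ('f, 'g, 'h) bicat"
  Ten :: "'o \<Rightarrow> 'o \<Rightarrow> 'o \<Rightarrow> ('f \<times> 'f, 'g \<times> 'g, 'h \<times> 'h, 'f, 'g, 'h) psfun"
  UnF :: "'o \<Rightarrow> (unit, unit, unit, 'f, 'g, 'h) psfun"
  AEq :: "'o \<Rightarrow> 'o \<Rightarrow> 'o \<Rightarrow> 'o
    \<Rightarrow> ('f \<times> 'f \<times> 'f, 'g \<times> 'g \<times> 'g, 'h \<times> 'h \<times> 'h, 'f, 'g, 'h) adjeq"
  LEq :: "'o \<Rightarrow> 'o \<Rightarrow> ('f, 'g, 'h, 'f, 'g, 'h) adjeq"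
  REq :: "'o \<Rightarrow> 'o \<Rightarrow> ('f, 'g, 'h, 'f, 'g, 'h) adjeq"
  TPi :: "'o \<Rightarrow> 'o \<Rightarrow> 'o \<Rightarrow> 'o \<Rightarrow> 'o \<Rightarrow> 'f \<times> 'f \<times> 'f \<times> 'f \<Rightarrow> 'h"
  TMu :: "'o \<Rightarrow> 'o \<Rightarrow> 'o \<Rightarrow> 'f \<times> 'f \<Rightarrow> 'h"
  TLam :: "'o \<Rightarrow> 'o \<Rightarrow> 'o \<Rightarrow> 'f \<times> 'f \<Rightarrow> 'h"
  TRho :: "'o \<Rightarrow> 'o \<Rightarrow> 'o \<Rightarrow> 'f \<times> 'f \<Rightarrow> 'h"

text \<open>
  Pointwise composites of functors and of transformations into hom-bicategories: for
  \<open>G : S \<rightarrow> Hom T b c\<close> and \<open>F : S \<rightarrow> Hom T a b\<close>, \<open>pten T a b c G F\<close> is the composite of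
  \<open>\<langle>G, F\<rangle> : S \<rightarrow> Hom T b c \<times> Hom T a b\<close> with the composition functor. In this notation
  \<open>\<otimes> \<circ> (\<otimes> \<times> 1)\<close> is \<open>(P\<^sub>1 \<otimes> P\<^sub>2) \<otimes> P\<^sub>3\<close> for the product projections \<open>P\<^sub>i\<close>.
\<close>

definition pten ::
    "('o, 'f, 'g, 'h) tricat \<Rightarrow> 'o \<Rightarrow> 'o \<Rightarrow> 'o \<Rightarrow> ('p, 'q, 'r, 'f, 'g, 'h) psfun
      \<Rightarrow> ('p, 'q, 'r, 'f, 'g, 'h) psfun \<Rightarrow> ('p, 'q, 'r, 'f, 'g, 'h) psfun" where
  "pten T a b c G F = Ten T a b c \<circ>\<^sub>p ppair G F"

definition tten ::
    "('o, 'f, 'g, 'h) tricat \<Rightarrow> 'o \<Rightarrow> 'o \<Rightarrow> 'o \<Rightarrow> ('p, 'q, 'r, 'f, 'g, 'h) pstrans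
      \<Rightarrow> ('p, 'q, 'r, 'f, 'g, 'h) pstrans \<Rightarrow> ('p, 'q, 'r, 'f, 'g, 'h) pstrans" where
  "tten T a b c \<tau> \<sigma> = twhisk_l (Ten T a b c) (tpair \<tau> \<sigma>)"

definition punit ::
    "('o, 'f, 'g, 'h) tricat \<Rightarrow> ('p, 'q, 'r) bicat \<Rightarrow> 'o \<Rightarrow> ('p, 'q, 'r, 'f, 'g, 'h) psfun" where
  "punit T S a = UnF T a \<circ>\<^sub>p pbang S"

definition proj3_1 where
  "proj3_1 A B C = pfst A (B \<times>\<^sub>b C)"
definition proj3_2 where
  "proj3_2 A B C = pfst B C \<circ>\<^sub>p psnd A (B \<times>\<^sub>b C)"
definition proj3_3 where
  "proj3_3 A B C = psnd B C \<circ>\<^sub>p psnd A (B \<times>\<^sub>b C)"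

definition proj4_1 where
  "proj4_1 A B C D = pfst A (B \<times>\<^sub>b C \<times>\<^sub>b D)"
definition proj4_2 where
  "proj4_2 A B C D = proj3_1 B C D \<circ>\<^sub>p psnd A (B \<times>\<^sub>b C \<times>\<^sub>b D)"
definition proj4_3 where
  "proj4_3 A B C D = proj3_2 B C D \<circ>\<^sub>p psnd A (B \<times>\<^sub>b C \<times>\<^sub>b D)"
definition proj4_4 where
  "proj4_4 A B C D = proj3_3 B C D \<circ>\<^sub>p psnd A (B \<times>\<^sub>b C \<times>\<^sub>b D)"

text \<open>The functors \<open>\<otimes> \<circ> (\<otimes> \<times> 1)\<close> and \<open>\<otimes> \<circ> (1 \<times> \<otimes>)\<close>.\<close>

definition assoc_src ::
    "('o, 'f, 'g, 'h) tricat \<Rightarrow> 'o \<Rightarrow> 'o \<Rightarrow> 'o \<Rightarrow> 'o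
      \<Rightarrow> ('f \<times> 'f \<times> 'f, 'g \<times> 'g \<times> 'g, 'h \<times> 'h \<times> 'h, 'f, 'g, 'h) psfun" where
  "assoc_src T a b c d = (let X = Hom T c d; Y = Hom T b c; Z = Hom T a b in
     pten T a b d (pten T b c d (proj3_1 X Y Z) (proj3_2 X Y Z)) (proj3_3 X Y Z))"

definition assoc_tgt ::
    "('o, 'f, 'g, 'h) tricat \<Rightarrow> 'o \<Rightarrow> 'o \<Rightarrow> 'o \<Rightarrow> 'o
      \<Rightarrow> ('f \<times> 'f \<times> 'f, 'g \<times> 'g \<times> 'g, 'h \<times> 'h \<times> 'h, 'f, 'g, 'h) psfun" where
  "assoc_tgt T a b c d = (let X = Hom T c d; Y = Hom T b c; Z = Hom T a b in
     pten T a c d (proj3_1 X Y Z) (pten T a b c (proj3_2 X Y Z) (proj3_3 X Y Z)))"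

text \<open>
  \<open>tassoc T a b c d H G F\<close> is the transformation \<open>(H \<otimes> G) \<otimes> F \<Rightarrow> H \<otimes> (G \<otimes> F)\<close> with components
  \<open>a\<^bsub>H x, G x, F x\<^esub>\<close>.
\<close>

definition tassoc where
  "tassoc T a b c d H G F = Fwd (AEq T a b c d) \<cdot>\<^sub>t ppair H (ppair G F)"

definition pi_src ::
    "('o, 'f, 'g, 'h) tricat \<Rightarrow> 'o \<Rightarrow> 'o \<Rightarrow> 'o \<Rightarrow> 'o \<Rightarrow> 'o
      \<Rightarrow> ('f \<times> 'f \<times> 'f \<times> 'f, 'g \<times> 'g \<times> 'g \<times> 'g, 'h \<times> 'h \<times> 'h \<times> 'h, 'f, 'g, 'h) pstrans" where
  "pi_src T a b c d e = (let W = Hom T d e; X = Hom T c d; Y = Hom T b c; Z = Hom T a b;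
       K = proj4_1 W X Y Z; J = proj4_2 W X Y Z; H = proj4_3 W X Y Z; G = proj4_4 W X Y Z in
     tten T a d e (tid K) (tassoc T a b c d J H G)
     \<circ>\<^sub>t tassoc T a b d e K (pten T b c d J H) G
     \<circ>\<^sub>t tten T a b e (tassoc T b c d e K J H) (tid G))"

definition pi_tgt ::
    "('o, 'f, 'g, 'h) tricat \<Rightarrow> 'o \<Rightarrow> 'o \<Rightarrow> 'o \<Rightarrow> 'o \<Rightarrow> 'o
      \<Rightarrow> ('f \<times> 'f \<times> 'f \<times> 'f, 'g \<times> 'g \<times> 'g \<times> 'g, 'h \<times> 'h \<times> 'h \<times> 'h, 'f, 'g, 'h) pstrans" where
  "pi_tgt T a b c d e = (let W = Hom T d e; X = Hom T c d; Y = Hom T b c; Z = Hom T a b;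
       K = proj4_1 W X Y Z; J = proj4_2 W X Y Z; H = proj4_3 W X Y Z; G = proj4_4 W X Y Z in
     tassoc T a c d e K J (pten T a b c H G) \<circ>\<^sub>t tassoc T a b c e (pten T c d e K J) H G)"

definition mu_src ::
    "('o, 'f, 'g, 'h) tricat \<Rightarrow> 'o \<Rightarrow> 'o \<Rightarrow> 'o
      \<Rightarrow> ('f \<times> 'f, 'g \<times> 'g, 'h \<times> 'h, 'f, 'g, 'h) pstrans" where
  "mu_src T a b c = (let X = Hom T b c; Y = Hom T a b; G = pfst X Y; F = psnd X Y in
     tten T a b c (tid G) (Fwd (LEq T a b) \<cdot>\<^sub>t F)
     \<circ>\<^sub>t tassoc T a b b c G (punit T (X \<times>\<^sub>b Y) b) F
     \<circ>\<^sub>t tten T a b c (Bwd (REq T b c) \<cdot>\<^sub>t G) (tid F))"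

definition mu_tgt ::
    "('o, 'f, 'g, 'h) tricat \<Rightarrow> 'o \<Rightarrow> 'o \<Rightarrow> 'o
      \<Rightarrow> ('f \<times> 'f, 'g \<times> 'g, 'h \<times> 'h, 'f, 'g, 'h) pstrans" where
  "mu_tgt T a b c = tid (Ten T a b c)"

definition lam_src ::
    "('o, 'f, 'g, 'h) tricat \<Rightarrow> 'o \<Rightarrow> 'o \<Rightarrow> 'o
      \<Rightarrow> ('f \<times> 'f, 'g \<times> 'g, 'h \<times> 'h, 'f, 'g, 'h) pstrans" where
  "lam_src T a b c = (let X = Hom T b c; Y = Hom T a b; G = pfst X Y; F = psnd X Y in
     tten T a b c (Fwd (LEq T b c) \<cdot>\<^sub>t G) (tid F))"

definition lam_tgt ::
    "('o, 'f, 'g, 'h) tricat \<Rightarrow> 'o \<Rightarrow> 'o \<Rightarrow> 'o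
      \<Rightarrow> ('f \<times> 'f, 'g \<times> 'g, 'h \<times> 'h, 'f, 'g, 'h) pstrans" where
  "lam_tgt T a b c = (let X = Hom T b c; Y = Hom T a b; G = pfst X Y; F = psnd X Y in
     (Fwd (LEq T a c) \<cdot>\<^sub>t Ten T a b c) \<circ>\<^sub>t tassoc T a b c c (punit T (X \<times>\<^sub>b Y) c) G F)"

definition rho_src ::
    "('o, 'f, 'g, 'h) tricat \<Rightarrow> 'o \<Rightarrow> 'o \<Rightarrow> 'o
      \<Rightarrow> ('f \<times> 'f, 'g \<times> 'g, 'h \<times> 'h, 'f, 'g, 'h) pstrans" where
  "rho_src T a b c = (let X = Hom T b c; Y = Hom T a b; G = pfst X Y; F = psnd X Y in
     tten T a b c (tid G) (Bwd (REq T a b) \<cdot>\<^sub>t F))"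

definition rho_tgt ::
    "('o, 'f, 'g, 'h) tricat \<Rightarrow> 'o \<Rightarrow> 'o \<Rightarrow> 'o
      \<Rightarrow> ('f \<times> 'f, 'g \<times> 'g, 'h \<times> 'h, 'f, 'g, 'h) pstrans" where
  "rho_tgt T a b c = (let X = Hom T b c; Y = Hom T a b; G = pfst X Y; F = psnd X Y in
     tassoc T a a b c G F (punit T (X \<times>\<^sub>b Y) a) \<circ>\<^sub>t (Bwd (REq T a c) \<cdot>\<^sub>t Ten T a b c))"

text \<open>
  Components, for use in the axioms: composition of 1-cells, 2-cells and 3-cells along objects, the
  unit 1-cell, and the components of \<open>a\<close>, \<open>l\<close> and the adjoint inverse \<open>r\<^sup>\<bullet>\<close> of \<open>r\<close>.
\<close>

definition ten0 where "ten0 T a b c g f = F0 (Ten T a b c) (g, f)"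
definition ten1 where "ten1 T a b c y x = F1 (Ten T a b c) (y, x)"
definition ten2 where "ten2 T a b c \<beta> \<alpha> = F2 (Ten T a b c) (\<beta>, \<alpha>)"
definition un0 where "un0 T a = F0 (UnF T a) ()"
definition ac where "ac T a b c d h g f = TObj (Fwd (AEq T a b c d)) (h, g, f)"
definition lc where "lc T a b f = TObj (Fwd (LEq T a b)) f"
definition rc' where "rc' T a b f = TObj (Bwd (REq T a b)) f"

text \<open>
  The functors \<open>1\<^sub>k \<otimes> - : Hom T a b \<rightarrow> Hom T a c\<close> for \<open>k : b \<rightarrow> c\<close> and
  \<open>- \<otimes> 1\<^sub>f : Hom T b c \<rightarrow> Hom T a c\<close> for \<open>f : a \<rightarrow> b\<close>.
\<close>

definition lwhisk where
  "lwhisk T a b c k = pten T a b c (pconst (Hom T a b) (Hom T b c) k) (pid (Hom T a b))"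
definition rwhisk where
  "rwhisk T a b c f = pten T a b c (pid (Hom T b c)) (pconst (Hom T b c) (Hom T a b) f)"

text \<open>
  Naturality of \<open>a\<close> in each variable separately. For \<open>f : a \<rightarrow> b\<close>, \<open>g : b \<rightarrow> c\<close>, \<open>h : c \<rightarrow> d\<close> and 2-cells
  \<open>x : f \<Rightarrow> f'\<close>, \<open>y : g \<Rightarrow> g'\<close>, \<open>z : h \<Rightarrow> h'\<close> these are 3-cells
    \<open>(1\<^sub>h \<otimes> (1\<^sub>g \<otimes> x)) \<odot> a \<Rrightarrow> a \<odot> (1\<^bsub>h \<otimes> g\<^esub> \<otimes> x)\<close>,
    \<open>a \<odot> ((1\<^sub>h \<otimes> y) \<otimes> 1\<^sub>f) \<Rrightarrow> (1\<^sub>h \<otimes> (y \<otimes> 1\<^sub>f)) \<odot> a\<close> and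
    \<open>a \<odot> ((z \<otimes> 1\<^sub>g) \<otimes> 1\<^sub>f) \<Rrightarrow> (z \<otimes> 1\<^bsub>g \<otimes> f\<^esub>) \<odot> a\<close>,
  where the first and the last also use the unit constraint of the composition functor.
\<close>

definition nat_f where
  "nat_f T a b c d h g x = (let H = Hom T a d; f' = Tgt (Hom T a b) x in
     (Id2 H (ac T a b c d h g f')
        \<star>\<^bsub>H\<^esub> ten2 T a b d (inv2 (Hom T b d) (FUnit (Ten T b c d) (h, g))) (Id2 (Hom T a b) x))
     \<bullet>\<^bsub>H\<^esub> inv2 H (TArr (Fwd (AEq T a b c d)) (Id1 (Hom T c d) h, Id1 (Hom T b c) g, x)))"

definition nat_g where
  "nat_g T a b c d h y f =
     TArr (Fwd (AEq T a b c d)) (Id1 (Hom T c d) h, y, Id1 (Hom T a b) f)"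

definition nat_h where
  "nat_h T a b c d z g f = (let H = Hom T a d; h = Src (Hom T c d) z in
     (ten2 T a c d (Id2 (Hom T c d) z) (inv2 (Hom T a c) (FUnit (Ten T a b c) (g, f)))
        \<star>\<^bsub>H\<^esub> Id2 H (ac T a b c d h g f))
     \<bullet>\<^bsub>H\<^esub> TArr (Fwd (AEq T a b c d)) (z, Id1 (Hom T b c) g, Id1 (Hom T a b) f))"

text \<open>
  The nonabelian 4-cocycle condition, for \<open>p \<rightarrow> q \<rightarrow> r \<rightarrow> s \<rightarrow> t \<rightarrow> u\<close> via \<open>f, g, h, j, k\<close>. Both sides are
  3-cells from the longest to the shortest path \<open>(((k j) h) g) f \<rightarrow> k (j (h (g f)))\<close> of associators;
  the step performed first is written last. Names such as \<open>a_kj_hg_f\<close> stand for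
  \<open>a\<^bsub>kj, hg, f\<^esub>\<close>.
\<close>

definition tricat_pentagon ::
    "('o, 'f, 'g, 'h) tricat \<Rightarrow> 'o \<Rightarrow> 'o \<Rightarrow> 'o \<Rightarrow> 'o \<Rightarrow> 'o \<Rightarrow> 'o \<Rightarrow> 'f \<Rightarrow> 'f \<Rightarrow> 'f \<Rightarrow> 'f \<Rightarrow> 'f \<Rightarrow> bool" where
  "tricat_pentagon T p q r s t u k j h g f = (let
      H = Hom T p u;
      gf = ten0 T p q r g f; hg = ten0 T q r s h g; jh = ten0 T r s t j h; kj = ten0 T s t u k j;
      h_gf = ten0 T p r s h gf; hg_f = ten0 T p q s hg f;
      j_hg = ten0 T q s t j hg; jh_g = ten0 T q r t jh g;
      k_jh = ten0 T r t u k jh; kj_h = ten0 T r s u kj h;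
      a_h_g_f = ac T p q r s h g f;
      a_j_h_g = ac T q r s t j h g;
      a_k_j_h = ac T r s t u k j h;
      a_jh_g_f = ac T p q r t jh g f;
      a_j_hg_f = ac T p q s t j hg f;
      a_j_h_gf = ac T p r s t j h gf;
      a_kj_h_g = ac T q r s u kj h g;
      a_k_jh_g = ac T q r t u k jh g;
      a_k_j_hg = ac T q s t u k j hg;
      a_kj_h_gf = ac T p r s u kj h gf;
      a_kj_hg_f = ac T p q s u kj hg f;
      a_k_jh_gf = ac T p r t u k jh gf;
      a_kjhleft_g_f = ac T p q r u kj_h g f;
      a_kjhright_g_f = ac T p q r u k_jh g f;
      a_k_jhgleft_f = ac T p q t u k jh_g f;
      a_k_jhgright_f = ac T p q t u k j_hg f;
      a_k_j_hgfleft = ac T p s t u k j hg_f;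
      a_k_j_hgfright = ac T p s t u k j h_gf;
      K = F1 (lwhisk T p t u k); K' = F1 (lwhisk T q t u k); J = F1 (lwhisk T p s t j);
      KJ = F1 (lwhisk T p s u kj);
      F = F1 (rwhisk T p q u f); F' = F1 (rwhisk T p q t f); G = F1 (rwhisk T q r u g);
      GF = F1 (rwhisk T p r u gf)
    in
      paste H [a_k_j_hgfright]
        [KJ a_h_g_f, a_kj_hg_f, F a_kj_h_g] (TPi T p q r s u (kj, h, g, f)) [a_kj_h_gf, a_kjhleft_g_f]
        []
      \<bullet>\<^bsub>H\<^esub> paste H []
        [K (J a_h_g_f), a_k_j_hgfleft] (nat_f T p s t u k j a_h_g_f) [a_k_j_hgfright, KJ a_h_g_f]
        [a_kj_hg_f, F a_kj_h_g]
      \<bullet>\<^bsub>H\<^esub> paste H [K (J a_h_g_f)]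
        [K a_j_hg_f, a_k_jhgright_f, F a_k_j_hg] (TPi T p q s t u (k, j, hg, f)) [a_k_j_hgfleft, a_kj_hg_f]
        [F a_kj_h_g]
      \<bullet>\<^bsub>H\<^esub> paste H [K (J a_h_g_f), K a_j_hg_f, a_k_jhgright_f]
        [F (K' a_j_h_g), F a_k_jh_g, F (G a_k_j_h)]
        (fcell (rwhisk T p q u f)
          [K' a_j_h_g, a_k_jh_g, G a_k_j_h] (TPi T q r s t u (k, j, h, g)) [a_k_j_hg, a_kj_h_g])
        [F a_k_j_hg, F a_kj_h_g]
        []
    =
      paste H []
        [K a_j_h_gf, a_k_jh_gf, GF a_k_j_h] (TPi T p r s t u (k, j, h, gf)) [a_k_j_hgfright, a_kj_h_gf]
        [a_kjhleft_g_f]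
      \<bullet>\<^bsub>H\<^esub> paste H [K a_j_h_gf, a_k_jh_gf]
        [a_kjhright_g_f, F (G a_k_j_h)] (nat_h T p q r u a_k_j_h g f) [GF a_k_j_h, a_kjhleft_g_f]
        []
      \<bullet>\<^bsub>H\<^esub> paste H [K a_j_h_gf]
        [K a_jh_g_f, a_k_jhgleft_f, F a_k_jh_g] (TPi T p q r t u (k, jh, g, f)) [a_k_jh_gf, a_kjhright_g_f]
        [F (G a_k_j_h)]
      \<bullet>\<^bsub>H\<^esub> paste H []
        [K (J a_h_g_f), K a_j_hg_f, K (F' a_j_h_g)]
        (fcell (lwhisk T p t u k)
          [J a_h_g_f, a_j_hg_f, F' a_j_h_g] (TPi T p q r s t (j, h, g, f)) [a_j_h_gf, a_jh_g_f])
        [K a_j_h_gf, K a_jh_g_f]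
        [a_k_jhgleft_f, F a_k_jh_g, F (G a_k_j_h)]
      \<bullet>\<^bsub>H\<^esub> paste H [K (J a_h_g_f), K a_j_hg_f]
        [a_k_jhgright_f, F (K' a_j_h_g)] (nat_g T p q t u k a_j_h_g f) [K (F' a_j_h_g), a_k_jhgleft_f]
        [F a_k_jh_g, F (G a_k_j_h)])"

text \<open>
  The left and right normalization axioms, for \<open>p \<rightarrow> q \<rightarrow> r \<rightarrow> s\<close> via \<open>f, g, h\<close>. The first equates two 3-cells
  \<open>a \<odot> ((1\<^sub>h \<otimes> l\<^sub>g) \<otimes> 1\<^sub>f) \<odot> (a\<^bsub>h, I, g\<^esub> \<otimes> 1\<^sub>f) \<odot> ((r\<^sup>\<bullet>\<^sub>h \<otimes> 1\<^sub>g) \<otimes> 1\<^sub>f) \<Rrightarrow> a\<close>, the second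
  two 3-cells
  \<open>(1\<^sub>h \<otimes> (1\<^sub>g \<otimes> l\<^sub>f)) \<odot> (1\<^sub>h \<otimes> a\<^bsub>g, I, f\<^esub>) \<odot> (1\<^sub>h \<otimes> (r\<^sup>\<bullet>\<^sub>g \<otimes> 1\<^sub>f)) \<odot> a \<Rrightarrow> a\<close>, with \<open>a = a\<^bsub>h, g, f\<^esub>\<close>.
\<close>

definition tricat_left_normal ::
    "('o, 'f, 'g, 'h) tricat \<Rightarrow> 'o \<Rightarrow> 'o \<Rightarrow> 'o \<Rightarrow> 'o \<Rightarrow> 'f \<Rightarrow> 'f \<Rightarrow> 'f \<Rightarrow> bool" where
  "tricat_left_normal T p q r s h g f = (let
      H = Hom T p s; i = un0 T r;
      gf = ten0 T p q r g f; hg = ten0 T q r s h g; ig = ten0 T q r r i g; hi = ten0 T r r s h i;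
      h_gf = ten0 T p r s h gf; hg_f = ten0 T p q s hg f;
      a_h_g_f = ac T p q r s h g f;
      a_i_g_f = ac T p q r r i g f;
      a_h_i_g = ac T q r r s h i g;
      a_h_ig_f = ac T p q r s h ig f;
      a_hi_g_f = ac T p q r s hi g f;
      a_h_i_gf = ac T p r r s h i gf;
      l_g = lc T q r g; l_gf = lc T p r gf; r_h = rc' T r s h;
      HL = F1 (lwhisk T p r s h); HL' = F1 (lwhisk T q r s h);
      F = F1 (rwhisk T p q s f); F' = F1 (rwhisk T p q r f);
      G = F1 (rwhisk T q r s g); GF = F1 (rwhisk T p r s gf)
    in
      RUnit H a_h_g_f
      \<bullet>\<^bsub>H\<^esub> (Id2 H a_h_g_f \<star>\<^bsub>H\<^esub> inv2 H (FUnit (rwhisk T p q s f) hg))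
      \<bullet>\<^bsub>H\<^esub> paste H [a_h_g_f]
        [F (HL' l_g), F a_h_i_g, F (G r_h)]
        (fcell (rwhisk T p q s f)
          [HL' l_g, a_h_i_g, G r_h] (TMu T q r s (h, g)) [Id1 (Hom T q s) hg])
        [F (Id1 (Hom T q s) hg)]
        []
    =
      LUnit H a_h_g_f
      \<bullet>\<^bsub>H\<^esub> paste H []
        [HL l_gf, a_h_i_gf, GF r_h] (TMu T p r s (h, gf)) [Id1 H h_gf]
        [a_h_g_f]
      \<bullet>\<^bsub>H\<^esub> paste H [HL l_gf, a_h_i_gf]
        [a_hi_g_f, F (G r_h)] (nat_h T p q r s r_h g f) [GF r_h, a_h_g_f]
        []
      \<bullet>\<^bsub>H\<^esub> paste H [HL l_gf]
        [HL a_i_g_f, a_h_ig_f, F a_h_i_g] (TPi T p q r r s (h, i, g, f)) [a_h_i_gf, a_hi_g_f]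
        [F (G r_h)]
      \<bullet>\<^bsub>H\<^esub> paste H []
        [HL (F' l_g)]
        (fcell (lwhisk T p r s h) [F' l_g] (TLam T p q r (g, f)) [l_gf, a_i_g_f])
        [HL l_gf, HL a_i_g_f]
        [a_h_ig_f, F a_h_i_g, F (G r_h)]
      \<bullet>\<^bsub>H\<^esub> paste H []
        [a_h_g_f, F (HL' l_g)] (nat_g T p q r s h l_g f) [HL (F' l_g), a_h_ig_f]
        [F a_h_i_g, F (G r_h)])"

definition tricat_right_normal ::
    "('o, 'f, 'g, 'h) tricat \<Rightarrow> 'o \<Rightarrow> 'o \<Rightarrow> 'o \<Rightarrow> 'o \<Rightarrow> 'f \<Rightarrow> 'f \<Rightarrow> 'f \<Rightarrow> bool" where
  "tricat_right_normal T p q r s h g f = (let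
      H = Hom T p s; i = un0 T q;
      gf = ten0 T p q r g f; hg = ten0 T q r s h g; gi = ten0 T q q r g i; if' = ten0 T p q q i f;
      h_gf = ten0 T p r s h gf; hg_f = ten0 T p q s hg f;
      a_h_g_f = ac T p q r s h g f;
      a_g_i_f = ac T p q q r g i f;
      a_h_g_i = ac T q q r s h g i;
      a_h_gi_f = ac T p q r s h gi f;
      a_h_g_if = ac T p q r s h g if';
      a_hg_i_f = ac T p q q s hg i f;
      l_f = lc T p q f; r_g = rc' T q r g; r_hg = rc' T q s hg;
      HL = F1 (lwhisk T p r s h); HL' = F1 (lwhisk T q r s h);
      GL = F1 (lwhisk T p q r g); HGL = F1 (lwhisk T p q s hg);
      F = F1 (rwhisk T p q s f); F' = F1 (rwhisk T p q r f)
    in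
      LUnit H a_h_g_f
      \<bullet>\<^bsub>H\<^esub> (inv2 H (FUnit (lwhisk T p r s h) gf) \<star>\<^bsub>H\<^esub> Id2 H a_h_g_f)
      \<bullet>\<^bsub>H\<^esub> paste H []
        [HL (GL l_f), HL a_g_i_f, HL (F' r_g)]
        (fcell (lwhisk T p r s h)
          [GL l_f, a_g_i_f, F' r_g] (TMu T p q r (g, f)) [Id1 (Hom T p r) gf])
        [HL (Id1 (Hom T p r) gf)]
        [a_h_g_f]
    =
      RUnit H a_h_g_f
      \<bullet>\<^bsub>H\<^esub> paste H [a_h_g_f]
        [HGL l_f, a_hg_i_f, F r_hg] (TMu T p q s (hg, f)) [Id1 H hg_f]
        []
      \<bullet>\<^bsub>H\<^esub> paste H []
        [HL (GL l_f), a_h_g_if] (nat_f T p q r s h g l_f) [a_h_g_f, HGL l_f]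
        [a_hg_i_f, F r_hg]
      \<bullet>\<^bsub>H\<^esub> paste H [HL (GL l_f)]
        [HL a_g_i_f, a_h_gi_f, F a_h_g_i] (TPi T p q q r s (h, g, i, f)) [a_h_g_if, a_hg_i_f]
        [F r_hg]
      \<bullet>\<^bsub>H\<^esub> paste H [HL (GL l_f), HL a_g_i_f, a_h_gi_f]
        [F (HL' r_g)]
        (fcell (rwhisk T p q s f) [HL' r_g] (TRho T q r s (h, g)) [a_h_g_i, r_hg])
        [F a_h_g_i, F r_hg]
        []
      \<bullet>\<^bsub>H\<^esub> paste H [HL (GL l_f), HL a_g_i_f]
        [HL (F' r_g), a_h_g_f] (inv2 H (nat_g T p q r s h r_g f)) [a_h_gi_f, F (HL' r_g)]
        [])"

locale tricategory =
  fixes T :: "('o, 'f, 'g, 'h) tricat"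
  assumes hom_bicat: "\<lbrakk>a \<in> TOb T; b \<in> TOb T\<rbrakk> \<Longrightarrow> bicategory (Hom T a b)"
    and ten: "\<lbrakk>a \<in> TOb T; b \<in> TOb T; c \<in> TOb T\<rbrakk>
      \<Longrightarrow> pseudofunctor (Hom T b c \<times>\<^sub>b Hom T a b) (Hom T a c) (Ten T a b c)"
    and un: "a \<in> TOb T \<Longrightarrow> pseudofunctor unit_bicat (Hom T a a) (UnF T a)"
    and assoc_eq: "\<lbrakk>a \<in> TOb T; b \<in> TOb T; c \<in> TOb T; d \<in> TOb T\<rbrakk>
      \<Longrightarrow> adjoint_equivalence (Hom T c d \<times>\<^sub>b Hom T b c \<times>\<^sub>b Hom T a b) (Hom T a d)
            (assoc_src T a b c d) (assoc_tgt T a b c d) (AEq T a b c d)"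
    and left_eq: "\<lbrakk>a \<in> TOb T; b \<in> TOb T\<rbrakk>
      \<Longrightarrow> adjoint_equivalence (Hom T a b) (Hom T a b)
            (pten T a b b (punit T (Hom T a b) b) (pid (Hom T a b))) (pid (Hom T a b)) (LEq T a b)"
    and right_eq: "\<lbrakk>a \<in> TOb T; b \<in> TOb T\<rbrakk>
      \<Longrightarrow> adjoint_equivalence (Hom T a b) (Hom T a b)
            (pten T a a b (pid (Hom T a b)) (punit T (Hom T a b) a)) (pid (Hom T a b)) (REq T a b)"
    and pi: "\<lbrakk>a \<in> TOb T; b \<in> TOb T; c \<in> TOb T; d \<in> TOb T; e \<in> TOb T\<rbrakk>
      \<Longrightarrow> invertible_modification (pi_src T a b c d e) (pi_tgt T a b c d e) (TPi T a b c d e)"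
    and mu: "\<lbrakk>a \<in> TOb T; b \<in> TOb T; c \<in> TOb T\<rbrakk>
      \<Longrightarrow> invertible_modification (mu_src T a b c) (mu_tgt T a b c) (TMu T a b c)"
    and lam: "\<lbrakk>a \<in> TOb T; b \<in> TOb T; c \<in> TOb T\<rbrakk>
      \<Longrightarrow> invertible_modification (lam_src T a b c) (lam_tgt T a b c) (TLam T a b c)"
    and rho: "\<lbrakk>a \<in> TOb T; b \<in> TOb T; c \<in> TOb T\<rbrakk>
      \<Longrightarrow> invertible_modification (rho_src T a b c) (rho_tgt T a b c) (TRho T a b c)"
    and cocycle: "\<lbrakk>p \<in> TOb T; q \<in> TOb T; r \<in> TOb T; s \<in> TOb T; t \<in> TOb T; u \<in> TOb T;
        k \<in> Obj (Hom T t u); j \<in> Obj (Hom T s t); h \<in> Obj (Hom T r s);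
        g \<in> Obj (Hom T q r); f \<in> Obj (Hom T p q)\<rbrakk>
      \<Longrightarrow> tricat_pentagon T p q r s t u k j h g f"
    and left_normal: "\<lbrakk>p \<in> TOb T; q \<in> TOb T; r \<in> TOb T; s \<in> TOb T;
        h \<in> Obj (Hom T r s); g \<in> Obj (Hom T q r); f \<in> Obj (Hom T p q)\<rbrakk>
      \<Longrightarrow> tricat_left_normal T p q r s h g f"
    and right_normal: "\<lbrakk>p \<in> TOb T; q \<in> TOb T; r \<in> TOb T; s \<in> TOb T;
        h \<in> Obj (Hom T r s); g \<in> Obj (Hom T q r); f \<in> Obj (Hom T p q)\<rbrakk>
      \<Longrightarrow> tricat_right_normal T p q r s h g f"

definition doubly_degenerate :: "('o, 'f, 'g, 'h) tricat \<Rightarrow> 'o \<Rightarrow> 'f \<Rightarrow> bool" where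
  "doubly_degenerate T z e \<longleftrightarrow> TOb T = {z} \<and> Obj (Hom T z z) = {e}"


section \<open>Monoidal categories, multiplications and braidings\<close>

record ('a, 'm) mcat =
  MOb :: "'a set"
  MMor :: "'m set"
  MDom :: "'m \<Rightarrow> 'a"
  MCod :: "'m \<Rightarrow> 'a"
  MId :: "'a \<Rightarrow> 'm"
  MComp :: "'m \<Rightarrow> 'm \<Rightarrow> 'm" (infixr "\<cdot>\<index>" 60)
  MUnit :: "'a"
  MTen0 :: "'a \<Rightarrow> 'a \<Rightarrow> 'a" (infixr "\<otimes>\<index>" 75)
  MTen1 :: "'m \<Rightarrow> 'm \<Rightarrow> 'm" (infixr "\<otimes>\<^sub>m\<index>" 70)
  MAssoc :: "'a \<Rightarrow> 'a \<Rightarrow> 'a \<Rightarrow> 'm"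
  MLUnit :: "'a \<Rightarrow> 'm"
  MRUnit :: "'a \<Rightarrow> 'm"

definition mhom :: "('a, 'm) mcat \<Rightarrow> 'a \<Rightarrow> 'a \<Rightarrow> 'm set" where
  "mhom M a b = {u \<in> MMor M. MDom M u = a \<and> MCod M u = b}"

definition minverse :: "('a, 'm) mcat \<Rightarrow> 'm \<Rightarrow> 'm \<Rightarrow> bool" where
  "minverse M u v \<longleftrightarrow> u \<in> MMor M \<and> v \<in> mhom M (MCod M u) (MDom M u) \<and>
     v \<cdot>\<^bsub>M\<^esub> u = MId M (MDom M u) \<and> u \<cdot>\<^bsub>M\<^esub> v = MId M (MCod M u)"

definition miso :: "('a, 'm) mcat \<Rightarrow> 'm \<Rightarrow> bool" where
  "miso M u \<longleftrightarrow> (\<exists>v. minverse M u v)"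

definition minv :: "('a, 'm) mcat \<Rightarrow> 'm \<Rightarrow> 'm" where
  "minv M u = (THE v. minverse M u v)"

locale monoidal_category =
  fixes M :: "('a, 'm) mcat" (structure)
  assumes dom_cod: "u \<in> MMor M \<Longrightarrow> MDom M u \<in> MOb M \<and> MCod M u \<in> MOb M"
    and ident: "a \<in> MOb M \<Longrightarrow> MId M a \<in> mhom M a a"
    and comp: "\<lbrakk>v \<in> mhom M b c; u \<in> mhom M a b\<rbrakk> \<Longrightarrow> v \<cdot> u \<in> mhom M a c"
    and comp_id: "u \<in> mhom M a b \<Longrightarrow> u \<cdot> MId M a = u \<and> MId M b \<cdot> u = u"
    and comp_assoc: "\<lbrakk>w \<in> mhom M c d; v \<in> mhom M b c; u \<in> mhom M a b\<rbrakk>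
      \<Longrightarrow> (w \<cdot> v) \<cdot> u = w \<cdot> (v \<cdot> u)"
    and unit: "MUnit M \<in> MOb M"
    and ten0: "\<lbrakk>a \<in> MOb M; b \<in> MOb M\<rbrakk> \<Longrightarrow> a \<otimes> b \<in> MOb M"
    and ten1: "\<lbrakk>u \<in> mhom M a a'; v \<in> mhom M b b'\<rbrakk> \<Longrightarrow> u \<otimes>\<^sub>m v \<in> mhom M (a \<otimes> b) (a' \<otimes> b')"
    and ten1_id: "\<lbrakk>a \<in> MOb M; b \<in> MOb M\<rbrakk> \<Longrightarrow> MId M a \<otimes>\<^sub>m MId M b = MId M (a \<otimes> b)"
    and ten1_comp: "\<lbrakk>u' \<in> mhom M a' a''; u \<in> mhom M a a'; v' \<in> mhom M b' b''; v \<in> mhom M b b'\<rbrakk>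
      \<Longrightarrow> (u' \<cdot> u) \<otimes>\<^sub>m (v' \<cdot> v) = (u' \<otimes>\<^sub>m v') \<cdot> (u \<otimes>\<^sub>m v)"
    and assoc: "\<lbrakk>a \<in> MOb M; b \<in> MOb M; c \<in> MOb M\<rbrakk>
      \<Longrightarrow> MAssoc M a b c \<in> mhom M ((a \<otimes> b) \<otimes> c) (a \<otimes> (b \<otimes> c)) \<and> miso M (MAssoc M a b c)"
    and assoc_nat: "\<lbrakk>u \<in> mhom M a a'; v \<in> mhom M b b'; w \<in> mhom M c c'\<rbrakk>
      \<Longrightarrow> MAssoc M a' b' c' \<cdot> ((u \<otimes>\<^sub>m v) \<otimes>\<^sub>m w) = (u \<otimes>\<^sub>m (v \<otimes>\<^sub>m w)) \<cdot> MAssoc M a b c"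
    and lunit: "a \<in> MOb M \<Longrightarrow> MLUnit M a \<in> mhom M (MUnit M \<otimes> a) a \<and> miso M (MLUnit M a)"
    and lunit_nat: "u \<in> mhom M a b
      \<Longrightarrow> MLUnit M b \<cdot> (MId M (MUnit M) \<otimes>\<^sub>m u) = u \<cdot> MLUnit M a"
    and runit: "a \<in> MOb M \<Longrightarrow> MRUnit M a \<in> mhom M (a \<otimes> MUnit M) a \<and> miso M (MRUnit M a)"
    and runit_nat: "u \<in> mhom M a b
      \<Longrightarrow> MRUnit M b \<cdot> (u \<otimes>\<^sub>m MId M (MUnit M)) = u \<cdot> MRUnit M a"
    and pentagon: "\<lbrakk>a \<in> MOb M; b \<in> MOb M; c \<in> MOb M; d \<in> MOb M\<rbrakk>
      \<Longrightarrow> (MId M a \<otimes>\<^sub>m MAssoc M b c d) \<cdot> MAssoc M a (b \<otimes> c) d \<cdot> (MAssoc M a b c \<otimes>\<^sub>m MId M d)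
        = MAssoc M a b (c \<otimes> d) \<cdot> MAssoc M (a \<otimes> b) c d"
    and triangle: "\<lbrakk>a \<in> MOb M; b \<in> MOb M\<rbrakk>
      \<Longrightarrow> (MId M a \<otimes>\<^sub>m MLUnit M b) \<cdot> MAssoc M a (MUnit M) b = MRUnit M a \<otimes>\<^sub>m MId M b"

text \<open>The monoidal category of endomorphisms of the object \<open>x\<close> of a one-object bicategory.\<close>

definition deloop :: "('o, 'f, 'c) bicat \<Rightarrow> 'o \<Rightarrow> ('f, 'c) mcat" where
  "deloop B x = \<lparr> MOb = Arr B, MMor = Cell B, MDom = Dom B, MCod = Cod B,
     MId = Id2 B, MComp = VComp B, MUnit = Id1 B x, MTen0 = Comp1 B, MTen1 = HComp B,
     MAssoc = Assoc B, MLUnit = LUnit B, MRUnit = RUnit B \<rparr>"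

definition prod_mcat :: "('a, 'm) mcat \<Rightarrow> ('b, 'n) mcat \<Rightarrow> ('a \<times> 'b, 'm \<times> 'n) mcat"
    (infixr "\<times>\<^sub>m" 80) where
  "M \<times>\<^sub>m N = \<lparr> MOb = MOb M \<times> MOb N, MMor = MMor M \<times> MMor N,
     MDom = map_prod (MDom M) (MDom N), MCod = map_prod (MCod M) (MCod N),
     MId = map_prod (MId M) (MId N),
     MComp = (\<lambda>(v, v') (u, u'). (v \<cdot>\<^bsub>M\<^esub> u, v' \<cdot>\<^bsub>N\<^esub> u')),
     MUnit = (MUnit M, MUnit N),
     MTen0 = (\<lambda>(a, a') (b, b'). (a \<otimes>\<^bsub>M\<^esub> b, a' \<otimes>\<^bsub>N\<^esub> b')),
     MTen1 = (\<lambda>(u, u') (v, v'). (u \<otimes>\<^sub>m\<^bsub>M\<^esub> v, u' \<otimes>\<^sub>m\<^bsub>N\<^esub> v')),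
     MAssoc = (\<lambda>(a, a') (b, b') (c, c'). (MAssoc M a b c, MAssoc N a' b' c')),
     MLUnit = map_prod (MLUnit M) (MLUnit N),
     MRUnit = map_prod (MRUnit M) (MRUnit N) \<rparr>"

text \<open>
  Monoidal functors are strong: \<open>MFTen F a b : F a \<otimes> F b \<rightarrow> F (a \<otimes> b)\<close> and \<open>MFUnit F\<close>, from the unit to
  the image of the unit, are invertible.
\<close>

record ('a, 'm, 'b, 'n) mfun =
  MF0 :: "'a \<Rightarrow> 'b"
  MF1 :: "'m \<Rightarrow> 'n"
  MFTen :: "'a \<Rightarrow> 'a \<Rightarrow> 'n"
  MFUnit :: "'n"

locale monoidal_functor = M: monoidal_category M + N: monoidal_category N
  for M :: "('a, 'm) mcat" and N :: "('b, 'n) mcat" +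
  fixes F :: "('a, 'm, 'b, 'n) mfun"
  assumes f0: "a \<in> MOb M \<Longrightarrow> MF0 F a \<in> MOb N"
    and f1: "u \<in> mhom M a b \<Longrightarrow> MF1 F u \<in> mhom N (MF0 F a) (MF0 F b)"
    and f1_id: "a \<in> MOb M \<Longrightarrow> MF1 F (MId M a) = MId N (MF0 F a)"
    and f1_comp: "\<lbrakk>v \<in> mhom M b c; u \<in> mhom M a b\<rbrakk>
      \<Longrightarrow> MF1 F (v \<cdot>\<^bsub>M\<^esub> u) = MF1 F v \<cdot>\<^bsub>N\<^esub> MF1 F u"
    and ften: "\<lbrakk>a \<in> MOb M; b \<in> MOb M\<rbrakk>
      \<Longrightarrow> MFTen F a b \<in> mhom N (MF0 F a \<otimes>\<^bsub>N\<^esub> MF0 F b) (MF0 F (a \<otimes>\<^bsub>M\<^esub> b)) \<and> miso N (MFTen F a b)"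
    and ften_nat: "\<lbrakk>u \<in> mhom M a a'; v \<in> mhom M b b'\<rbrakk>
      \<Longrightarrow> MFTen F a' b' \<cdot>\<^bsub>N\<^esub> (MF1 F u \<otimes>\<^sub>m\<^bsub>N\<^esub> MF1 F v) = MF1 F (u \<otimes>\<^sub>m\<^bsub>M\<^esub> v) \<cdot>\<^bsub>N\<^esub> MFTen F a b"
    and funit: "MFUnit F \<in> mhom N (MUnit N) (MF0 F (MUnit M)) \<and> miso N (MFUnit F)"
    and fassoc: "\<lbrakk>a \<in> MOb M; b \<in> MOb M; c \<in> MOb M\<rbrakk>
      \<Longrightarrow> MF1 F (MAssoc M a b c) \<cdot>\<^bsub>N\<^esub> MFTen F (a \<otimes>\<^bsub>M\<^esub> b) c \<cdot>\<^bsub>N\<^esub> (MFTen F a b \<otimes>\<^sub>m\<^bsub>N\<^esub> MId N (MF0 F c))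
        = MFTen F a (b \<otimes>\<^bsub>M\<^esub> c) \<cdot>\<^bsub>N\<^esub> (MId N (MF0 F a) \<otimes>\<^sub>m\<^bsub>N\<^esub> MFTen F b c)
            \<cdot>\<^bsub>N\<^esub> MAssoc N (MF0 F a) (MF0 F b) (MF0 F c)"
    and flunit: "a \<in> MOb M
      \<Longrightarrow> MF1 F (MLUnit M a) \<cdot>\<^bsub>N\<^esub> MFTen F (MUnit M) a \<cdot>\<^bsub>N\<^esub> (MFUnit F \<otimes>\<^sub>m\<^bsub>N\<^esub> MId N (MF0 F a))
        = MLUnit N (MF0 F a)"
    and frunit: "a \<in> MOb M
      \<Longrightarrow> MF1 F (MRUnit M a) \<cdot>\<^bsub>N\<^esub> MFTen F a (MUnit M) \<cdot>\<^bsub>N\<^esub> (MId N (MF0 F a) \<otimes>\<^sub>m\<^bsub>N\<^esub> MFUnit F)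
        = MRUnit N (MF0 F a)"

definition mf_id :: "('a, 'm) mcat \<Rightarrow> ('a, 'm, 'a, 'm) mfun" where
  "mf_id M = \<lparr> MF0 = (\<lambda>a. a), MF1 = (\<lambda>u. u), MFTen = (\<lambda>a b. MId M (a \<otimes>\<^bsub>M\<^esub> b)),
     MFUnit = MId M (MUnit M) \<rparr>"

text \<open>The composite \<open>G \<circ> F\<close>, where \<open>P\<close> is the codomain of \<open>G\<close>.\<close>

definition mf_comp ::
    "('c, 'p) mcat \<Rightarrow> ('b, 'n, 'c, 'p) mfun \<Rightarrow> ('a, 'm, 'b, 'n) mfun \<Rightarrow> ('a, 'm, 'c, 'p) mfun" where
  "mf_comp P G F = \<lparr> MF0 = (\<lambda>a. MF0 G (MF0 F a)), MF1 = (\<lambda>u. MF1 G (MF1 F u)),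
     MFTen = (\<lambda>a b. MF1 G (MFTen F a b) \<cdot>\<^bsub>P\<^esub> MFTen G (MF0 F a) (MF0 F b)),
     MFUnit = MF1 G (MFUnit F) \<cdot>\<^bsub>P\<^esub> MFUnit G \<rparr>"

text \<open>The monoidal functors \<open>(-, E)\<close> and \<open>(E, -)\<close> from \<open>M\<close> to \<open>M \<times> M\<close>, with \<open>E\<close> the unit of \<open>M\<close>.\<close>

definition ins_l :: "('a, 'm) mcat \<Rightarrow> ('a, 'm, 'a \<times> 'a, 'm \<times> 'm) mfun" where
  "ins_l M = \<lparr> MF0 = (\<lambda>a. (a, MUnit M)), MF1 = (\<lambda>u. (u, MId M (MUnit M))),
     MFTen = (\<lambda>a b. (MId M (a \<otimes>\<^bsub>M\<^esub> b), MLUnit M (MUnit M))),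
     MFUnit = (MId M (MUnit M), MId M (MUnit M)) \<rparr>"

definition ins_r :: "('a, 'm) mcat \<Rightarrow> ('a, 'm, 'a \<times> 'a, 'm \<times> 'm) mfun" where
  "ins_r M = \<lparr> MF0 = (\<lambda>a. (MUnit M, a)), MF1 = (\<lambda>u. (MId M (MUnit M), u)),
     MFTen = (\<lambda>a b. (MLUnit M (MUnit M), MId M (a \<otimes>\<^bsub>M\<^esub> b))),
     MFUnit = (MId M (MUnit M), MId M (MUnit M)) \<rparr>"

locale invertible_monoidal_transformation = F: monoidal_functor M N F + G: monoidal_functor M N G
  for M :: "('a, 'm) mcat" and N :: "('b, 'n) mcat"
    and F :: "('a, 'm, 'b, 'n) mfun" and G :: "('a, 'm, 'b, 'n) mfun" +
  fixes \<theta> :: "'a \<Rightarrow> 'n"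
  assumes component: "a \<in> MOb M \<Longrightarrow> \<theta> a \<in> mhom N (MF0 F a) (MF0 G a) \<and> miso N (\<theta> a)"
    and natural: "u \<in> mhom M a b \<Longrightarrow> \<theta> b \<cdot>\<^bsub>N\<^esub> MF1 F u = MF1 G u \<cdot>\<^bsub>N\<^esub> \<theta> a"
    and tensor: "\<lbrakk>a \<in> MOb M; b \<in> MOb M\<rbrakk>
      \<Longrightarrow> \<theta> (a \<otimes>\<^bsub>M\<^esub> b) \<cdot>\<^bsub>N\<^esub> MFTen F a b = MFTen G a b \<cdot>\<^bsub>N\<^esub> (\<theta> a \<otimes>\<^sub>m\<^bsub>N\<^esub> \<theta> b)"
    and unit: "\<theta> (MUnit M) \<cdot>\<^bsub>N\<^esub> MFUnit F = MFUnit G"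

locale multiplication = monoidal_functor "M \<times>\<^sub>m M" M \<phi>
    + right: invertible_monoidal_transformation M M "mf_comp M \<phi> (ins_l M)" "mf_id M" \<rho>
    + left: invertible_monoidal_transformation M M "mf_comp M \<phi> (ins_r M)" "mf_id M" lam
  for M :: "('a, 'm) mcat" and \<phi> :: "('a \<times> 'a, 'm \<times> 'm, 'a, 'm) mfun"
    and \<rho> :: "'a \<Rightarrow> 'm" and lam :: "'a \<Rightarrow> 'm"

text \<open>
  The Joyal--Street braiding
  \<open>ab \<rightarrow> \<phi>(E,a) \<phi>(b,E) \<rightarrow> \<phi>(Eb,aE) \<rightarrow> \<phi>(b,a) \<rightarrow> \<phi>(bE,Ea) \<rightarrow> \<phi>(b,E) \<phi>(E,a) \<rightarrow> ba\<close>.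
\<close>

definition induced_braiding ::
    "('a, 'm) mcat \<Rightarrow> ('a \<times> 'a, 'm \<times> 'm, 'a, 'm) mfun \<Rightarrow> ('a \<Rightarrow> 'm) \<Rightarrow> ('a \<Rightarrow> 'm) \<Rightarrow> 'a \<Rightarrow> 'a \<Rightarrow> 'm" where
  "induced_braiding M \<phi> \<rho> lam a b = (let E = MUnit M in
     (\<rho> b \<otimes>\<^sub>m\<^bsub>M\<^esub> lam a)
     \<cdot>\<^bsub>M\<^esub> minv M (MFTen \<phi> (b, E) (E, a))
     \<cdot>\<^bsub>M\<^esub> MF1 \<phi> (minv M (MRUnit M b), minv M (MLUnit M a))
     \<cdot>\<^bsub>M\<^esub> MF1 \<phi> (MLUnit M b, MRUnit M a)
     \<cdot>\<^bsub>M\<^esub> MFTen \<phi> (E, a) (b, E)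
     \<cdot>\<^bsub>M\<^esub> (minv M (lam a) \<otimes>\<^sub>m\<^bsub>M\<^esub> minv M (\<rho> b)))"

locale braided_monoidal_category = monoidal_category M
  for M :: "('a, 'm) mcat" (structure) +
  fixes c :: "'a \<Rightarrow> 'a \<Rightarrow> 'm"
  assumes braid: "\<lbrakk>a \<in> MOb M; b \<in> MOb M\<rbrakk> \<Longrightarrow> c a b \<in> mhom M (a \<otimes> b) (b \<otimes> a) \<and> miso M (c a b)"
    and braid_nat: "\<lbrakk>u \<in> mhom M a a'; v \<in> mhom M b b'\<rbrakk>
      \<Longrightarrow> c a' b' \<cdot> (u \<otimes>\<^sub>m v) = (v \<otimes>\<^sub>m u) \<cdot> c a b"
    and hexagon1: "\<lbrakk>x \<in> MOb M; y \<in> MOb M; z \<in> MOb M\<rbrakk>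
      \<Longrightarrow> MAssoc M y z x \<cdot> c x (y \<otimes> z) \<cdot> MAssoc M x y z
        = (MId M y \<otimes>\<^sub>m c x z) \<cdot> MAssoc M y x z \<cdot> (c x y \<otimes>\<^sub>m MId M z)"
    and hexagon2: "\<lbrakk>x \<in> MOb M; y \<in> MOb M; z \<in> MOb M\<rbrakk>
      \<Longrightarrow> minv M (MAssoc M z x y) \<cdot> c (x \<otimes> y) z \<cdot> minv M (MAssoc M x y z)
        = (c x z \<otimes>\<^sub>m MId M y) \<cdot> minv M (MAssoc M x z y) \<cdot> (MId M x \<otimes>\<^sub>m c y z)"

end

theory Submission
  imports Defs
begin

text \<open>
  An object \<open>R\<close> with isomorphisms \<open>R L \<cong> E \<cong> L R\<close> makes \<open>- \<otimes> R\<close> fully faithful. Hence a morphism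
  \<open>f : a \<rightarrow> b\<close> and isomorphisms \<open>s : R a \<cong> a' R\<close>, \<open>t : R b \<cong> b' R\<close> determine a unique
  \<open>f' : a' \<rightarrow> b'\<close> with \<open>(f' \<otimes> R) s = t (R \<otimes> f)\<close>, and such squares can be composed and tensored.
  Conjugating a monoidal functor \<open>F\<close> by \<open>R\<close> therefore gives a monoidal functor whose axioms follow from
  those of \<open>F\<close> by uniqueness, without any coherence for duals; this is \<open>\<phi>\<close>. The constraints of the
  pseudonatural transformations \<open>r\<close> and \<open>l\<close> are again squares of this kind, with conjugating objects
  \<open>R\<close> and \<open>L\<close>, and yield \<open>\<rho>\<close> and \<open>\<lambda>\<close> once \<open>L \<cong> R\<close>. This isomorphism comes from
  \<open>E \<cong> (E \<boxtimes> L) A (R\<^sup>\<bullet> \<boxtimes> E) \<cong> L A R\<^sup>\<bullet> \<cong> (L \<boxtimes> E) R\<^sup>\<bullet>\<close>, where the first step is a component of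
  \<open>\<mu>\<close> and the last one a component of \<open>\<lambda>\<close>, together with \<open>R (L \<boxtimes> E) \<cong> L R\<close>.

  The induced braiding is the image under \<open>\<phi>\<close> of the isomorphism
  \<open>(E,a)(b,E) \<cong> (b,E)(E,a)\<close> of \<open>M \<times> M\<close> built from unit constraints; the hexagons hold for
  the latter by unit coherence and are transported along \<open>\<phi>\<close>, \<open>\<rho>\<close> and \<open>\<lambda>\<close>.
\<close>

section \<open>Calculus in monoidal categories\<close>

text \<open>Three mismatches between the given data and a multiplication shape the proof. The unit
  equivalences involve the unit 1-cell with its monoid \<open>I\<close>, a multiplication involves
  \<open>E\<close>; the unit constraint of the unit functor is an isomorphism of monoids between
  them, and the composition functor carries it to the isomorphism needed to trade one for the other.
  The prescribed formula has \<open>R\<close> on one side and the dual of \<open>L\<close> on the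
  other, so it is a conjugation only once that dual is known to invert \<open>R\<close>. Finally
  \<open>r\<close> is a conjugation by \<open>R\<close>, but \<open>l\<close> is one by
  \<open>L\<close>. A single isomorphism of \<open>L\<close> with \<open>R\<close> settles the last
  two points, and any such isomorphism will do, because conjugations can be transported along it;
  this is why its existence may be established on isomorphism classes. The origin of
  \<open>\<rho>\<close> and \<open>lam\<close> is then a comparison of two conjugates: \<phi>(-,E)
  and the identity functor are both conjugates by \<open>R\<close> of the same restricted
  composition functor.\<close>

context monoidal_category
begin

text \<open>The axioms speak of \<open>mhom\<close> with explicit objects, which a rewrite rule
  would have to guess. The calculus below reads sources and targets off with \<open>MDom\<close> and
  \<open>MCod\<close>, so that typing conditions are decided by simplification.\<close>

lemma mhom_iff: "u \<in> mhom M a b \<longleftrightarrow> u \<in> MMor M \<and> MDom M u = a \<and> MCod M u = b"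
  by (auto simp: mhom_def)

lemma dom_ob [simp]: "u \<in> MMor M \<Longrightarrow> MDom M u \<in> MOb M"
  and cod_ob [simp]: "u \<in> MMor M \<Longrightarrow> MCod M u \<in> MOb M"
  using dom_cod by auto

lemma unit_ob [simp]: "MUnit M \<in> MOb M"
  by (rule unit)

lemma ten_ob [simp]: "\<lbrakk>a \<in> MOb M; b \<in> MOb M\<rbrakk> \<Longrightarrow> a \<otimes> b \<in> MOb M"
  by (rule ten0)

lemma comp_simps [simp]:
  assumes "u \<in> MMor M" "v \<in> MMor M" "MDom M v = MCod M u"
  shows "v \<cdot> u \<in> MMor M" "MDom M (v \<cdot> u) = MDom M u" "MCod M (v \<cdot> u) = MCod M v"
  using comp[of v "MCod M u" "MCod M v" u "MDom M u"] assms by (auto simp: mhom_iff)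

lemma id_simps [simp]:
  assumes "a \<in> MOb M"
  shows "MId M a \<in> MMor M" "MDom M (MId M a) = a" "MCod M (MId M a) = a"
  using ident[OF assms] by (auto simp: mhom_iff)

lemma ten_simps [simp]:
  assumes "u \<in> MMor M" "v \<in> MMor M"
  shows "u \<otimes>\<^sub>m v \<in> MMor M" "MDom M (u \<otimes>\<^sub>m v) = MDom M u \<otimes> MDom M v"
    "MCod M (u \<otimes>\<^sub>m v) = MCod M u \<otimes> MCod M v"
  using ten1[of u "MDom M u" "MCod M u" v "MDom M v" "MCod M v"] assms by (auto simp: mhom_iff)

lemma comp_id_right [simp]: "\<lbrakk>u \<in> MMor M; MDom M u = a\<rbrakk> \<Longrightarrow> u \<cdot> MId M a = u"
  and comp_id_left [simp]: "\<lbrakk>u \<in> MMor M; MCod M u = a\<rbrakk> \<Longrightarrow> MId M a \<cdot> u = u"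
  using comp_id[of u "MDom M u" "MCod M u"] by (auto simp: mhom_iff)

lemma comp_assoc' [simp]:
  "\<lbrakk>u \<in> MMor M; v \<in> MMor M; w \<in> MMor M; MDom M v = MCod M u; MDom M w = MCod M v\<rbrakk>
    \<Longrightarrow> (w \<cdot> v) \<cdot> u = w \<cdot> v \<cdot> u"
  using comp_assoc[of w "MCod M v" "MCod M w" v "MCod M u" u "MDom M u"] by (auto simp: mhom_iff)

lemma ten_id [simp]: "\<lbrakk>a \<in> MOb M; b \<in> MOb M\<rbrakk> \<Longrightarrow> MId M a \<otimes>\<^sub>m MId M b = MId M (a \<otimes> b)"
  by (rule ten1_id)

lemma ten_comp:
  assumes "u \<in> MMor M" "u' \<in> MMor M" "v \<in> MMor M" "v' \<in> MMor M"
    "MDom M u' = MCod M u" "MDom M v' = MCod M v"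
  shows "(u' \<otimes>\<^sub>m v') \<cdot> (u \<otimes>\<^sub>m v) = (u' \<cdot> u) \<otimes>\<^sub>m (v' \<cdot> v)"
  using ten1_comp[of u' "MCod M u" "MCod M u'" u "MDom M u" v' "MCod M v" "MCod M v'" v "MDom M v"]
    assms by (auto simp: mhom_iff)

text \<open>Composites are normalised to the right by \<open>comp_assoc'\<close>, so an equation for
  a composite of two factors no longer matches when a further factor follows. This rule and
  \<open>comp_reassoc2\<close> apply it there.\<close>

lemma comp_reassoc:
  assumes "v \<cdot> u = w" "u \<in> MMor M" "v \<in> MMor M" "x \<in> MMor M" "MDom M v = MCod M u" "MDom M u = MCod M x"
  shows "v \<cdot> u \<cdot> x = w \<cdot> x"
  using assms by (metis comp_assoc')

lemma comp_reassoc2: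
  assumes "v \<cdot> u = w \<cdot> y" "u \<in> MMor M" "v \<in> MMor M" "w \<in> MMor M" "y \<in> MMor M" "x \<in> MMor M"
    "MDom M v = MCod M u" "MDom M w = MCod M y" "MDom M u = MCod M x" "MDom M y = MCod M x"
  shows "v \<cdot> u \<cdot> x = w \<cdot> y \<cdot> x"
  using assms by (metis comp_assoc')

lemma minverse_unique:
  assumes "minverse M u v" "minverse M u w"
  shows "v = w"
proof -
  have "v = (w \<cdot> u) \<cdot> v"
    using assms by (auto simp: minverse_def mhom_iff)
  also have "\<dots> = w \<cdot> u \<cdot> v"
    using assms by (intro comp_assoc') (auto simp: minverse_def mhom_iff)
  also have "\<dots> = w"
    using assms by (auto simp: minverse_def mhom_iff)
  finally show ?thesis .
qed

lemma minv_eqI: "minverse M u v \<Longrightarrow> minv M u = v"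
  unfolding minv_def by (rule the_equality) (auto intro: minverse_unique)

lemma minverse_minv: "miso M u \<Longrightarrow> minverse M u (minv M u)"
  using minv_eqI by (auto simp: miso_def)

lemma miso_mor: "miso M u \<Longrightarrow> u \<in> MMor M"
  by (auto simp: miso_def minverse_def)

lemma minv_simps [simp]:
  assumes "miso M u"
  shows "minv M u \<in> MMor M" "MDom M (minv M u) = MCod M u" "MCod M (minv M u) = MDom M u"
    "minv M u \<cdot> u = MId M (MDom M u)" "u \<cdot> minv M u = MId M (MCod M u)"
  using minverse_minv[OF assms] by (auto simp: minverse_def mhom_iff)

lemma minv_cancel [simp]:
  assumes "miso M u" "x \<in> MMor M"
  shows "MDom M u = MCod M x \<Longrightarrow> minv M u \<cdot> u \<cdot> x = x"
    "MCod M u = MCod M x \<Longrightarrow> u \<cdot> minv M u \<cdot> x = x"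
proof -
  note [simp] = miso_mor[OF assms(1)] assms
  show "MDom M u = MCod M x \<Longrightarrow> minv M u \<cdot> u \<cdot> x = x"
    by (subst comp_assoc'[symmetric]) auto
  show "MCod M u = MCod M x \<Longrightarrow> u \<cdot> minv M u \<cdot> x = x"
    by (subst comp_assoc'[symmetric]) auto
qed

lemma minverseI:
  assumes "u \<in> MMor M" "v \<in> MMor M" "MDom M v = MCod M u" "MCod M v = MDom M u"
    "v \<cdot> u = MId M (MDom M u)" "u \<cdot> v = MId M (MCod M u)"
  shows "minverse M u v"
  using assms by (auto simp: minverse_def mhom_iff)

lemma miso_id [simp]: "a \<in> MOb M \<Longrightarrow> miso M (MId M a)"
  and minv_id [simp]: "a \<in> MOb M \<Longrightarrow> minv M (MId M a) = MId M a"
proof -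
  assume "a \<in> MOb M"
  then have "minverse M (MId M a) (MId M a)"
    by (intro minverseI) auto
  then show "miso M (MId M a)" "minv M (MId M a) = MId M a"
    by (auto simp: miso_def minv_eqI)
qed

lemma miso_minv [simp]: "miso M u \<Longrightarrow> miso M (minv M u)"
  and minv_minv [simp]: "miso M u \<Longrightarrow> minv M (minv M u) = u"
proof -
  assume "miso M u"
  then have "minverse M (minv M u) u"
    using miso_mor by (intro minverseI) auto
  then show "miso M (minv M u)" "minv M (minv M u) = u"
    by (auto simp: miso_def minv_eqI)
qed

lemma miso_comp [simp]:
  assumes "miso M u" "miso M v" "MDom M v = MCod M u"
  shows "miso M (v \<cdot> u)" "minv M (v \<cdot> u) = minv M u \<cdot> minv M v"
proof -
  have "minverse M (v \<cdot> u) (minv M u \<cdot> minv M v)"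
    using assms miso_mor[OF assms(1)] miso_mor[OF assms(2)] by (intro minverseI) auto
  then show "miso M (v \<cdot> u)" "minv M (v \<cdot> u) = minv M u \<cdot> minv M v"
    by (auto simp: miso_def minv_eqI)
qed

lemma miso_ten [simp]:
  assumes "miso M u" "miso M v"
  shows "miso M (u \<otimes>\<^sub>m v)" "minv M (u \<otimes>\<^sub>m v) = minv M u \<otimes>\<^sub>m minv M v"
proof -
  have "minverse M (u \<otimes>\<^sub>m v) (minv M u \<otimes>\<^sub>m minv M v)"
    using assms miso_mor[OF assms(1)] miso_mor[OF assms(2)] by (intro minverseI) (auto simp: ten_comp)
  then show "miso M (u \<otimes>\<^sub>m v)" "minv M (u \<otimes>\<^sub>m v) = minv M u \<otimes>\<^sub>m minv M v"
    by (auto simp: miso_def minv_eqI)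
qed

lemma miso_cancel_left:
  assumes "miso M u" "u \<cdot> x = u \<cdot> y" "x \<in> MMor M" "y \<in> MMor M" "MCod M x = MDom M u" "MCod M y = MDom M u"
  shows "x = y"
proof -
  have "minv M u \<cdot> u \<cdot> x = minv M u \<cdot> u \<cdot> y"
    by (simp only: assms(2))
  then show ?thesis
    using assms(1,3-6) by simp
qed

lemma miso_cancel_right:
  assumes "miso M u" "x \<cdot> u = y \<cdot> u" "x \<in> MMor M" "y \<in> MMor M" "MDom M x = MCod M u" "MDom M y = MCod M u"
  shows "x = y"
proof -
  note [simp] = miso_mor[OF assms(1)] assms(1,3-6)
  have "(x \<cdot> u) \<cdot> minv M u = (y \<cdot> u) \<cdot> minv M u"
    by (simp only: assms(2))
  then show ?thesis by simp
qed

lemma assoc_simps [simp]: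
  assumes "a \<in> MOb M" "b \<in> MOb M" "c \<in> MOb M"
  shows "MAssoc M a b c \<in> MMor M" "MDom M (MAssoc M a b c) = (a \<otimes> b) \<otimes> c"
    "MCod M (MAssoc M a b c) = a \<otimes> b \<otimes> c" "miso M (MAssoc M a b c)"
  using assoc[OF assms] by (auto simp: mhom_iff)

lemma lunit_simps [simp]:
  assumes "a \<in> MOb M"
  shows "MLUnit M a \<in> MMor M" "MDom M (MLUnit M a) = MUnit M \<otimes> a"
    "MCod M (MLUnit M a) = a" "miso M (MLUnit M a)"
  using lunit[OF assms] by (auto simp: mhom_iff)

lemma runit_simps [simp]:
  assumes "a \<in> MOb M"
  shows "MRUnit M a \<in> MMor M" "MDom M (MRUnit M a) = a \<otimes> MUnit M"
    "MCod M (MRUnit M a) = a" "miso M (MRUnit M a)"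
  using runit[OF assms] by (auto simp: mhom_iff)

lemma assoc_natural:
  "\<lbrakk>u \<in> MMor M; v \<in> MMor M; w \<in> MMor M\<rbrakk>
    \<Longrightarrow> MAssoc M (MCod M u) (MCod M v) (MCod M w) \<cdot> ((u \<otimes>\<^sub>m v) \<otimes>\<^sub>m w)
      = (u \<otimes>\<^sub>m (v \<otimes>\<^sub>m w)) \<cdot> MAssoc M (MDom M u) (MDom M v) (MDom M w)"
  by (rule assoc_nat) (auto simp: mhom_iff)

lemma lunit_natural: "u \<in> MMor M
    \<Longrightarrow> MLUnit M (MCod M u) \<cdot> (MId M (MUnit M) \<otimes>\<^sub>m u) = u \<cdot> MLUnit M (MDom M u)"
  by (rule lunit_nat) (auto simp: mhom_iff)

lemma runit_natural: "u \<in> MMor M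
    \<Longrightarrow> MRUnit M (MCod M u) \<cdot> (u \<otimes>\<^sub>m MId M (MUnit M)) = u \<cdot> MRUnit M (MDom M u)"
  by (rule runit_nat) (auto simp: mhom_iff)

section \<open>Unit coherence derived from pentagon and triangle\<close>

lemma ten_unit_faithful_right:
  assumes "u \<otimes>\<^sub>m MId M (MUnit M) = v \<otimes>\<^sub>m MId M (MUnit M)" "u \<in> MMor M" "v \<in> MMor M"
    "MDom M u = MDom M v" "MCod M u = MCod M v"
  shows "u = v"
proof (rule miso_cancel_right)
  show "u \<cdot> MRUnit M (MDom M u) = v \<cdot> MRUnit M (MDom M u)"
    using runit_natural[of u] runit_natural[of v] assms by simp
qed (use assms in auto)

lemma ten_unit_faithful_left:
  assumes "MId M (MUnit M) \<otimes>\<^sub>m u = MId M (MUnit M) \<otimes>\<^sub>m v" "u \<in> MMor M" "v \<in> MMor M"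
    "MDom M u = MDom M v" "MCod M u = MCod M v"
  shows "u = v"
proof (rule miso_cancel_right)
  show "u \<cdot> MLUnit M (MDom M u) = v \<cdot> MLUnit M (MDom M u)"
    using lunit_natural[of u] lunit_natural[of v] assms by simp
qed (use assms in auto)

lemma ten_id_comp:
  assumes "u \<in> MMor M" "v \<in> MMor M" "MDom M v = MCod M u" "a \<in> MOb M"
  shows "MId M a \<otimes>\<^sub>m (v \<cdot> u) = (MId M a \<otimes>\<^sub>m v) \<cdot> (MId M a \<otimes>\<^sub>m u)"
    "(v \<cdot> u) \<otimes>\<^sub>m MId M a = (v \<otimes>\<^sub>m MId M a) \<cdot> (u \<otimes>\<^sub>m MId M a)"
  using assms by (simp_all add: ten_comp)

text \<open>Kelly's argument: it suffices to check the equation after tensoring with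
  \<open>E\<close> on the left, and there it follows from the pentagon for
  \<open>E, E, a, b\<close>, two triangles and naturality of the associator.\<close>

lemma lunit_ten:
  assumes "a \<in> MOb M" "b \<in> MOb M"
  shows "MLUnit M (a \<otimes> b) \<cdot> MAssoc M (MUnit M) a b = MLUnit M a \<otimes>\<^sub>m MId M b"
proof (rule ten_unit_faithful_left)
  let ?E = "MUnit M" and ?i = "\<lambda>a. MId M a" and ?A = "MAssoc M"
  note [simp] = assms
  show "?i ?E \<otimes>\<^sub>m (MLUnit M (a \<otimes> b) \<cdot> ?A ?E a b) = ?i ?E \<otimes>\<^sub>m (MLUnit M a \<otimes>\<^sub>m ?i b)"
  proof (rule miso_cancel_right[of "?A ?E (?E \<otimes> a) b \<cdot> (?A ?E ?E a \<otimes>\<^sub>m ?i b)"])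
    have "(?i ?E \<otimes>\<^sub>m (MLUnit M (a \<otimes> b) \<cdot> ?A ?E a b)) \<cdot> ?A ?E (?E \<otimes> a) b \<cdot> (?A ?E ?E a \<otimes>\<^sub>m ?i b)
        = (?i ?E \<otimes>\<^sub>m MLUnit M (a \<otimes> b)) \<cdot> (?i ?E \<otimes>\<^sub>m ?A ?E a b) \<cdot> ?A ?E (?E \<otimes> a) b \<cdot> (?A ?E ?E a \<otimes>\<^sub>m ?i b)"
      by (simp add: ten_id_comp)
    also have "\<dots> = (?i ?E \<otimes>\<^sub>m MLUnit M (a \<otimes> b)) \<cdot> ?A ?E ?E (a \<otimes> b) \<cdot> ?A (?E \<otimes> ?E) a b"
      by (simp add: pentagon)
    also have "\<dots> = (MRUnit M ?E \<otimes>\<^sub>m ?i (a \<otimes> b)) \<cdot> ?A (?E \<otimes> ?E) a b"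
      by (rule comp_reassoc) (simp_all add: triangle)
    also have "\<dots> = ?A ?E a b \<cdot> ((MRUnit M ?E \<otimes>\<^sub>m ?i a) \<otimes>\<^sub>m ?i b)"
      using assoc_natural[of "MRUnit M ?E" "?i a" "?i b"] by simp
    also have "\<dots> = ?A ?E a b \<cdot> ((?i ?E \<otimes>\<^sub>m MLUnit M a) \<otimes>\<^sub>m ?i b) \<cdot> (?A ?E ?E a \<otimes>\<^sub>m ?i b)"
      by (simp add: triangle[symmetric] ten_id_comp)
    also have "\<dots> = (?i ?E \<otimes>\<^sub>m (MLUnit M a \<otimes>\<^sub>m ?i b)) \<cdot> ?A ?E (?E \<otimes> a) b \<cdot> (?A ?E ?E a \<otimes>\<^sub>m ?i b)"
      using assoc_natural[of "?i ?E" "MLUnit M a" "?i b"] by (intro comp_reassoc2) auto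
    finally show "(?i ?E \<otimes>\<^sub>m (MLUnit M (a \<otimes> b) \<cdot> ?A ?E a b)) \<cdot> ?A ?E (?E \<otimes> a) b \<cdot> (?A ?E ?E a \<otimes>\<^sub>m ?i b)
      = (?i ?E \<otimes>\<^sub>m (MLUnit M a \<otimes>\<^sub>m ?i b)) \<cdot> ?A ?E (?E \<otimes> a) b \<cdot> (?A ?E ?E a \<otimes>\<^sub>m ?i b)" .
  qed auto
qed (use assms in auto)

text \<open>The mirror image of the preceding argument: the pentagon for \<open>a, b, E, E\<close>,
  tested after tensoring with \<open>E\<close> on the right.\<close>

lemma runit_ten:
  assumes "a \<in> MOb M" "b \<in> MOb M"
  shows "(MId M a \<otimes>\<^sub>m MRUnit M b) \<cdot> MAssoc M a b (MUnit M) = MRUnit M (a \<otimes> b)"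
proof (rule ten_unit_faithful_right)
  let ?E = "MUnit M" and ?i = "\<lambda>a. MId M a" and ?A = "MAssoc M"
  note [simp] = assms
  show "((?i a \<otimes>\<^sub>m MRUnit M b) \<cdot> ?A a b ?E) \<otimes>\<^sub>m ?i ?E = MRUnit M (a \<otimes> b) \<otimes>\<^sub>m ?i ?E"
  proof (rule miso_cancel_left[of "?A a b ?E"])
    have "?A a b ?E \<cdot> (((?i a \<otimes>\<^sub>m MRUnit M b) \<cdot> ?A a b ?E) \<otimes>\<^sub>m ?i ?E)
        = ?A a b ?E \<cdot> ((?i a \<otimes>\<^sub>m MRUnit M b) \<otimes>\<^sub>m ?i ?E) \<cdot> (?A a b ?E \<otimes>\<^sub>m ?i ?E)"
      by (simp add: ten_id_comp)
    also have "\<dots> = (?i a \<otimes>\<^sub>m (MRUnit M b \<otimes>\<^sub>m ?i ?E)) \<cdot> ?A a (b \<otimes> ?E) ?E \<cdot> (?A a b ?E \<otimes>\<^sub>m ?i ?E)"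
      using assoc_natural[of "?i a" "MRUnit M b" "?i ?E"] by (intro comp_reassoc2) auto
    also have "\<dots> = (?i a \<otimes>\<^sub>m (?i b \<otimes>\<^sub>m MLUnit M ?E)) \<cdot> (?i a \<otimes>\<^sub>m ?A b ?E ?E) \<cdot> ?A a (b \<otimes> ?E) ?E \<cdot> (?A a b ?E \<otimes>\<^sub>m ?i ?E)"
      by (simp add: triangle[symmetric] ten_id_comp)
    also have "\<dots> = (?i a \<otimes>\<^sub>m (?i b \<otimes>\<^sub>m MLUnit M ?E)) \<cdot> ?A a b (?E \<otimes> ?E) \<cdot> ?A (a \<otimes> b) ?E ?E"
      by (simp add: pentagon)
    also have "\<dots> = ?A a b ?E \<cdot> ((?i (a \<otimes> b)) \<otimes>\<^sub>m MLUnit M ?E) \<cdot> ?A (a \<otimes> b) ?E ?E"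
      using assoc_natural[of "?i a" "?i b" "MLUnit M ?E"] by (intro comp_reassoc2) auto
    also have "\<dots> = ?A a b ?E \<cdot> (MRUnit M (a \<otimes> b) \<otimes>\<^sub>m ?i ?E)"
      by (simp add: triangle)
    finally show "?A a b ?E \<cdot> (((?i a \<otimes>\<^sub>m MRUnit M b) \<cdot> ?A a b ?E) \<otimes>\<^sub>m ?i ?E)
      = ?A a b ?E \<cdot> (MRUnit M (a \<otimes> b) \<otimes>\<^sub>m ?i ?E)" .
  qed auto
qed (use assms in auto)

lemma lunit_unit: "MLUnit M (MUnit M) = MRUnit M (MUnit M)"
proof (rule ten_unit_faithful_right)
  let ?E = "MUnit M" and ?i = "\<lambda>a. MId M a" and ?A = "MAssoc M"
  \<comment> \<open>Naturality of the left unit at the morphism \<open>MLUnit M ?E\<close> itself,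
    which is then cancelled.\<close>
  have 1: "MLUnit M (?E \<otimes> ?E) = ?i ?E \<otimes>\<^sub>m MLUnit M ?E"
    by (rule miso_cancel_left[of "MLUnit M ?E"]) (use lunit_natural[of "MLUnit M ?E"] in auto)
  have "MLUnit M ?E \<otimes>\<^sub>m ?i ?E = (?i ?E \<otimes>\<^sub>m MLUnit M ?E) \<cdot> ?A ?E ?E ?E"
    using lunit_ten[of ?E ?E] 1 by simp
  also have "\<dots> = MRUnit M ?E \<otimes>\<^sub>m ?i ?E"
    by (simp add: triangle)
  finally show "MLUnit M ?E \<otimes>\<^sub>m ?i ?E = MRUnit M ?E \<otimes>\<^sub>m ?i ?E" .
qed auto

end

section \<open>Conjugation by an object\<close>

context monoidal_category
begin

text \<open>Turns a commuting square with two opposite invertible sides into the square of their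
  inverses. Naturality of inverse structural isomorphisms is obtained in this way.\<close>

lemma minv_shift:
  assumes "v \<cdot> u = w \<cdot> y" "miso M u" "miso M w" "v \<in> MMor M" "y \<in> MMor M"
    "MDom M v = MCod M u" "MDom M w = MCod M y" "MDom M u = MDom M y" "MCod M v = MCod M w"
  shows "minv M w \<cdot> v = y \<cdot> minv M u"
proof -
  obtain a b where ab: "MDom M y = a" "MCod M w = b"
    by simp
  note [simp] = assms(2-9) miso_mor[OF assms(2)] miso_mor[OF assms(3)] ab
  have "minv M w \<cdot> (v \<cdot> u) \<cdot> minv M u = minv M w \<cdot> (w \<cdot> y) \<cdot> minv M u"
    by (simp only: assms(1))
  then show ?thesis by simp
qed

lemma assoc_inv_natural:
  assumes "u \<in> MMor M" "v \<in> MMor M" "w \<in> MMor M"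
  shows "minv M (MAssoc M (MCod M u) (MCod M v) (MCod M w)) \<cdot> (u \<otimes>\<^sub>m (v \<otimes>\<^sub>m w))
    = ((u \<otimes>\<^sub>m v) \<otimes>\<^sub>m w) \<cdot> minv M (MAssoc M (MDom M u) (MDom M v) (MDom M w))"
  by (rule minv_shift) (use assms in \<open>simp_all add: assoc_natural\<close>)

text \<open>
  \<open>conj_iso R a a' s\<close> exhibits \<open>a'\<close> as the conjugate of \<open>a\<close> by \<open>R\<close>. The tensor product \<open>conj_ten\<close>
  and the unit \<open>conj_unit\<close> of such isomorphisms are the composites that occur in the axioms of a
  pseudonatural transformation between one-object bicategories.
\<close>

definition conj_iso :: "'a \<Rightarrow> 'a \<Rightarrow> 'a \<Rightarrow> 'm \<Rightarrow> bool" where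
  "conj_iso R a a' s \<longleftrightarrow> R \<in> MOb M \<and> a \<in> MOb M \<and> a' \<in> MOb M \<and> miso M s \<and>
     MDom M s = R \<otimes> a \<and> MCod M s = a' \<otimes> R"

definition conj_ten :: "'a \<Rightarrow> 'a \<Rightarrow> 'a \<Rightarrow> 'a \<Rightarrow> 'a \<Rightarrow> 'm \<Rightarrow> 'm \<Rightarrow> 'm" where
  "conj_ten R a a' b b' s t = minv M (MAssoc M a' b' R) \<cdot> (MId M a' \<otimes>\<^sub>m t) \<cdot> MAssoc M a' R b
     \<cdot> (s \<otimes>\<^sub>m MId M b) \<cdot> minv M (MAssoc M R a b)"

definition conj_unit :: "'a \<Rightarrow> 'm" where
  "conj_unit R = minv M (MLUnit M R) \<cdot> MRUnit M R"

text \<open>Triples \<open>(a, a', s)\<close> with \<open>conj_iso\<close> are the objects, and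
  pairs \<open>(f, f')\<close> with \<open>conj_sq\<close> the morphisms, of a monoidal category
  that projects strictly to both components; the lemmas below supply its identities, composition,
  tensor product and constraints. The formula of \<open>conj_ten\<close> is the hexagon that a
  half-braiding on \<open>R\<close> satisfies at a tensor product.\<close>

definition conj_sq :: "'a \<Rightarrow> 'm \<Rightarrow> 'm \<Rightarrow> 'm \<Rightarrow> 'm \<Rightarrow> bool" where
  "conj_sq R f f' s t \<longleftrightarrow> f \<in> MMor M \<and> f' \<in> MMor M \<and>
     conj_iso R (MDom M f) (MDom M f') s \<and> conj_iso R (MCod M f) (MCod M f') t \<and>
     (f' \<otimes>\<^sub>m MId M R) \<cdot> s = t \<cdot> (MId M R \<otimes>\<^sub>m f)"

lemma conj_iso_simps:
  assumes "conj_iso R a a' s"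
  shows "R \<in> MOb M" "a \<in> MOb M" "a' \<in> MOb M" "s \<in> MMor M" "miso M s"
    "MDom M s = R \<otimes> a" "MCod M s = a' \<otimes> R"
  using assms by (auto simp: conj_iso_def miso_mor)

lemma conj_iso_ten:
  assumes "conj_iso R a a' s" "conj_iso R b b' t"
  shows "conj_iso R (a \<otimes> b) (a' \<otimes> b') (conj_ten R a a' b b' s t)"
  using conj_iso_simps[OF assms(1)] conj_iso_simps[OF assms(2)]
  by (simp add: conj_iso_def conj_ten_def)

lemma conj_iso_unit: "R \<in> MOb M \<Longrightarrow> conj_iso R (MUnit M) (MUnit M) (conj_unit R)"
  by (simp add: conj_iso_def conj_unit_def)

lemma conj_sq_id: "conj_iso R a a' s \<Longrightarrow> conj_sq R (MId M a) (MId M a') s s"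
  using conj_iso_simps[of R a a' s] by (simp add: conj_sq_def)

lemma conj_sq_comp:
  assumes "conj_sq R f f' s t" "conj_sq R g g' t u" "MDom M g = MCod M f" "MDom M g' = MCod M f'"
  shows "conj_sq R (g \<cdot> f) (g' \<cdot> f') s u"
proof -
  note 1 = assms[unfolded conj_sq_def]
  note [simp] = conj_iso_simps(1,4-)[of R "MDom M f" "MDom M f'" s]
    conj_iso_simps(1,4-)[of R "MCod M f" "MCod M f'" t] conj_iso_simps(1,4-)[of R "MCod M g" "MCod M g'" u]
  have "((g' \<cdot> f') \<otimes>\<^sub>m MId M R) \<cdot> s = (g' \<otimes>\<^sub>m MId M R) \<cdot> (f' \<otimes>\<^sub>m MId M R) \<cdot> s"
    using 1 by (simp add: ten_id_comp)
  also have "\<dots> = (g' \<otimes>\<^sub>m MId M R) \<cdot> t \<cdot> (MId M R \<otimes>\<^sub>m f)"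
    using 1 by simp
  also have "\<dots> = u \<cdot> (MId M R \<otimes>\<^sub>m g) \<cdot> (MId M R \<otimes>\<^sub>m f)"
    using 1 by (intro comp_reassoc2) auto
  also have "\<dots> = u \<cdot> (MId M R \<otimes>\<^sub>m (g \<cdot> f))"
    using 1 by (simp add: ten_id_comp)
  finally show ?thesis
    using 1 by (simp add: conj_sq_def)
qed

text \<open>The pair \<open>f'\<close>, \<open>g'\<close> passes through \<open>conj_ten\<close> one
  factor at a time: the square of \<open>g\<close> is used at the factor \<open>u\<close>, that of
  \<open>f\<close> at the factor \<open>s\<close>, and naturality of the associator in
  between.\<close>

lemma conj_sq_ten:
  assumes "conj_sq R f f' s t" "conj_sq R g g' u v"
  shows "conj_sq R (f \<otimes>\<^sub>m g) (f' \<otimes>\<^sub>m g')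
    (conj_ten R (MDom M f) (MDom M f') (MDom M g) (MDom M g') s u)
    (conj_ten R (MCod M f) (MCod M f') (MCod M g) (MCod M g') t v)"
proof -
  note 1 = assms[unfolded conj_sq_def]
  let ?i = "MId M" and ?A = "MAssoc M"
  let ?a = "MDom M f" and ?a' = "MDom M f'" and ?b = "MDom M g" and ?b' = "MDom M g'"
  let ?c = "MCod M f" and ?c' = "MCod M f'" and ?d = "MCod M g" and ?d' = "MCod M g'"
  have I: "conj_iso R ?a ?a' s" "conj_iso R ?c ?c' t" "conj_iso R ?b ?b' u" "conj_iso R ?d ?d' v"
    using 1 by auto
  note [simp] = I[THEN conj_iso_simps(1)] I[THEN conj_iso_simps(4)] I[THEN conj_iso_simps(5)]
     I[THEN conj_iso_simps(6)] I[THEN conj_iso_simps(7)]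
  have [simp]: "f \<in> MMor M" "f' \<in> MMor M" "g \<in> MMor M" "g' \<in> MMor M"
    using 1 by auto
  have e1: "(f' \<otimes>\<^sub>m ?i R) \<cdot> s = t \<cdot> (?i R \<otimes>\<^sub>m f)" and e2: "(g' \<otimes>\<^sub>m ?i R) \<cdot> u = v \<cdot> (?i R \<otimes>\<^sub>m g)"
    using 1 by auto
  have "((f' \<otimes>\<^sub>m g') \<otimes>\<^sub>m ?i R) \<cdot> conj_ten R ?a ?a' ?b ?b' s u
      = minv M (?A ?c' ?d' R) \<cdot> (f' \<otimes>\<^sub>m (g' \<otimes>\<^sub>m ?i R)) \<cdot> (?i ?a' \<otimes>\<^sub>m u) \<cdot> ?A ?a' R ?b
         \<cdot> (s \<otimes>\<^sub>m ?i ?b) \<cdot> minv M (?A R ?a ?b)"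
    unfolding conj_ten_def using assoc_inv_natural[of f' g' "?i R"] by (intro comp_reassoc2) auto
  also have "\<dots> = minv M (?A ?c' ?d' R) \<cdot> (f' \<otimes>\<^sub>m (v \<cdot> (?i R \<otimes>\<^sub>m g))) \<cdot> ?A ?a' R ?b
         \<cdot> (s \<otimes>\<^sub>m ?i ?b) \<cdot> minv M (?A R ?a ?b)"
    by (subst comp_reassoc) (auto simp: ten_comp e2)
  also have "f' \<otimes>\<^sub>m (v \<cdot> (?i R \<otimes>\<^sub>m g)) = (?i ?c' \<otimes>\<^sub>m v) \<cdot> (f' \<otimes>\<^sub>m (?i R \<otimes>\<^sub>m g))"
    by (simp add: ten_comp)
  also have "minv M (?A ?c' ?d' R) \<cdot> ((?i ?c' \<otimes>\<^sub>m v) \<cdot> (f' \<otimes>\<^sub>m (?i R \<otimes>\<^sub>m g))) \<cdot> ?A ?a' R ?b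
         \<cdot> (s \<otimes>\<^sub>m ?i ?b) \<cdot> minv M (?A R ?a ?b)
     = minv M (?A ?c' ?d' R) \<cdot> (?i ?c' \<otimes>\<^sub>m v) \<cdot> (f' \<otimes>\<^sub>m (?i R \<otimes>\<^sub>m g)) \<cdot> ?A ?a' R ?b
         \<cdot> (s \<otimes>\<^sub>m ?i ?b) \<cdot> minv M (?A R ?a ?b)"
    by simp
  also have "(f' \<otimes>\<^sub>m (?i R \<otimes>\<^sub>m g)) \<cdot> ?A ?a' R ?b \<cdot> (s \<otimes>\<^sub>m ?i ?b) \<cdot> minv M (?A R ?a ?b)
      = ?A ?c' R ?d \<cdot> ((f' \<otimes>\<^sub>m ?i R) \<otimes>\<^sub>m g) \<cdot> (s \<otimes>\<^sub>m ?i ?b) \<cdot> minv M (?A R ?a ?b)"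
    using assoc_natural[of f' "?i R" g] by (intro comp_reassoc2) auto
  also have "((f' \<otimes>\<^sub>m ?i R) \<otimes>\<^sub>m g) \<cdot> (s \<otimes>\<^sub>m ?i ?b) \<cdot> minv M (?A R ?a ?b)
      = ((t \<otimes>\<^sub>m ?i ?d) \<cdot> ((?i R \<otimes>\<^sub>m f) \<otimes>\<^sub>m g)) \<cdot> minv M (?A R ?a ?b)"
    by (subst comp_reassoc) (auto simp: ten_comp e1)
  also have "\<dots> = (t \<otimes>\<^sub>m ?i ?d) \<cdot> ((?i R \<otimes>\<^sub>m f) \<otimes>\<^sub>m g) \<cdot> minv M (?A R ?a ?b)"
    by simp
  also have "((?i R \<otimes>\<^sub>m f) \<otimes>\<^sub>m g) \<cdot> minv M (?A R ?a ?b)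
      = minv M (?A R ?c ?d) \<cdot> (?i R \<otimes>\<^sub>m (f \<otimes>\<^sub>m g))"
    using assoc_inv_natural[of "?i R" f g] by simp
  finally show ?thesis
    using I by (simp add: conj_sq_def conj_iso_ten) (simp add: conj_ten_def)
qed

text \<open>Moving \<open>R\<close> past three factors takes one pentagon for each position of
  \<open>R\<close> among four letters: \<open>p1\<close> to \<open>p4\<close> are the pentagons with
  \<open>R\<close> first, second, third and last, solved for the associators and inverses that occur
  in \<open>conj_ten\<close>.\<close>

lemma conj_sq_assoc:
  assumes "conj_iso R a a' s" "conj_iso R b b' t" "conj_iso R c c' u"
  shows "conj_sq R (MAssoc M a b c) (MAssoc M a' b' c')
    (conj_ten R (a \<otimes> b) (a' \<otimes> b') c c' (conj_ten R a a' b b' s t) u)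
    (conj_ten R a a' (b \<otimes> c) (b' \<otimes> c') s (conj_ten R b b' c c' t u))"
proof -
  let ?i = "MId M" and ?A = "MAssoc M"
  note [simp] = assms[THEN conj_iso_simps(1)] assms[THEN conj_iso_simps(2)] assms[THEN conj_iso_simps(3)]
    assms[THEN conj_iso_simps(4)] assms[THEN conj_iso_simps(5)]
     assms[THEN conj_iso_simps(6)] assms[THEN conj_iso_simps(7)]
  have p1: "minv M (?A R a (b \<otimes> c)) \<cdot> (?i R \<otimes>\<^sub>m ?A a b c)
      = ?A (R \<otimes> a) b c \<cdot> (minv M (?A R a b) \<otimes>\<^sub>m ?i c) \<cdot> minv M (?A R (a \<otimes> b) c)"
    using minv_shift[of "?i R \<otimes>\<^sub>m ?A a b c" "?A R (a \<otimes> b) c \<cdot> (?A R a b \<otimes>\<^sub>m ?i c)" "?A R a (b \<otimes> c)" "?A (R \<otimes> a) b c"]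
    by (simp add: pentagon)
  have p2: "(?i a' \<otimes>\<^sub>m minv M (?A R b c)) \<cdot> ?A a' R (b \<otimes> c) \<cdot> ?A (a' \<otimes> R) b c
      = ?A a' (R \<otimes> b) c \<cdot> (?A a' R b \<otimes>\<^sub>m ?i c)"
    using pentagon[of a' R b c] by (simp flip: pentagon add: comp_reassoc[OF ten_comp])
  have p3: "(?i a' \<otimes>\<^sub>m ?A b' R c) \<cdot> ?A a' (b' \<otimes> R) c
      = ?A a' b' (R \<otimes> c) \<cdot> ?A (a' \<otimes> b') R c \<cdot> (minv M (?A a' b' R) \<otimes>\<^sub>m ?i c)"
  proof (rule miso_cancel_right[of "?A a' b' R \<otimes>\<^sub>m ?i c"])
    show "((?i a' \<otimes>\<^sub>m ?A b' R c) \<cdot> ?A a' (b' \<otimes> R) c) \<cdot> (?A a' b' R \<otimes>\<^sub>m ?i c) =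
        (?A a' b' (R \<otimes> c) \<cdot> ?A (a' \<otimes> b') R c \<cdot> (minv M (?A a' b' R) \<otimes>\<^sub>m ?i c)) \<cdot> (?A a' b' R \<otimes>\<^sub>m ?i c)"
      by (simp add: pentagon ten_comp)
  qed auto
  have p4: "minv M (?A a' (b' \<otimes> c') R) \<cdot> (?i a' \<otimes>\<^sub>m minv M (?A b' c' R)) \<cdot> ?A a' b' (c' \<otimes> R)
      = (?A a' b' c' \<otimes>\<^sub>m ?i R) \<cdot> minv M (?A (a' \<otimes> b') c' R)"
    using minv_shift[of "?A a' b' (c' \<otimes> R)" "?A (a' \<otimes> b') c' R" "(?i a' \<otimes>\<^sub>m ?A b' c' R) \<cdot> ?A a' (b' \<otimes> c') R"
        "?A a' b' c' \<otimes>\<^sub>m ?i R"]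
    by (simp add: pentagon)
  have "conj_ten R a a' (b \<otimes> c) (b' \<otimes> c') s (conj_ten R b b' c c' t u) \<cdot> (?i R \<otimes>\<^sub>m ?A a b c)
     = minv M (?A a' (b' \<otimes> c') R) \<cdot> (?i a' \<otimes>\<^sub>m conj_ten R b b' c c' t u) \<cdot> ?A a' R (b \<otimes> c)
        \<cdot> (s \<otimes>\<^sub>m ?i (b \<otimes> c)) \<cdot> minv M (?A R a (b \<otimes> c)) \<cdot> (?i R \<otimes>\<^sub>m ?A a b c)"
    unfolding conj_ten_def[of R a a' "b \<otimes> c"] using conj_iso_simps[OF conj_iso_ten[OF assms(2,3)]] by simp
  also have "\<dots> = minv M (?A a' (b' \<otimes> c') R) \<cdot> (?i a' \<otimes>\<^sub>m conj_ten R b b' c c' t u) \<cdot> ?A a' R (b \<otimes> c)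
        \<cdot> (s \<otimes>\<^sub>m ?i (b \<otimes> c)) \<cdot> ?A (R \<otimes> a) b c \<cdot> (minv M (?A R a b) \<otimes>\<^sub>m ?i c) \<cdot> minv M (?A R (a \<otimes> b) c)"
    unfolding p1 ..
  also have "(s \<otimes>\<^sub>m ?i (b \<otimes> c)) \<cdot> ?A (R \<otimes> a) b c \<cdot> (minv M (?A R a b) \<otimes>\<^sub>m ?i c) \<cdot> minv M (?A R (a \<otimes> b) c)
     = ?A (a' \<otimes> R) b c \<cdot> ((s \<otimes>\<^sub>m ?i b) \<otimes>\<^sub>m ?i c) \<cdot> (minv M (?A R a b) \<otimes>\<^sub>m ?i c) \<cdot> minv M (?A R (a \<otimes> b) c)"
    using assoc_natural[of s "?i b" "?i c"] by (intro comp_reassoc2) auto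
  also have "((s \<otimes>\<^sub>m ?i b) \<otimes>\<^sub>m ?i c) \<cdot> (minv M (?A R a b) \<otimes>\<^sub>m ?i c) \<cdot> minv M (?A R (a \<otimes> b) c)
      = (((s \<otimes>\<^sub>m ?i b) \<cdot> minv M (?A R a b)) \<otimes>\<^sub>m ?i c) \<cdot> minv M (?A R (a \<otimes> b) c)" (is "_ = ?X")
    by (simp add: ten_id_comp)
  also have "?i a' \<otimes>\<^sub>m conj_ten R b b' c c' t u = (?i a' \<otimes>\<^sub>m minv M (?A b' c' R))
      \<cdot> (?i a' \<otimes>\<^sub>m (?i b' \<otimes>\<^sub>m u)) \<cdot> (?i a' \<otimes>\<^sub>m ?A b' R c) \<cdot> (?i a' \<otimes>\<^sub>m (t \<otimes>\<^sub>m ?i c))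
      \<cdot> (?i a' \<otimes>\<^sub>m minv M (?A R b c))"
    by (simp add: conj_ten_def ten_id_comp)
  also have "minv M (?A a' (b' \<otimes> c') R) \<cdot> \<dots> \<cdot> ?A a' R (b \<otimes> c) \<cdot> ?A (a' \<otimes> R) b c \<cdot> ?X
      = minv M (?A a' (b' \<otimes> c') R) \<cdot> (?i a' \<otimes>\<^sub>m minv M (?A b' c' R))
      \<cdot> (?i a' \<otimes>\<^sub>m (?i b' \<otimes>\<^sub>m u)) \<cdot> (?i a' \<otimes>\<^sub>m ?A b' R c) \<cdot> (?i a' \<otimes>\<^sub>m (t \<otimes>\<^sub>m ?i c))
      \<cdot> ((?i a' \<otimes>\<^sub>m minv M (?A R b c)) \<cdot> ?A a' R (b \<otimes> c) \<cdot> ?A (a' \<otimes> R) b c) \<cdot> ?X"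
    by simp
  also have "(?i a' \<otimes>\<^sub>m (t \<otimes>\<^sub>m ?i c)) \<cdot> ((?i a' \<otimes>\<^sub>m minv M (?A R b c)) \<cdot> ?A a' R (b \<otimes> c) \<cdot> ?A (a' \<otimes> R) b c) \<cdot> ?X
      = (?i a' \<otimes>\<^sub>m (t \<otimes>\<^sub>m ?i c)) \<cdot> ?A a' (R \<otimes> b) c \<cdot> (?A a' R b \<otimes>\<^sub>m ?i c) \<cdot> ?X"
    unfolding p2 by simp
  also have "\<dots> = ?A a' (b' \<otimes> R) c \<cdot> ((?i a' \<otimes>\<^sub>m t) \<otimes>\<^sub>m ?i c) \<cdot> (?A a' R b \<otimes>\<^sub>m ?i c) \<cdot> ?X"
    using assoc_natural[of "?i a'" t "?i c"] by (intro comp_reassoc2) auto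
  also have "((?i a' \<otimes>\<^sub>m t) \<otimes>\<^sub>m ?i c) \<cdot> (?A a' R b \<otimes>\<^sub>m ?i c) \<cdot> ?X
      = (((?i a' \<otimes>\<^sub>m t) \<cdot> ?A a' R b \<cdot> (s \<otimes>\<^sub>m ?i b) \<cdot> minv M (?A R a b)) \<otimes>\<^sub>m ?i c) \<cdot> minv M (?A R (a \<otimes> b) c)"
    (is "_ = ?Y")
    by (simp add: ten_id_comp)
  also have "(?i a' \<otimes>\<^sub>m ?A b' R c) \<cdot> ?A a' (b' \<otimes> R) c \<cdot> ?Y
      = (?A a' b' (R \<otimes> c) \<cdot> ?A (a' \<otimes> b') R c \<cdot> (minv M (?A a' b' R) \<otimes>\<^sub>m ?i c)) \<cdot> ?Y"
    by (rule comp_reassoc[OF p3]) auto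
  also have "\<dots> = ?A a' b' (R \<otimes> c) \<cdot> ?A (a' \<otimes> b') R c \<cdot> (conj_ten R a a' b b' s t \<otimes>\<^sub>m ?i c) \<cdot> minv M (?A R (a \<otimes> b) c)"
    (is "_ = _ \<cdot> ?Z") by (simp add: conj_ten_def ten_id_comp)
  also have "(?i a' \<otimes>\<^sub>m (?i b' \<otimes>\<^sub>m u)) \<cdot> ?A a' b' (R \<otimes> c) \<cdot> ?Z
      = ?A a' b' (c' \<otimes> R) \<cdot> (?i (a' \<otimes> b') \<otimes>\<^sub>m u) \<cdot> ?Z"
    using assoc_natural[of "?i a'" "?i b'" u] conj_iso_simps[OF conj_iso_ten[OF assms(1,2)]]
    by (intro comp_reassoc2) auto
  also have "minv M (?A a' (b' \<otimes> c') R) \<cdot> (?i a' \<otimes>\<^sub>m minv M (?A b' c' R)) \<cdot> \<dots>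
      = (minv M (?A a' (b' \<otimes> c') R) \<cdot> (?i a' \<otimes>\<^sub>m minv M (?A b' c' R)) \<cdot> ?A a' b' (c' \<otimes> R))
          \<cdot> (?i (a' \<otimes> b') \<otimes>\<^sub>m u) \<cdot> ?Z"
    using conj_iso_simps[OF conj_iso_ten[OF assms(1,2)]] by simp
  also have "\<dots> = (?A a' b' c' \<otimes>\<^sub>m ?i R) \<cdot> conj_ten R (a \<otimes> b) (a' \<otimes> b') c c' (conj_ten R a a' b b' s t) u"
    unfolding p4 unfolding conj_ten_def[of R "a \<otimes> b"]
    using conj_iso_simps[OF conj_iso_ten[OF assms(1,2)]] by simp
  finally show ?thesis
    using assms by (simp add: conj_sq_def conj_iso_ten)
qed

text \<open>Naturality carries the left unit past \<open>s\<close>, with \<open>lunit_ten\<close>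
  used before and after; the triangle then turns the right unit of \<open>R\<close> left over from
  \<open>conj_unit\<close> into the left unit of \<open>a\<close>.\<close>

lemma conj_sq_lunit:
  assumes "conj_iso R a a' s"
  shows "conj_sq R (MLUnit M a) (MLUnit M a') (conj_ten R (MUnit M) (MUnit M) a a' (conj_unit R) s) s"
proof -
  let ?i = "MId M" and ?A = "MAssoc M" and ?E = "MUnit M"
  note [simp] = conj_iso_simps[OF assms]
  have "(MLUnit M a' \<otimes>\<^sub>m ?i R) \<cdot> conj_ten R ?E ?E a a' (conj_unit R) s
     = (MLUnit M (a' \<otimes> R) \<cdot> (?i ?E \<otimes>\<^sub>m s)) \<cdot> ?A ?E R a \<cdot> (minv M (MLUnit M R) \<otimes>\<^sub>m ?i a) \<cdot> (MRUnit M R \<otimes>\<^sub>m ?i a)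
       \<cdot> minv M (?A R ?E a)"
    by (simp add: conj_ten_def conj_unit_def lunit_ten[symmetric] ten_id_comp)
  also have "\<dots> = s \<cdot> (MLUnit M (R \<otimes> a) \<cdot> ?A ?E R a) \<cdot> (minv M (MLUnit M R) \<otimes>\<^sub>m ?i a)
       \<cdot> (MRUnit M R \<otimes>\<^sub>m ?i a) \<cdot> minv M (?A R ?E a)"
    using lunit_natural[of s] by simp
  also have "\<dots> = s \<cdot> ((MLUnit M R \<otimes>\<^sub>m ?i a) \<cdot> (minv M (MLUnit M R) \<otimes>\<^sub>m ?i a))
       \<cdot> (MRUnit M R \<otimes>\<^sub>m ?i a) \<cdot> minv M (?A R ?E a)"
    by (simp only: lunit_ten \<open>R \<in> MOb M\<close> \<open>a \<in> MOb M\<close>) simp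
  also have "\<dots> = s \<cdot> (MRUnit M R \<otimes>\<^sub>m ?i a) \<cdot> minv M (?A R ?E a)"
    by (subst ten_comp) auto
  also have "\<dots> = s \<cdot> (?i R \<otimes>\<^sub>m MLUnit M a)"
    by (simp add: triangle[symmetric])
  finally show ?thesis
    using assms by (simp add: conj_sq_def conj_iso_ten conj_iso_unit)
qed

lemma conj_sq_runit:
  assumes "conj_iso R a a' s"
  shows "conj_sq R (MRUnit M a) (MRUnit M a') (conj_ten R a a' (MUnit M) (MUnit M) s (conj_unit R)) s"
proof -
  let ?i = "MId M" and ?A = "MAssoc M" and ?E = "MUnit M"
  note [simp] = conj_iso_simps[OF assms]
  have "(MRUnit M a' \<otimes>\<^sub>m ?i R) \<cdot> conj_ten R a a' ?E ?E s (conj_unit R)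
     = ((?i a' \<otimes>\<^sub>m MLUnit M R) \<cdot> (?i a' \<otimes>\<^sub>m minv M (MLUnit M R))) \<cdot> ((?i a' \<otimes>\<^sub>m MRUnit M R) \<cdot> ?A a' R ?E) \<cdot> (s \<otimes>\<^sub>m ?i ?E)
       \<cdot> minv M (?A R a ?E)"
    by (simp add: conj_ten_def conj_unit_def triangle[symmetric] ten_id_comp)
  also have "\<dots> = (MRUnit M (a' \<otimes> R) \<cdot> (s \<otimes>\<^sub>m ?i ?E)) \<cdot> minv M (?A R a ?E)"
    by (simp only: runit_ten \<open>R \<in> MOb M\<close> \<open>a' \<in> MOb M\<close>) (subst ten_comp; simp)
  also have "\<dots> = s \<cdot> MRUnit M (R \<otimes> a) \<cdot> minv M (?A R a ?E)"
    using runit_natural[of s] by simp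
  also have "\<dots> = s \<cdot> (?i R \<otimes>\<^sub>m MRUnit M a)"
    by (simp add: runit_ten[symmetric])
  finally show ?thesis
    using assms by (simp add: conj_sq_def conj_iso_ten conj_iso_unit)
qed

end

section \<open>Conjugates of monoidal functors\<close>

context monoidal_category
begin

lemma mhom_ob:
  assumes "u \<in> mhom M a b"
  shows "a \<in> MOb M" "b \<in> MOb M"
  using dom_cod[of u] assms by (auto simp: mhom_iff)

text \<open>For invertible \<open>e\<close> the composite in front is an isomorphism from
  \<open>(a \<otimes> x) \<otimes> y\<close> to \<open>a\<close>; its naturality shows that
  tensoring with \<open>y\<close> undoes tensoring with \<open>x\<close>.\<close>

lemma inverse_object_natural:
  assumes "e \<in> mhom M (x \<otimes> y) (MUnit M)" "x \<in> MOb M" "y \<in> MOb M" "u \<in> MMor M"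
  shows "(MRUnit M (MCod M u) \<cdot> (MId M (MCod M u) \<otimes>\<^sub>m e) \<cdot> MAssoc M (MCod M u) x y)
      \<cdot> ((u \<otimes>\<^sub>m MId M x) \<otimes>\<^sub>m MId M y)
    = u \<cdot> MRUnit M (MDom M u) \<cdot> (MId M (MDom M u) \<otimes>\<^sub>m e) \<cdot> MAssoc M (MDom M u) x y"
proof -
  let ?i = "MId M"
  note [simp] = assms(1)[unfolded mhom_iff] assms(2-4)
  have "(MRUnit M (MCod M u) \<cdot> (?i (MCod M u) \<otimes>\<^sub>m e) \<cdot> MAssoc M (MCod M u) x y) \<cdot> ((u \<otimes>\<^sub>m ?i x) \<otimes>\<^sub>m ?i y)
      = MRUnit M (MCod M u) \<cdot> ((?i (MCod M u) \<otimes>\<^sub>m e) \<cdot> (u \<otimes>\<^sub>m ?i (x \<otimes> y))) \<cdot> MAssoc M (MDom M u) x y"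
    using assoc_natural[of u "?i x" "?i y"] by simp
  also have "(?i (MCod M u) \<otimes>\<^sub>m e) \<cdot> (u \<otimes>\<^sub>m ?i (x \<otimes> y)) = (u \<otimes>\<^sub>m ?i (MUnit M)) \<cdot> (?i (MDom M u) \<otimes>\<^sub>m e)"
    by (simp add: ten_comp)
  also have "MRUnit M (MCod M u) \<cdot> \<dots> \<cdot> MAssoc M (MDom M u) x y
      = (MRUnit M (MCod M u) \<cdot> (u \<otimes>\<^sub>m ?i (MUnit M))) \<cdot> (?i (MDom M u) \<otimes>\<^sub>m e) \<cdot> MAssoc M (MDom M u) x y"
    by simp
  finally show ?thesis
    by (simp add: runit_natural)
qed

lemma ten_faithful:
  assumes "miso M e" "e \<in> mhom M (x \<otimes> y) (MUnit M)" "x \<in> MOb M" "y \<in> MOb M"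
    "u \<in> mhom M a b" "v \<in> mhom M a b" "u \<otimes>\<^sub>m MId M x = v \<otimes>\<^sub>m MId M x"
  shows "u = v"
proof (rule miso_cancel_right)
  note [simp] = assms(2,5,6)[unfolded mhom_iff] assms(1,3,4)
  note [simp] = mhom_ob[OF assms(5)]
  let ?e = "MRUnit M a \<cdot> (MId M a \<otimes>\<^sub>m e) \<cdot> MAssoc M a x y"
  show "u \<cdot> ?e = v \<cdot> ?e"
    using inverse_object_natural[OF assms(2), of u] inverse_object_natural[OF assms(2), of v]
    by (simp add: assms(7))
  show "miso M ?e" "u \<in> MMor M" "v \<in> MMor M" "MDom M u = MCod M ?e" "MDom M v = MCod M ?e"
    by simp_all
qed

end

text \<open>\<open>L\<close> stands for an inverse of \<open>R\<close>; in the tricategory it will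
  be the dual \<open>L'\<close> of the component of the left unit equivalence.
  \<open>\<epsilon>\<close> makes tensoring with \<open>R\<close> faithful, \<open>\<kappa>\<close>
  makes tensoring with \<open>L\<close> faithful, and fullness combines the two.\<close>

locale invertible_object = monoidal_category M
  for M :: "('a, 'm) mcat" (structure) +
  fixes R L :: 'a and \<epsilon> \<kappa> :: 'm
  assumes R_ob [simp]: "R \<in> MOb M" and L_ob [simp]: "L \<in> MOb M"
    and \<epsilon>_hom: "\<epsilon> \<in> mhom M (R \<otimes> L) (MUnit M)" and \<epsilon>_iso [simp]: "miso M \<epsilon>"
    and \<kappa>_hom: "\<kappa> \<in> mhom M (L \<otimes> R) (MUnit M)" and \<kappa>_iso [simp]: "miso M \<kappa>"
begin

lemma R_faithful:
  "\<lbrakk>u \<in> mhom M a b; v \<in> mhom M a b; u \<otimes>\<^sub>m MId M R = v \<otimes>\<^sub>m MId M R\<rbrakk> \<Longrightarrow> u = v"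
  by (rule ten_faithful[OF \<epsilon>_iso \<epsilon>_hom]) auto

text \<open>The preimage is \<open>g\<close> tensored with \<open>L\<close> and transported along
  the natural isomorphisms \<open>e\<close>. That it maps to \<open>g\<close> is checked after
  tensoring with \<open>L\<close>, where naturality of \<open>e\<close> at the preimage gives the
  equation.\<close>

lemma R_full:
  assumes "g \<in> mhom M (a \<otimes> R) (b \<otimes> R)" "a \<in> MOb M" "b \<in> MOb M"
  obtains f where "f \<in> mhom M a b" "f \<otimes>\<^sub>m MId M R = g" "miso M g \<Longrightarrow> miso M f"
proof
  define e where "e a = MRUnit M a \<cdot> (MId M a \<otimes>\<^sub>m \<epsilon>) \<cdot> MAssoc M a R L" for a
  note [simp] = \<epsilon>_hom[unfolded mhom_iff] assms(1)[unfolded mhom_iff] assms(2-)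
  have [simp]: "miso M (e a)" "e a \<in> MMor M" "MDom M (e a) = (a \<otimes> R) \<otimes> L" "MCod M (e a) = a"
    if "a \<in> MOb M" for a
    using that by (simp_all add: e_def)
  let ?f = "e b \<cdot> (g \<otimes>\<^sub>m MId M L) \<cdot> minv M (e a)"
  show f: "?f \<in> mhom M a b"
    by (simp add: mhom_iff)
  show "miso M g \<Longrightarrow> miso M ?f"
    by simp
  show "?f \<otimes>\<^sub>m MId M R = g"
  proof (rule ten_faithful[OF \<kappa>_iso \<kappa>_hom])
    show "?f \<otimes>\<^sub>m MId M R \<in> mhom M (a \<otimes> R) (b \<otimes> R)"
      by (simp add: mhom_iff)
    show "(?f \<otimes>\<^sub>m MId M R) \<otimes>\<^sub>m MId M L = g \<otimes>\<^sub>m MId M L"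
    proof (rule miso_cancel_left[of "e b"])
      have "e b \<cdot> ((?f \<otimes>\<^sub>m MId M R) \<otimes>\<^sub>m MId M L) = ?f \<cdot> e a"
        using inverse_object_natural[OF \<epsilon>_hom R_ob L_ob, of ?f] f by (simp add: mhom_iff e_def[symmetric])
      then show "e b \<cdot> ((?f \<otimes>\<^sub>m MId M R) \<otimes>\<^sub>m MId M L) = e b \<cdot> (g \<otimes>\<^sub>m MId M L)"
        by simp
    qed simp_all
  qed (use assms in auto)
qed

text \<open>The square determines \<open>g \<otimes>\<^sub>m MId M R\<close> because
  \<open>s\<close> is invertible, and tensoring with \<open>R\<close> is faithful. Equations between
  lifted morphisms are proved below by exhibiting both sides as lifts of one and the same
  morphism.\<close>

lemma conj_sq_unique:
  assumes "conj_sq R f g s t" "conj_sq R f h s t" "MDom M g = MDom M h" "MCod M g = MCod M h"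
  shows "g = h"
proof (rule R_faithful)
  note 1 = assms[unfolded conj_sq_def]
  show "g \<in> mhom M (MDom M g) (MCod M g)" "h \<in> mhom M (MDom M g) (MCod M g)"
    using 1 by (auto simp: mhom_iff)
  show "g \<otimes>\<^sub>m MId M R = h \<otimes>\<^sub>m MId M R"
    by (rule miso_cancel_right[of s]) (use 1 in \<open>auto simp: conj_iso_def\<close>)
qed

lemma conj_sq_ex:
  assumes "f \<in> MMor M" "conj_iso R (MDom M f) a' s" "conj_iso R (MCod M f) b' t"
  shows "\<exists>f'. f' \<in> mhom M a' b' \<and> conj_sq R f f' s t \<and> (miso M f \<longrightarrow> miso M f')"
proof -
  note [simp] = assms(1) conj_iso_simps[OF assms(2)] conj_iso_simps[OF assms(3)]
  obtain f' where f': "f' \<in> mhom M a' b'" "f' \<otimes>\<^sub>m MId M R = t \<cdot> (MId M R \<otimes>\<^sub>m f) \<cdot> minv M s"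
    "miso M (t \<cdot> (MId M R \<otimes>\<^sub>m f) \<cdot> minv M s) \<Longrightarrow> miso M f'"
    by (rule R_full[of "t \<cdot> (MId M R \<otimes>\<^sub>m f) \<cdot> minv M s" a' b']) (auto simp: mhom_iff)
  moreover have "conj_sq R f f' s t"
    using f'(1,2) assms by (simp add: conj_sq_def mhom_iff)
  ultimately show ?thesis by auto
qed

text \<open>The choice is harmless, since \<open>conj_sq_unique\<close> leaves a single candidate.
  Invertibility belongs to the chosen property because \<open>R_full\<close> delivers it together
  with the preimage.\<close>

definition conj_lift :: "'m \<Rightarrow> 'a \<Rightarrow> 'a \<Rightarrow> 'm \<Rightarrow> 'm \<Rightarrow> 'm" where
  "conj_lift f a' b' s t =
    (SOME f'. f' \<in> mhom M a' b' \<and> conj_sq R f f' s t \<and> (miso M f \<longrightarrow> miso M f'))"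

lemma conj_lift:
  assumes "f \<in> MMor M" "conj_iso R (MDom M f) a' s" "conj_iso R (MCod M f) b' t"
  shows "conj_lift f a' b' s t \<in> mhom M a' b'" "conj_sq R f (conj_lift f a' b' s t) s t"
    "miso M f \<Longrightarrow> miso M (conj_lift f a' b' s t)"
  using someI_ex[OF conj_sq_ex[OF assms]] by (auto simp: conj_lift_def)

end

section \<open>Calculus of strong monoidal functors\<close>

context monoidal_functor
begin

lemma f0_ob [simp]: "a \<in> MOb M \<Longrightarrow> MF0 F a \<in> MOb N"
  by (rule f0)

lemma f1_simps [simp]:
  assumes "u \<in> MMor M"
  shows "MF1 F u \<in> MMor N" "MDom N (MF1 F u) = MF0 F (MDom M u)" "MCod N (MF1 F u) = MF0 F (MCod M u)"
  using f1[of u "MDom M u" "MCod M u"] assms by (auto simp: M.mhom_iff N.mhom_iff)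

lemma f1_comp':
  "\<lbrakk>u \<in> MMor M; v \<in> MMor M; MDom M v = MCod M u\<rbrakk> \<Longrightarrow> MF1 F (v \<cdot>\<^bsub>M\<^esub> u) = MF1 F v \<cdot>\<^bsub>N\<^esub> MF1 F u"
  by (rule f1_comp[of _ "MCod M u" "MCod M v" _ "MDom M u"]) (auto simp: M.mhom_iff)

lemma ften_simps [simp]:
  assumes "a \<in> MOb M" "b \<in> MOb M"
  shows "MFTen F a b \<in> MMor N" "MDom N (MFTen F a b) = MF0 F a \<otimes>\<^bsub>N\<^esub> MF0 F b"
    "MCod N (MFTen F a b) = MF0 F (a \<otimes>\<^bsub>M\<^esub> b)" "miso N (MFTen F a b)"
  using ften[OF assms] by (auto simp: N.mhom_iff)

lemma ften_natural:
  "\<lbrakk>u \<in> MMor M; v \<in> MMor M\<rbrakk> \<Longrightarrow> MFTen F (MCod M u) (MCod M v) \<cdot>\<^bsub>N\<^esub> (MF1 F u \<otimes>\<^sub>m\<^bsub>N\<^esub> MF1 F v)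
    = MF1 F (u \<otimes>\<^sub>m\<^bsub>M\<^esub> v) \<cdot>\<^bsub>N\<^esub> MFTen F (MDom M u) (MDom M v)"
  by (rule ften_nat) (auto simp: M.mhom_iff)

lemma funit_simps [simp]:
  "MFUnit F \<in> MMor N" "MDom N (MFUnit F) = MUnit N" "MCod N (MFUnit F) = MF0 F (MUnit M)"
  "miso N (MFUnit F)"
  using funit by (auto simp: N.mhom_iff)

lemma f1_miso [simp]:
  assumes "miso M u"
  shows "miso N (MF1 F u)" "MF1 F (minv M u) = minv N (MF1 F u)"
proof -
  note [simp] = assms M.miso_mor[OF assms]
  have "minverse N (MF1 F u) (MF1 F (minv M u))"
    by (intro N.minverseI) (auto simp: f1_comp'[symmetric] f1_id)
  then show "miso N (MF1 F u)" "MF1 F (minv M u) = minv N (MF1 F u)"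
    by (auto simp: miso_def N.minv_eqI)
qed

end

text \<open>The object part \<open>G0\<close> and the morphism part \<open>G1\<close> are
  parameters, so that the multiplication can have its prescribed values; only the monoidal
  constraints are constructed, by lifting those of \<open>F\<close>.\<close>

locale conjugate_functor = N: invertible_object N R L \<epsilon> \<kappa> + F: monoidal_functor M N F
  for M :: "('a, 'm) mcat" and N :: "('b, 'n) mcat" and F :: "('a, 'm, 'b, 'n) mfun"
    and R L :: 'b and \<epsilon> \<kappa> :: 'n +
  fixes G0 :: "'a \<Rightarrow> 'b" and G1 :: "'m \<Rightarrow> 'n" and t :: "'a \<Rightarrow> 'n"
  assumes t: "a \<in> MOb M \<Longrightarrow> N.conj_iso R (MF0 F a) (G0 a) (t a)"
    and G1: "u \<in> MMor M \<Longrightarrow> G1 u \<in> mhom N (G0 (MDom M u)) (G0 (MCod M u))"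
    and t_nat: "u \<in> MMor M \<Longrightarrow> N.conj_sq R (MF1 F u) (G1 u) (t (MDom M u)) (t (MCod M u))"
begin

definition G where
  "G = \<lparr> MF0 = G0, MF1 = G1,
     MFTen = (\<lambda>a b. N.conj_lift (MFTen F a b) (G0 a \<otimes>\<^bsub>N\<^esub> G0 b) (G0 (a \<otimes>\<^bsub>M\<^esub> b))
       (N.conj_ten R (MF0 F a) (G0 a) (MF0 F b) (G0 b) (t a) (t b)) (t (a \<otimes>\<^bsub>M\<^esub> b))),
     MFUnit = N.conj_lift (MFUnit F) (MUnit N) (G0 (MUnit M)) (N.conj_unit R) (t (MUnit M)) \<rparr>"

lemma G_simps [simp]: "MF0 G = G0" "MF1 G = G1"
  by (simp_all add: G_def)

lemma G0_ob [simp]: "a \<in> MOb M \<Longrightarrow> G0 a \<in> MOb N"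
  using t by (auto simp: N.conj_iso_def)

lemma G1_simps [simp]:
  assumes "u \<in> MMor M"
  shows "G1 u \<in> MMor N" "MDom N (G1 u) = G0 (MDom M u)" "MCod N (G1 u) = G0 (MCod M u)"
  using G1[OF assms] by (auto simp: N.mhom_iff)

lemma G_ten:
  assumes "a \<in> MOb M" "b \<in> MOb M"
  shows "MFTen G a b \<in> mhom N (G0 a \<otimes>\<^bsub>N\<^esub> G0 b) (G0 (a \<otimes>\<^bsub>M\<^esub> b))" "miso N (MFTen G a b)"
    "N.conj_sq R (MFTen F a b) (MFTen G a b)
      (N.conj_ten R (MF0 F a) (G0 a) (MF0 F b) (G0 b) (t a) (t b)) (t (a \<otimes>\<^bsub>M\<^esub> b))"
  using N.conj_lift[of "MFTen F a b" "G0 a \<otimes>\<^bsub>N\<^esub> G0 b"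
      "N.conj_ten R (MF0 F a) (G0 a) (MF0 F b) (G0 b) (t a) (t b)" "G0 (a \<otimes>\<^bsub>M\<^esub> b)" "t (a \<otimes>\<^bsub>M\<^esub> b)"]
    assms by (simp_all add: G_def t N.conj_iso_ten)

lemma G_unit:
  "MFUnit G \<in> mhom N (MUnit N) (G0 (MUnit M))" "miso N (MFUnit G)"
  "N.conj_sq R (MFUnit F) (MFUnit G) (N.conj_unit R) (t (MUnit M))"
  using N.conj_lift[of "MFUnit F" "MUnit N" "N.conj_unit R" "G0 (MUnit M)" "t (MUnit M)"]
  by (simp_all add: G_def t N.conj_iso_unit)

text \<open>In each equational axiom both sides lift the corresponding sides of the axiom for
  \<open>F\<close> (or of the identity laws and units of \<open>N\<close>) between the same
  isomorphisms, so \<open>conj_sq_unique\<close> applies.\<close>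

sublocale G: monoidal_functor M N G
proof
  note [simp] = G_ten(1)[unfolded N.mhom_iff] G_unit(1)[unfolded N.mhom_iff]
  fix a b c :: 'a and a' b' and u v w :: 'm
  show "a \<in> MOb M \<Longrightarrow> MF0 G a \<in> MOb N"
    by simp
  show "u \<in> mhom M a b \<Longrightarrow> MF1 G u \<in> mhom N (MF0 G a) (MF0 G b)"
    using G1 by (auto simp: F.M.mhom_iff)
  show "MF1 G (MId M a) = MId N (MF0 G a)" if "a \<in> MOb M"
    by (rule N.conj_sq_unique) (use t_nat[of "MId M a"] N.conj_sq_id[OF t[OF that]] that in \<open>auto simp: F.f1_id\<close>)
  show "MF1 G (v \<cdot>\<^bsub>M\<^esub> u) = MF1 G v \<cdot>\<^bsub>N\<^esub> MF1 G u" if "v \<in> mhom M b c" "u \<in> mhom M a b"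
    unfolding G_simps by (rule N.conj_sq_unique[OF t_nat[of "v \<cdot>\<^bsub>M\<^esub> u"]])
      (use N.conj_sq_comp[of R "MF1 F u" "G1 u" _ _ "MF1 F v" "G1 v"] t_nat[of u] t_nat[of v] that in \<open>auto simp: F.f1_comp' F.M.mhom_iff\<close>)
  show "MFTen G a b \<in> mhom N (MF0 G a \<otimes>\<^bsub>N\<^esub> MF0 G b) (MF0 G (a \<otimes>\<^bsub>M\<^esub> b)) \<and> miso N (MFTen G a b)"
    if "a \<in> MOb M" "b \<in> MOb M"
    using G_ten that by simp
  show "MFTen G a' b' \<cdot>\<^bsub>N\<^esub> (MF1 G u \<otimes>\<^sub>m\<^bsub>N\<^esub> MF1 G v) = MF1 G (u \<otimes>\<^sub>m\<^bsub>M\<^esub> v) \<cdot>\<^bsub>N\<^esub> MFTen G a b"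
    if uv: "u \<in> mhom M a a'" "v \<in> mhom M b b'"
  proof (rule N.conj_sq_unique)
    note [simp] = uv[unfolded F.M.mhom_iff]
    note [simp] = F.M.mhom_ob[OF uv(1)] F.M.mhom_ob[OF uv(2)]
    show "N.conj_sq R (MFTen F a' b' \<cdot>\<^bsub>N\<^esub> (MF1 F u \<otimes>\<^sub>m\<^bsub>N\<^esub> MF1 F v)) (MFTen G a' b' \<cdot>\<^bsub>N\<^esub> (MF1 G u \<otimes>\<^sub>m\<^bsub>N\<^esub> MF1 G v))
        (N.conj_ten R (MF0 F a) (G0 a) (MF0 F b) (G0 b) (t a) (t b)) (t (a' \<otimes>\<^bsub>M\<^esub> b'))"
      using N.conj_sq_comp[OF N.conj_sq_ten[OF t_nat[of u] t_nat[of v]], of "MFTen F a' b'" "MFTen G a' b'"]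
        G_ten(3)[of a' b'] by simp
    have "N.conj_sq R (MF1 F (u \<otimes>\<^sub>m\<^bsub>M\<^esub> v) \<cdot>\<^bsub>N\<^esub> MFTen F a b) (MF1 G (u \<otimes>\<^sub>m\<^bsub>M\<^esub> v) \<cdot>\<^bsub>N\<^esub> MFTen G a b)
        (N.conj_ten R (MF0 F a) (G0 a) (MF0 F b) (G0 b) (t a) (t b)) (t (a' \<otimes>\<^bsub>M\<^esub> b'))"
      using N.conj_sq_comp[OF G_ten(3)[of a b], of "MF1 F (u \<otimes>\<^sub>m\<^bsub>M\<^esub> v)" "G1 (u \<otimes>\<^sub>m\<^bsub>M\<^esub> v)"]
        t_nat[of "u \<otimes>\<^sub>m\<^bsub>M\<^esub> v"] by simp
    then show "N.conj_sq R (MFTen F a' b' \<cdot>\<^bsub>N\<^esub> (MF1 F u \<otimes>\<^sub>m\<^bsub>N\<^esub> MF1 F v)) (MF1 G (u \<otimes>\<^sub>m\<^bsub>M\<^esub> v) \<cdot>\<^bsub>N\<^esub> MFTen G a b)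
        (N.conj_ten R (MF0 F a) (G0 a) (MF0 F b) (G0 b) (t a) (t b)) (t (a' \<otimes>\<^bsub>M\<^esub> b'))"
      using F.ften_natural[of u v] by simp
  qed (use uv in \<open>auto simp: F.M.mhom_iff\<close>)
  show "MFUnit G \<in> mhom N (MUnit N) (MF0 G (MUnit M)) \<and> miso N (MFUnit G)"
    using G_unit by simp
  show "MF1 G (MAssoc M a b c) \<cdot>\<^bsub>N\<^esub> MFTen G (a \<otimes>\<^bsub>M\<^esub> b) c \<cdot>\<^bsub>N\<^esub> (MFTen G a b \<otimes>\<^sub>m\<^bsub>N\<^esub> MId N (MF0 G c))
      = MFTen G a (b \<otimes>\<^bsub>M\<^esub> c) \<cdot>\<^bsub>N\<^esub> (MId N (MF0 G a) \<otimes>\<^sub>m\<^bsub>N\<^esub> MFTen G b c)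
          \<cdot>\<^bsub>N\<^esub> MAssoc N (MF0 G a) (MF0 G b) (MF0 G c)" (is "?l = ?r")
    if [simp]: "a \<in> MOb M" "b \<in> MOb M" "c \<in> MOb M"
  proof (rule N.conj_sq_unique)
    let ?t2 = "\<lambda>a b. N.conj_ten R (MF0 F a) (G0 a) (MF0 F b) (G0 b) (t a) (t b)"
    let ?s = "N.conj_ten R (MF0 F a \<otimes>\<^bsub>N\<^esub> MF0 F b) (G0 a \<otimes>\<^bsub>N\<^esub> G0 b) (MF0 F c) (G0 c) (?t2 a b) (t c)"
    let ?t = "t (a \<otimes>\<^bsub>M\<^esub> b \<otimes>\<^bsub>M\<^esub> c)"
    let ?f = "MF1 F (MAssoc M a b c) \<cdot>\<^bsub>N\<^esub> MFTen F (a \<otimes>\<^bsub>M\<^esub> b) c \<cdot>\<^bsub>N\<^esub> (MFTen F a b \<otimes>\<^sub>m\<^bsub>N\<^esub> MId N (MF0 F c))"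
    let ?g = "MFTen F a (b \<otimes>\<^bsub>M\<^esub> c) \<cdot>\<^bsub>N\<^esub> (MId N (MF0 F a) \<otimes>\<^sub>m\<^bsub>N\<^esub> MFTen F b c)
            \<cdot>\<^bsub>N\<^esub> MAssoc N (MF0 F a) (MF0 F b) (MF0 F c)"
    have 1: "N.conj_sq R (MFTen F a b \<otimes>\<^sub>m\<^bsub>N\<^esub> MId N (MF0 F c)) (MFTen G a b \<otimes>\<^sub>m\<^bsub>N\<^esub> MId N (G0 c)) ?s (?t2 (a \<otimes>\<^bsub>M\<^esub> b) c)"
      using N.conj_sq_ten[OF G_ten(3)[of a b] N.conj_sq_id[OF t[of c]]] by simp
    have 2: "N.conj_sq R (MFTen F (a \<otimes>\<^bsub>M\<^esub> b) c \<cdot>\<^bsub>N\<^esub> (MFTen F a b \<otimes>\<^sub>m\<^bsub>N\<^esub> MId N (MF0 F c)))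
        (MFTen G (a \<otimes>\<^bsub>M\<^esub> b) c \<cdot>\<^bsub>N\<^esub> (MFTen G a b \<otimes>\<^sub>m\<^bsub>N\<^esub> MId N (G0 c))) ?s (t ((a \<otimes>\<^bsub>M\<^esub> b) \<otimes>\<^bsub>M\<^esub> c))"
      using N.conj_sq_comp[OF 1 G_ten(3)[of "a \<otimes>\<^bsub>M\<^esub> b" c]] by simp
    have 3: "N.conj_sq R (MF1 F (MAssoc M a b c)) (G1 (MAssoc M a b c)) (t ((a \<otimes>\<^bsub>M\<^esub> b) \<otimes>\<^bsub>M\<^esub> c)) ?t"
      using t_nat[of "MAssoc M a b c"] by simp
    show "N.conj_sq R ?f ?l ?s ?t"
      using N.conj_sq_comp[OF 2 3] by simp
    have 4: "N.conj_sq R (MId N (MF0 F a) \<otimes>\<^sub>m\<^bsub>N\<^esub> MFTen F b c) (MId N (G0 a) \<otimes>\<^sub>m\<^bsub>N\<^esub> MFTen G b c)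
        (N.conj_ten R (MF0 F a) (G0 a) (MF0 F b \<otimes>\<^bsub>N\<^esub> MF0 F c) (G0 b \<otimes>\<^bsub>N\<^esub> G0 c) (t a) (?t2 b c)) (?t2 a (b \<otimes>\<^bsub>M\<^esub> c))"
      using N.conj_sq_ten[OF N.conj_sq_id[OF t[of a]] G_ten(3)[of b c]] by simp
    \<comment> \<open>\<open>N.conj_sq_assoc\<close> rebrackets the isomorphism, so that the
      right-hand side starts at the same \<open>?s\<close> as the left-hand side.\<close>
    have 5: "N.conj_sq R ((MId N (MF0 F a) \<otimes>\<^sub>m\<^bsub>N\<^esub> MFTen F b c) \<cdot>\<^bsub>N\<^esub> MAssoc N (MF0 F a) (MF0 F b) (MF0 F c))
        ((MId N (G0 a) \<otimes>\<^sub>m\<^bsub>N\<^esub> MFTen G b c) \<cdot>\<^bsub>N\<^esub> MAssoc N (G0 a) (G0 b) (G0 c)) ?s (?t2 a (b \<otimes>\<^bsub>M\<^esub> c))"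
      using N.conj_sq_comp[OF N.conj_sq_assoc[OF t[of a] t[of b] t[of c]] 4] by simp
    have "N.conj_sq R ?g ?r ?s ?t"
      using N.conj_sq_comp[OF 5 G_ten(3)[of a "b \<otimes>\<^bsub>M\<^esub> c"]] by simp
    \<comment> \<open>Associativity of \<open>F\<close> identifies \<open>?g\<close> with
      \<open>?f\<close>; now both sides lift the same morphism.\<close>
    then show "N.conj_sq R ?f ?r ?s ?t"
      by (simp only: F.fassoc that)
  qed auto
  show "MF1 G (MLUnit M a) \<cdot>\<^bsub>N\<^esub> MFTen G (MUnit M) a \<cdot>\<^bsub>N\<^esub> (MFUnit G \<otimes>\<^sub>m\<^bsub>N\<^esub> MId N (MF0 G a)) = MLUnit N (MF0 G a)"
    if [simp]: "a \<in> MOb M"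
    unfolding G_simps
  proof (rule N.conj_sq_unique[OF _ N.conj_sq_lunit[OF t[of a]]])
    let ?s = "N.conj_ten R (MUnit N) (MUnit N) (MF0 F a) (G0 a) (N.conj_unit R) (t a)"
    have 1: "N.conj_sq R (MFUnit F \<otimes>\<^sub>m\<^bsub>N\<^esub> MId N (MF0 F a)) (MFUnit G \<otimes>\<^sub>m\<^bsub>N\<^esub> MId N (G0 a)) ?s
        (N.conj_ten R (MF0 F (MUnit M)) (G0 (MUnit M)) (MF0 F a) (G0 a) (t (MUnit M)) (t a))"
      using N.conj_sq_ten[OF G_unit(3) N.conj_sq_id[OF t[of a]]] by simp
    have 2: "N.conj_sq R (MFTen F (MUnit M) a \<cdot>\<^bsub>N\<^esub> (MFUnit F \<otimes>\<^sub>m\<^bsub>N\<^esub> MId N (MF0 F a)))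
        (MFTen G (MUnit M) a \<cdot>\<^bsub>N\<^esub> (MFUnit G \<otimes>\<^sub>m\<^bsub>N\<^esub> MId N (G0 a))) ?s (t (MUnit M \<otimes>\<^bsub>M\<^esub> a))"
      using N.conj_sq_comp[OF 1 G_ten(3)[of "MUnit M" a]] by simp
    have 3: "N.conj_sq R (MF1 F (MLUnit M a)) (G1 (MLUnit M a)) (t (MUnit M \<otimes>\<^bsub>M\<^esub> a)) (t a)"
      using t_nat[of "MLUnit M a"] by simp
    show "N.conj_sq R (MLUnit N (MF0 F a)) (G1 (MLUnit M a) \<cdot>\<^bsub>N\<^esub> MFTen G (MUnit M) a \<cdot>\<^bsub>N\<^esub> (MFUnit G \<otimes>\<^sub>m\<^bsub>N\<^esub> MId N (G0 a))) ?s (t a)"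
      using N.conj_sq_comp[OF 2 3] F.flunit[of a] by simp
  qed auto
  show "MF1 G (MRUnit M a) \<cdot>\<^bsub>N\<^esub> MFTen G a (MUnit M) \<cdot>\<^bsub>N\<^esub> (MId N (MF0 G a) \<otimes>\<^sub>m\<^bsub>N\<^esub> MFUnit G) = MRUnit N (MF0 G a)"
    if [simp]: "a \<in> MOb M"
    unfolding G_simps
  proof (rule N.conj_sq_unique[OF _ N.conj_sq_runit[OF t[of a]]])
    let ?s = "N.conj_ten R (MF0 F a) (G0 a) (MUnit N) (MUnit N) (t a) (N.conj_unit R)"
    have 1: "N.conj_sq R (MId N (MF0 F a) \<otimes>\<^sub>m\<^bsub>N\<^esub> MFUnit F) (MId N (G0 a) \<otimes>\<^sub>m\<^bsub>N\<^esub> MFUnit G) ?s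
        (N.conj_ten R (MF0 F a) (G0 a) (MF0 F (MUnit M)) (G0 (MUnit M)) (t a) (t (MUnit M)))"
      using N.conj_sq_ten[OF N.conj_sq_id[OF t[of a]] G_unit(3)] by simp
    have 2: "N.conj_sq R (MFTen F a (MUnit M) \<cdot>\<^bsub>N\<^esub> (MId N (MF0 F a) \<otimes>\<^sub>m\<^bsub>N\<^esub> MFUnit F))
        (MFTen G a (MUnit M) \<cdot>\<^bsub>N\<^esub> (MId N (G0 a) \<otimes>\<^sub>m\<^bsub>N\<^esub> MFUnit G)) ?s (t (a \<otimes>\<^bsub>M\<^esub> MUnit M))"
      using N.conj_sq_comp[OF 1 G_ten(3)[of a "MUnit M"]] by simp
    have 3: "N.conj_sq R (MF1 F (MRUnit M a)) (G1 (MRUnit M a)) (t (a \<otimes>\<^bsub>M\<^esub> MUnit M)) (t a)"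
      using t_nat[of "MRUnit M a"] by simp
    show "N.conj_sq R (MRUnit N (MF0 F a)) (G1 (MRUnit M a) \<cdot>\<^bsub>N\<^esub> MFTen G a (MUnit M) \<cdot>\<^bsub>N\<^esub> (MId N (G0 a) \<otimes>\<^sub>m\<^bsub>N\<^esub> MFUnit G)) ?s (t a)"
      using N.conj_sq_comp[OF 2 3] F.frunit[of a] by simp
  qed auto
qed

end

section \<open>Squares over a monoidal functor\<close>

lemma prod_mcat_simps [simp]:
  "MOb (M \<times>\<^sub>m N) = MOb M \<times> MOb N" "MMor (M \<times>\<^sub>m N) = MMor M \<times> MMor N"
  "MDom (M \<times>\<^sub>m N) (u, v) = (MDom M u, MDom N v)" "MCod (M \<times>\<^sub>m N) (u, v) = (MCod M u, MCod N v)"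
  "MId (M \<times>\<^sub>m N) (a, b) = (MId M a, MId N b)"
  "MComp (M \<times>\<^sub>m N) (u, v) (u', v') = (u \<cdot>\<^bsub>M\<^esub> u', v \<cdot>\<^bsub>N\<^esub> v')"
  "MUnit (M \<times>\<^sub>m N) = (MUnit M, MUnit N)"
  "MTen0 (M \<times>\<^sub>m N) (a, b) (a', b') = (a \<otimes>\<^bsub>M\<^esub> a', b \<otimes>\<^bsub>N\<^esub> b')"
  "MTen1 (M \<times>\<^sub>m N) (u, v) (u', v') = (u \<otimes>\<^sub>m\<^bsub>M\<^esub> u', v \<otimes>\<^sub>m\<^bsub>N\<^esub> v')"
  "MAssoc (M \<times>\<^sub>m N) (a, b) (a', b') (a'', b'') = (MAssoc M a a' a'', MAssoc N b b' b'')"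
  "MLUnit (M \<times>\<^sub>m N) (a, b) = (MLUnit M a, MLUnit N b)"
  "MRUnit (M \<times>\<^sub>m N) (a, b) = (MRUnit M a, MRUnit N b)"
  by (simp_all add: prod_mcat_def)

lemma mhom_prod [simp]: "(u, v) \<in> mhom (M \<times>\<^sub>m N) (a, b) (a', b') \<longleftrightarrow> u \<in> mhom M a a' \<and> v \<in> mhom N b b'"
  by (auto simp: mhom_def)

lemma minverse_prod: "minverse (M \<times>\<^sub>m N) (u, v) (u', v') \<longleftrightarrow> minverse M u u' \<and> minverse N v v'"
  by (auto simp: minverse_def mhom_def)

lemma miso_prod [simp]: "miso (M \<times>\<^sub>m N) (u, v) \<longleftrightarrow> miso M u \<and> miso N v"
  by (auto simp: miso_def minverse_prod)

lemma minv_prod: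
  assumes "monoidal_category M" "monoidal_category N" "monoidal_category (M \<times>\<^sub>m N)" "miso M u" "miso N v"
  shows "minv (M \<times>\<^sub>m N) (u, v) = (minv M u, minv N v)"
  by (rule monoidal_category.minv_eqI[OF assms(3)])
    (simp add: minverse_prod monoidal_category.minverse_minv[OF assms(1,4)]
      monoidal_category.minverse_minv[OF assms(2,5)])

section \<open>The two coordinates of the hexagon for unit swaps\<close>

context monoidal_category
begin

text \<open>The first coordinate of the first hexagon in the product category: \<open>E\<close>
  passes \<open>y \<otimes> z\<close>. The units of the tensor product are rewritten by
  \<open>runit_ten\<close> and \<open>lunit_ten\<close>, and the triangle cancels the unit
  isomorphisms that meet between \<open>y\<close> and \<open>z\<close>.\<close>

lemma unit_swap_assoc1:
  assumes [simp]: "y \<in> MOb M" "z \<in> MOb M"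
  shows "MAssoc M y z (MUnit M) \<cdot> (minv M (MRUnit M (y \<otimes> z)) \<cdot> MLUnit M (y \<otimes> z)) \<cdot> MAssoc M (MUnit M) y z
    = (MId M y \<otimes>\<^sub>m (minv M (MRUnit M z) \<cdot> MLUnit M z)) \<cdot> MAssoc M y (MUnit M) z
        \<cdot> ((minv M (MRUnit M y) \<cdot> MLUnit M y) \<otimes>\<^sub>m MId M z)"
proof -
  let ?E = "MUnit M" and ?i = "MId M" and ?A = "MAssoc M"
  have 1: "?A y z ?E \<cdot> minv M (MRUnit M (y \<otimes> z)) = ?i y \<otimes>\<^sub>m minv M (MRUnit M z)"
    using arg_cong[OF runit_ten[of y z], of "minv M", symmetric] by simp
  have 2: "(?i y \<otimes>\<^sub>m MLUnit M z) \<cdot> ?A y ?E z \<cdot> (minv M (MRUnit M y) \<otimes>\<^sub>m ?i z) = ?i (y \<otimes> z)"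
    by (subst comp_reassoc[OF triangle]) (simp_all add: ten_comp)
  have "?A y z ?E \<cdot> (minv M (MRUnit M (y \<otimes> z)) \<cdot> MLUnit M (y \<otimes> z)) \<cdot> ?A ?E y z
      = (?A y z ?E \<cdot> minv M (MRUnit M (y \<otimes> z))) \<cdot> MLUnit M (y \<otimes> z) \<cdot> ?A ?E y z"
    by simp
  also have "\<dots> = (?i y \<otimes>\<^sub>m minv M (MRUnit M z)) \<cdot> ?i (y \<otimes> z) \<cdot> (MLUnit M y \<otimes>\<^sub>m ?i z)"
    unfolding 1 by (simp add: lunit_ten)
  also have "\<dots> = (?i y \<otimes>\<^sub>m (minv M (MRUnit M z) \<cdot> MLUnit M z)) \<cdot> ?A y ?E z
        \<cdot> ((minv M (MRUnit M y) \<cdot> MLUnit M y) \<otimes>\<^sub>m ?i z)"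
    unfolding 2[symmetric] by (simp add: ten_id_comp)
  finally show ?thesis .
qed

text \<open>The second coordinate of the same hexagon: \<open>x\<close> passes two copies of
  \<open>E\<close>. The factors \<open>MLUnit M (MUnit M)\<close> occur because the product of
  \<open>(y, E)\<close> and \<open>(z, E)\<close> has second coordinate
  \<open>E \<otimes> E\<close>, while the braiding with \<open>y \<otimes> z\<close> uses
  \<open>(y \<otimes> z, E)\<close>.\<close>

lemma unit_swap_assoc2:
  assumes [simp]: "x \<in> MOb M"
  shows "MAssoc M (MUnit M) (MUnit M) x \<cdot> (minv M (MLUnit M (MUnit M)) \<otimes>\<^sub>m MId M x)
      \<cdot> (minv M (MLUnit M x) \<cdot> MRUnit M x) \<cdot> (MId M x \<otimes>\<^sub>m MLUnit M (MUnit M)) \<cdot> MAssoc M x (MUnit M) (MUnit M)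
    = (MId M (MUnit M) \<otimes>\<^sub>m (minv M (MLUnit M x) \<cdot> MRUnit M x)) \<cdot> MAssoc M (MUnit M) x (MUnit M)
      \<cdot> ((minv M (MLUnit M x) \<cdot> MRUnit M x) \<otimes>\<^sub>m MId M (MUnit M))"
proof -
  let ?E = "MUnit M" and ?i = "MId M" and ?A = "MAssoc M" and ?l = "MLUnit M" and ?r = "MRUnit M"
  have 1: "?A ?E ?E x \<cdot> (minv M (?l ?E) \<otimes>\<^sub>m ?i x) = ?i ?E \<otimes>\<^sub>m minv M (?l x)"
    using arg_cong[OF triangle[of ?E x], of "minv M", symmetric] by (simp add: lunit_unit)
  have 2: "?A ?E x ?E \<cdot> (minv M (?l x) \<otimes>\<^sub>m ?i ?E) = minv M (?l (x \<otimes> ?E))"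
    using arg_cong[OF lunit_ten[of x ?E], of "minv M", symmetric] by simp
  have 3: "(?i ?E \<otimes>\<^sub>m ?r x) \<cdot> minv M (?l (x \<otimes> ?E)) = minv M (?l x) \<cdot> ?r x"
    using minv_shift[of "?r x" "?l (x \<otimes> ?E)" "?l x" "?i ?E \<otimes>\<^sub>m ?r x"] lunit_natural[of "?r x"] by simp
  have "?A ?E ?E x \<cdot> (minv M (?l ?E) \<otimes>\<^sub>m ?i x) \<cdot> (minv M (?l x) \<cdot> ?r x) \<cdot> (?i x \<otimes>\<^sub>m ?l ?E) \<cdot> ?A x ?E ?E
     = (?A ?E ?E x \<cdot> (minv M (?l ?E) \<otimes>\<^sub>m ?i x)) \<cdot> (minv M (?l x) \<cdot> ?r x) \<cdot> (?i x \<otimes>\<^sub>m ?l ?E) \<cdot> ?A x ?E ?E"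
    by simp
  also have "\<dots> = (?i ?E \<otimes>\<^sub>m minv M (?l x)) \<cdot> (minv M (?l x) \<cdot> ?r x) \<cdot> (?r x \<otimes>\<^sub>m ?i ?E)"
    unfolding 1 by (simp add: triangle)
  also have "\<dots> = (?i ?E \<otimes>\<^sub>m minv M (?l x)) \<cdot> ((?i ?E \<otimes>\<^sub>m ?r x) \<cdot> ?A ?E x ?E \<cdot> (minv M (?l x) \<otimes>\<^sub>m ?i ?E)) \<cdot> (?r x \<otimes>\<^sub>m ?i ?E)"
    unfolding 2 3 ..
  also have "\<dots> = (?i ?E \<otimes>\<^sub>m (minv M (?l x) \<cdot> ?r x)) \<cdot> ?A ?E x ?E \<cdot> ((minv M (?l x) \<cdot> ?r x) \<otimes>\<^sub>m ?i ?E)"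
    by (simp add: ten_id_comp)
  finally show ?thesis .
qed

end

context monoidal_functor
begin

text \<open>
  The triples \<open>(x, a, k)\<close> with \<open>k : F x \<cong> a\<close> are the objects of a monoidal category that projects
  strictly to \<open>M\<close> and \<open>N\<close>; \<open>im_sq\<close> describes its morphisms and \<open>im_ten\<close> its tensor product. The
  component in \<open>M\<close> of a morphism determines that in \<open>N\<close>.
\<close>

definition im_iso :: "'a \<Rightarrow> 'b \<Rightarrow> 'n \<Rightarrow> bool" where
  "im_iso x a k \<longleftrightarrow> x \<in> MOb M \<and> miso N k \<and> MDom N k = MF0 F x \<and> MCod N k = a"

definition im_ten :: "'a \<Rightarrow> 'a \<Rightarrow> 'n \<Rightarrow> 'n \<Rightarrow> 'n" where
  "im_ten x y k l = (k \<otimes>\<^sub>m\<^bsub>N\<^esub> l) \<cdot>\<^bsub>N\<^esub> minv N (MFTen F x y)"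

definition im_sq :: "'m \<Rightarrow> 'n \<Rightarrow> 'n \<Rightarrow> 'n \<Rightarrow> bool" where
  "im_sq f g k l \<longleftrightarrow> f \<in> MMor M \<and> g \<in> MMor N \<and> im_iso (MDom M f) (MDom N g) k \<and>
     im_iso (MCod M f) (MCod N g) l \<and> g \<cdot>\<^bsub>N\<^esub> k = l \<cdot>\<^bsub>N\<^esub> MF1 F f"

lemma im_iso_simps:
  assumes "im_iso x a k"
  shows "x \<in> MOb M" "a \<in> MOb N" "k \<in> MMor N" "miso N k" "MDom N k = MF0 F x" "MCod N k = a"
  using assms N.cod_ob[of k] by (auto simp: im_iso_def N.miso_mor)

lemma im_iso_ten:
  assumes "im_iso x a k" "im_iso y b l"
  shows "im_iso (x \<otimes>\<^bsub>M\<^esub> y) (a \<otimes>\<^bsub>N\<^esub> b) (im_ten x y k l)"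
  using im_iso_simps[OF assms(1)] im_iso_simps[OF assms(2)] by (simp add: im_iso_def im_ten_def)

lemma im_sq_id: "im_iso x a k \<Longrightarrow> im_sq (MId M x) (MId N a) k k"
  using im_iso_simps[where x = x and a = a and k = k] by (simp add: im_sq_def f1_id)

lemma im_sq_comp:
  assumes "im_sq f f' k l" "im_sq g g' l m" "MDom M g = MCod M f"
  shows "im_sq (g \<cdot>\<^bsub>M\<^esub> f) (g' \<cdot>\<^bsub>N\<^esub> f') k m"
proof -
  note 1 = assms[unfolded im_sq_def]
  have I: "im_iso (MDom M f) (MDom N f') k" "im_iso (MCod M f) (MCod N f') l" "im_iso (MCod M g) (MCod N g') m"
    using 1 by auto
  note [simp] = I[THEN im_iso_simps(3)] I[THEN im_iso_simps(4)] I[THEN im_iso_simps(5)] I[THEN im_iso_simps(6)]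
  have [simp]: "f \<in> MMor M" "f' \<in> MMor N" "g \<in> MMor M" "g' \<in> MMor N" "MDom M g = MCod M f"
    using 1 by auto
  have [simp]: "MDom N g' = MCod N f'"
    using 1 by (metis im_iso_def)
  have "(g' \<cdot>\<^bsub>N\<^esub> f') \<cdot>\<^bsub>N\<^esub> k = g' \<cdot>\<^bsub>N\<^esub> l \<cdot>\<^bsub>N\<^esub> MF1 F f"
    using 1 by simp
  also have "\<dots> = m \<cdot>\<^bsub>N\<^esub> MF1 F g \<cdot>\<^bsub>N\<^esub> MF1 F f"
    using 1 by (intro N.comp_reassoc2) auto
  finally show ?thesis
    using I by (simp add: im_sq_def f1_comp')
qed

lemma im_sq_minv:
  assumes "im_sq f g k l" "miso M f" "miso N g"
  shows "im_sq (minv M f) (minv N g) l k"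
proof -
  note 1 = assms(1)[unfolded im_sq_def]
  have I: "im_iso (MDom M f) (MDom N g) k" "im_iso (MCod M f) (MCod N g) l"
    using 1 by auto
  note [simp] = I[THEN im_iso_simps(3)] I[THEN im_iso_simps(4)] I[THEN im_iso_simps(5)] I[THEN im_iso_simps(6)]
    assms(2,3)
  have "minv N g \<cdot>\<^bsub>N\<^esub> l = k \<cdot>\<^bsub>N\<^esub> minv N (MF1 F f)"
    by (rule N.minv_shift) (use 1 in auto)
  then show ?thesis
    using 1 by (simp add: im_sq_def)
qed

lemma im_sq_ten:
  assumes "im_sq f f' k l" "im_sq g g' m n"
  shows "im_sq (f \<otimes>\<^sub>m\<^bsub>M\<^esub> g) (f' \<otimes>\<^sub>m\<^bsub>N\<^esub> g') (im_ten (MDom M f) (MDom M g) k m) (im_ten (MCod M f) (MCod M g) l n)"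
proof -
  note 1 = assms[unfolded im_sq_def]
  have I: "im_iso (MDom M f) (MDom N f') k" "im_iso (MCod M f) (MCod N f') l"
    "im_iso (MDom M g) (MDom N g') m" "im_iso (MCod M g) (MCod N g') n"
    using 1 by auto
  note [simp] = I[THEN im_iso_simps(3)] I[THEN im_iso_simps(4)] I[THEN im_iso_simps(5)] I[THEN im_iso_simps(6)]
  have [simp]: "f \<in> MMor M" "f' \<in> MMor N" "g \<in> MMor M" "g' \<in> MMor N"
    using 1 by auto
  have 2: "(MF1 F f \<otimes>\<^sub>m\<^bsub>N\<^esub> MF1 F g) \<cdot>\<^bsub>N\<^esub> minv N (MFTen F (MDom M f) (MDom M g))
      = minv N (MFTen F (MCod M f) (MCod M g)) \<cdot>\<^bsub>N\<^esub> MF1 F (f \<otimes>\<^sub>m\<^bsub>M\<^esub> g)"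
    by (rule N.minv_shift[symmetric]) (simp_all add: ften_natural)
  have "(f' \<otimes>\<^sub>m\<^bsub>N\<^esub> g') \<cdot>\<^bsub>N\<^esub> im_ten (MDom M f) (MDom M g) k m
     = ((f' \<cdot>\<^bsub>N\<^esub> k) \<otimes>\<^sub>m\<^bsub>N\<^esub> (g' \<cdot>\<^bsub>N\<^esub> m)) \<cdot>\<^bsub>N\<^esub> minv N (MFTen F (MDom M f) (MDom M g))"
    unfolding im_ten_def by (rule N.comp_reassoc) (auto simp: N.ten_comp)
  also have "\<dots> = ((l \<otimes>\<^sub>m\<^bsub>N\<^esub> n) \<cdot>\<^bsub>N\<^esub> (MF1 F f \<otimes>\<^sub>m\<^bsub>N\<^esub> MF1 F g)) \<cdot>\<^bsub>N\<^esub> minv N (MFTen F (MDom M f) (MDom M g))"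
    using 1 by (simp add: N.ten_comp)
  also have "\<dots> = im_ten (MCod M f) (MCod M g) l n \<cdot>\<^bsub>N\<^esub> MF1 F (f \<otimes>\<^sub>m\<^bsub>M\<^esub> g)"
    using 2 by (simp add: im_ten_def)
  finally show ?thesis
    using I by (simp add: im_sq_def im_iso_ten)
qed

text \<open>Both nested tensor products are a tensor product of \<open>k\<close>, \<open>l\<close>,
  \<open>m\<close> preceded by an inverse constraint of \<open>F\<close>; associativity of
  \<open>F\<close>, inverted by \<open>minv_shift\<close>, compares the two constraints.\<close>

lemma im_sq_assoc:
  assumes "im_iso x a k" "im_iso y b l" "im_iso z c m"
  shows "im_sq (MAssoc M x y z) (MAssoc N a b c)
    (im_ten (x \<otimes>\<^bsub>M\<^esub> y) z (im_ten x y k l) m) (im_ten x (y \<otimes>\<^bsub>M\<^esub> z) k (im_ten y z l m))"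
proof -
  note [simp] = assms[THEN im_iso_simps(1)] assms[THEN im_iso_simps(2)] assms[THEN im_iso_simps(3)]
    assms[THEN im_iso_simps(4)] assms[THEN im_iso_simps(5)] assms[THEN im_iso_simps(6)]
  let ?f = "MFTen F (x \<otimes>\<^bsub>M\<^esub> y) z \<cdot>\<^bsub>N\<^esub> (MFTen F x y \<otimes>\<^sub>m\<^bsub>N\<^esub> MId N (MF0 F z))"
  let ?g = "MFTen F x (y \<otimes>\<^bsub>M\<^esub> z) \<cdot>\<^bsub>N\<^esub> (MId N (MF0 F x) \<otimes>\<^sub>m\<^bsub>N\<^esub> MFTen F y z)"
  have "im_ten (x \<otimes>\<^bsub>M\<^esub> y) z (im_ten x y k l) m = ((k \<otimes>\<^sub>m\<^bsub>N\<^esub> l) \<otimes>\<^sub>m\<^bsub>N\<^esub> m) \<cdot>\<^bsub>N\<^esub> minv N ?f"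
    unfolding im_ten_def by (simp, subst N.comp_reassoc[OF N.ten_comp]) auto
  moreover have "im_ten x (y \<otimes>\<^bsub>M\<^esub> z) k (im_ten y z l m) = (k \<otimes>\<^sub>m\<^bsub>N\<^esub> (l \<otimes>\<^sub>m\<^bsub>N\<^esub> m)) \<cdot>\<^bsub>N\<^esub> minv N ?g"
    unfolding im_ten_def by (simp, subst N.comp_reassoc[OF N.ten_comp]) auto
  moreover have "MAssoc N (MF0 F x) (MF0 F y) (MF0 F z) \<cdot>\<^bsub>N\<^esub> minv N ?f = minv N ?g \<cdot>\<^bsub>N\<^esub> MF1 F (MAssoc M x y z)"
    by (rule N.minv_shift[symmetric]) (use fassoc[of x y z] in simp_all)
  moreover have "MAssoc N a b c \<cdot>\<^bsub>N\<^esub> ((k \<otimes>\<^sub>m\<^bsub>N\<^esub> l) \<otimes>\<^sub>m\<^bsub>N\<^esub> m) \<cdot>\<^bsub>N\<^esub> minv N ?f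
      = (k \<otimes>\<^sub>m\<^bsub>N\<^esub> (l \<otimes>\<^sub>m\<^bsub>N\<^esub> m)) \<cdot>\<^bsub>N\<^esub> MAssoc N (MF0 F x) (MF0 F y) (MF0 F z) \<cdot>\<^bsub>N\<^esub> minv N ?f"
    by (rule N.comp_reassoc2) (use N.assoc_natural[of k l m] in simp_all)
  ultimately have "MAssoc N a b c \<cdot>\<^bsub>N\<^esub> im_ten (x \<otimes>\<^bsub>M\<^esub> y) z (im_ten x y k l) m
      = im_ten x (y \<otimes>\<^bsub>M\<^esub> z) k (im_ten y z l m) \<cdot>\<^bsub>N\<^esub> MF1 F (MAssoc M x y z)"
    by simp
  then show ?thesis
    using assms by (simp add: im_sq_def im_iso_ten)
qed

lemma im_sq_unique:
  assumes "im_sq f g k l" "im_sq f h k l"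
  shows "g = h"
  by (rule N.miso_cancel_right[of k]) (use assms in \<open>auto simp: im_sq_def im_iso_def\<close>)

end

section \<open>The braiding induced by a multiplication\<close>

context multiplication
begin

abbreviation (input) "swap a b \<equiv>
  (minv M (MRUnit M b) \<cdot>\<^bsub>M\<^esub> MLUnit M b, minv M (MLUnit M a) \<cdot>\<^bsub>M\<^esub> MRUnit M a)"

lemma minv_pair: "\<lbrakk>miso M u; miso M v\<rbrakk> \<Longrightarrow> minv (M \<times>\<^sub>m M) (u, v) = (minv M u, minv M v)"
  by (intro minv_prod) unfold_locales

lemma \<rho>_iso: "b \<in> MOb M \<Longrightarrow> im_iso (b, MUnit M) b (\<rho> b)"
  using right.component[of b] by (auto simp: im_iso_def mf_comp_def ins_l_def mf_id_def N.mhom_iff)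

lemma lam_iso: "a \<in> MOb M \<Longrightarrow> im_iso (MUnit M, a) a (lam a)"
  using left.component[of a] by (auto simp: im_iso_def mf_comp_def ins_r_def mf_id_def N.mhom_iff)

lemma \<rho>_sq: "u \<in> MMor M \<Longrightarrow> im_sq (u, MId M (MUnit M)) u (\<rho> (MDom M u)) (\<rho> (MCod M u))"
  using right.natural[of u "MDom M u" "MCod M u"]
  by (simp add: im_sq_def \<rho>_iso mf_comp_def ins_l_def mf_id_def N.mhom_iff)

lemma lam_sq: "u \<in> MMor M \<Longrightarrow> im_sq (MId M (MUnit M), u) u (lam (MDom M u)) (lam (MCod M u))"
  using left.natural[of u "MDom M u" "MCod M u"]
  by (simp add: im_sq_def lam_iso mf_comp_def ins_r_def mf_id_def N.mhom_iff)

text \<open>Monoidality of \<open>\<rho>\<close> read as a square. The product of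
  \<open>(a, E)\<close> and \<open>(b, E)\<close> has second coordinate
  \<open>E \<otimes> E\<close>, hence the left unit of \<open>E\<close>. The other component is an
  identity, so inserting this square into a composite changes only the part in the product
  category.\<close>

lemma \<rho>_ten_sq:
  assumes "a \<in> MOb M" "b \<in> MOb M"
  shows "im_sq (MId M (a \<otimes>\<^bsub>M\<^esub> b), MLUnit M (MUnit M)) (MId M (a \<otimes>\<^bsub>M\<^esub> b))
    (im_ten (a, MUnit M) (b, MUnit M) (\<rho> a) (\<rho> b)) (\<rho> (a \<otimes>\<^bsub>M\<^esub> b))"
proof -
  note [simp] = assms im_iso_simps(3-)[OF \<rho>_iso]
  have "\<rho> (a \<otimes>\<^bsub>M\<^esub> b) \<cdot>\<^bsub>M\<^esub> MF1 \<phi> (MId M (a \<otimes>\<^bsub>M\<^esub> b), MLUnit M (MUnit M)) \<cdot>\<^bsub>M\<^esub> MFTen \<phi> (a, MUnit M) (b, MUnit M)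
      = \<rho> a \<otimes>\<^sub>m\<^bsub>M\<^esub> \<rho> b"
    using right.tensor[of a b] by (simp add: mf_comp_def ins_l_def mf_id_def)
  then have "\<rho> a \<otimes>\<^sub>m\<^bsub>M\<^esub> \<rho> b
    = (\<rho> (a \<otimes>\<^bsub>M\<^esub> b) \<cdot>\<^bsub>M\<^esub> MF1 \<phi> (MId M (a \<otimes>\<^bsub>M\<^esub> b), MLUnit M (MUnit M))) \<cdot>\<^bsub>M\<^esub> MFTen \<phi> (a, MUnit M) (b, MUnit M)"
    by simp
  then show ?thesis
    using im_iso_ten[OF \<rho>_iso \<rho>_iso, of a b] by (simp add: im_sq_def \<rho>_iso im_ten_def)
qed

lemma lam_ten_sq:
  assumes "a \<in> MOb M" "b \<in> MOb M"
  shows "im_sq (MLUnit M (MUnit M), MId M (a \<otimes>\<^bsub>M\<^esub> b)) (MId M (a \<otimes>\<^bsub>M\<^esub> b))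
    (im_ten (MUnit M, a) (MUnit M, b) (lam a) (lam b)) (lam (a \<otimes>\<^bsub>M\<^esub> b))"
proof -
  note [simp] = assms im_iso_simps(3-)[OF lam_iso]
  have "lam (a \<otimes>\<^bsub>M\<^esub> b) \<cdot>\<^bsub>M\<^esub> MF1 \<phi> (MLUnit M (MUnit M), MId M (a \<otimes>\<^bsub>M\<^esub> b)) \<cdot>\<^bsub>M\<^esub> MFTen \<phi> (MUnit M, a) (MUnit M, b)
      = lam a \<otimes>\<^sub>m\<^bsub>M\<^esub> lam b"
    using left.tensor[of a b] by (simp add: mf_comp_def ins_r_def mf_id_def)
  then have "lam a \<otimes>\<^sub>m\<^bsub>M\<^esub> lam b
    = (lam (a \<otimes>\<^bsub>M\<^esub> b) \<cdot>\<^bsub>M\<^esub> MF1 \<phi> (MLUnit M (MUnit M), MId M (a \<otimes>\<^bsub>M\<^esub> b))) \<cdot>\<^bsub>M\<^esub> MFTen \<phi> (MUnit M, a) (MUnit M, b)"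
    by simp
  then show ?thesis
    using im_iso_ten[OF lam_iso lam_iso, of a b] by (simp add: im_sq_def lam_iso im_ten_def)
qed

abbreviation "braiding \<equiv> induced_braiding M \<phi> \<rho> lam"

lemma braiding_simps:
  assumes "a \<in> MOb M" "b \<in> MOb M"
  shows "braiding a b \<in> MMor M" "MDom M (braiding a b) = a \<otimes>\<^bsub>M\<^esub> b" "MCod M (braiding a b) = b \<otimes>\<^bsub>M\<^esub> a" "miso M (braiding a b)"
  using im_iso_simps(3-)[OF \<rho>_iso[OF assms(2)]] im_iso_simps(3-)[OF lam_iso[OF assms(1)]] assms
  by (simp_all add: induced_braiding_def Let_def)

text \<open>The first two and the last two morphisms of the Joyal--Street composite are the inverse
  of the source isomorphism and the target isomorphism of this square; the two values of
  \<open>\<phi>\<close> in the middle compose to its value at the swap.\<close>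

lemma braiding_sq:
  assumes "a \<in> MOb M" "b \<in> MOb M"
  shows "im_sq (swap a b) (braiding a b)
    (im_ten (MUnit M, a) (b, MUnit M) (lam a) (\<rho> b)) (im_ten (b, MUnit M) (MUnit M, a) (\<rho> b) (lam a))"
proof -
  note [simp] = im_iso_simps(3-)[OF \<rho>_iso[OF assms(2)]] im_iso_simps(3-)[OF lam_iso[OF assms(1)]] assms
  have "MF1 \<phi> (swap a b) = MF1 \<phi> (minv M (MRUnit M b), minv M (MLUnit M a)) \<cdot>\<^bsub>M\<^esub> MF1 \<phi> (MLUnit M b, MRUnit M a)"
    by (subst f1_comp'[symmetric]) auto
  moreover have "(minv M (lam a) \<otimes>\<^sub>m\<^bsub>M\<^esub> minv M (\<rho> b)) \<cdot>\<^bsub>M\<^esub> im_ten (MUnit M, a) (b, MUnit M) (lam a) (\<rho> b)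
      = minv M (MFTen \<phi> (MUnit M, a) (b, MUnit M))"
    unfolding im_ten_def by (subst N.comp_reassoc[OF N.ten_comp]) auto
  ultimately show ?thesis
    using im_iso_ten[OF \<rho>_iso lam_iso, of b a] im_iso_ten[OF lam_iso \<rho>_iso, of a b]
      im_iso_simps(3-)[OF im_iso_ten[OF lam_iso \<rho>_iso, of a b]]
    by (simp add: im_sq_def braiding_simps) (simp add: induced_braiding_def Let_def im_ten_def)
qed

sublocale braided_monoidal_category M braiding
proof
  fix a b a' b' u v
  show "braiding a b \<in> mhom M (a \<otimes>\<^bsub>M\<^esub> b) (b \<otimes>\<^bsub>M\<^esub> a) \<and> miso M (braiding a b)" if "a \<in> MOb M" "b \<in> MOb M"
    using braiding_simps[OF that] by (simp add: N.mhom_iff)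
  show "braiding a' b' \<cdot>\<^bsub>M\<^esub> (u \<otimes>\<^sub>m\<^bsub>M\<^esub> v) = (v \<otimes>\<^sub>m\<^bsub>M\<^esub> u) \<cdot>\<^bsub>M\<^esub> braiding a b" if uv: "u \<in> mhom M a a'" "v \<in> mhom M b b'"
  proof -
    let ?E = "MUnit M"
    note [simp] = uv[unfolded N.mhom_iff] N.mhom_ob[OF uv(1)] N.mhom_ob[OF uv(2)]
    have 1: "im_sq ((MId M ?E, u) \<otimes>\<^sub>m\<^bsub>M \<times>\<^sub>m M\<^esub> (v, MId M ?E)) (u \<otimes>\<^sub>m\<^bsub>M\<^esub> v)
        (im_ten (?E, a) (b, ?E) (lam a) (\<rho> b)) (im_ten (?E, a') (b', ?E) (lam a') (\<rho> b'))"
      using im_sq_ten[OF lam_sq[of u] \<rho>_sq[of v]] by simp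
    have 2: "im_sq ((v, MId M ?E) \<otimes>\<^sub>m\<^bsub>M \<times>\<^sub>m M\<^esub> (MId M ?E, u)) (v \<otimes>\<^sub>m\<^bsub>M\<^esub> u)
        (im_ten (b, ?E) (?E, a) (\<rho> b) (lam a)) (im_ten (b', ?E) (?E, a') (\<rho> b') (lam a'))"
      using im_sq_ten[OF \<rho>_sq[of v] lam_sq[of u]] by simp
    have 3: "minv M (MRUnit M b') \<cdot>\<^bsub>M\<^esub> v = (v \<otimes>\<^sub>m\<^bsub>M\<^esub> MId M ?E) \<cdot>\<^bsub>M\<^esub> minv M (MRUnit M b)"
      "minv M (MLUnit M a') \<cdot>\<^bsub>M\<^esub> u = (MId M ?E \<otimes>\<^sub>m\<^bsub>M\<^esub> u) \<cdot>\<^bsub>M\<^esub> minv M (MLUnit M a)"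
      using N.minv_shift[of v "MRUnit M b" "MRUnit M b'" "v \<otimes>\<^sub>m\<^bsub>M\<^esub> MId M ?E"] N.runit_natural[of v]
        N.minv_shift[of u "MLUnit M a" "MLUnit M a'" "MId M ?E \<otimes>\<^sub>m\<^bsub>M\<^esub> u"] N.lunit_natural[of u]
      by simp_all
    have 4: "minv M (MRUnit M b') \<cdot>\<^bsub>M\<^esub> v \<cdot>\<^bsub>M\<^esub> MLUnit M b = (v \<otimes>\<^sub>m\<^bsub>M\<^esub> MId M ?E) \<cdot>\<^bsub>M\<^esub> minv M (MRUnit M b) \<cdot>\<^bsub>M\<^esub> MLUnit M b"
      "minv M (MLUnit M a') \<cdot>\<^bsub>M\<^esub> u \<cdot>\<^bsub>M\<^esub> MRUnit M a = (MId M ?E \<otimes>\<^sub>m\<^bsub>M\<^esub> u) \<cdot>\<^bsub>M\<^esub> minv M (MLUnit M a) \<cdot>\<^bsub>M\<^esub> MRUnit M a"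
      by (rule N.comp_reassoc2; simp add: 3)+
    \<comment> \<open>Coordinatewise this is naturality of the unit constraints, at \<open>v\<close>
      in the first coordinate and at \<open>u\<close> in the second.\<close>
    have "swap a' b' \<cdot>\<^bsub>M \<times>\<^sub>m M\<^esub> ((MId M ?E, u) \<otimes>\<^sub>m\<^bsub>M \<times>\<^sub>m M\<^esub> (v, MId M ?E))
        = ((v, MId M ?E) \<otimes>\<^sub>m\<^bsub>M \<times>\<^sub>m M\<^esub> (MId M ?E, u)) \<cdot>\<^bsub>M \<times>\<^sub>m M\<^esub> swap a b"
      using N.lunit_natural[of v] N.runit_natural[of u] 4 by simp
    then show ?thesis
      using im_sq_comp[OF 1 braiding_sq[of a' b']] im_sq_comp[OF braiding_sq[of a b] 2]
      by (intro im_sq_unique) auto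
  qed
next
  fix x y z
  assume [simp]: "x \<in> MOb M" "y \<in> MOb M" "z \<in> MOb M"
  let ?E = "MUnit M" and ?P = "M \<times>\<^sub>m M"
  note [simp] = braiding_simps minv_pair
  have I: "im_iso (?E, x) x (lam x)" "im_iso (?E, y) y (lam y)" "im_iso (y, ?E) y (\<rho> y)" "im_iso (z, ?E) z (\<rho> z)"
    by (simp_all add: \<rho>_iso lam_iso)
  show "MAssoc M y z x \<cdot>\<^bsub>M\<^esub> braiding x (y \<otimes>\<^bsub>M\<^esub> z) \<cdot>\<^bsub>M\<^esub> MAssoc M x y z
    = (MId M y \<otimes>\<^sub>m\<^bsub>M\<^esub> braiding x z) \<cdot>\<^bsub>M\<^esub> MAssoc M y x z \<cdot>\<^bsub>M\<^esub> (braiding x y \<otimes>\<^sub>m\<^bsub>M\<^esub> MId M z)"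
  proof -
    let ?X = "(?E, x)" and ?Y = "(y, ?E)" and ?Z = "(z, ?E)" and ?k = "lam x" and ?l = "\<rho> y" and ?m = "\<rho> z"
    \<comment> \<open>\<open>?j\<close> compares the product of \<open>(y, E)\<close> and
      \<open>(z, E)\<close> with \<open>(y \<otimes> z, E)\<close>. Its square has an identity as
      component in \<open>M\<close>, so \<open>?g1\<close> and \<open>?g2\<close> make the composite
      in the product category well typed without altering the hexagon in \<open>M\<close>.\<close>
    let ?j = "(MId M (y \<otimes>\<^bsub>M\<^esub> z), MLUnit M ?E)"
    let ?s = "im_ten (?X \<otimes>\<^bsub>?P\<^esub> ?Y) ?Z (im_ten ?X ?Y ?k ?l) ?m"
    let ?t = "im_ten ?Y (?Z \<otimes>\<^bsub>?P\<^esub> ?X) ?l (im_ten ?Z ?X ?m ?k)"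
    let ?f1 = "swap x y \<otimes>\<^sub>m\<^bsub>?P\<^esub> MId ?P ?Z" and ?f2 = "MAssoc ?P ?Y ?X ?Z" and ?f3 = "MId ?P ?Y \<otimes>\<^sub>m\<^bsub>?P\<^esub> swap x z"
    have 1: "im_sq ?f1 (braiding x y \<otimes>\<^sub>m\<^bsub>M\<^esub> MId M z) ?s (im_ten (?Y \<otimes>\<^bsub>?P\<^esub> ?X) ?Z (im_ten ?Y ?X ?l ?k) ?m)"
      using im_sq_ten[OF braiding_sq[of x y] im_sq_id[OF I(4)]] by simp
    have 2: "im_sq (?f2 \<cdot>\<^bsub>?P\<^esub> ?f1) (MAssoc M y x z \<cdot>\<^bsub>M\<^esub> (braiding x y \<otimes>\<^sub>m\<^bsub>M\<^esub> MId M z)) ?s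
        (im_ten ?Y (?X \<otimes>\<^bsub>?P\<^esub> ?Z) ?l (im_ten ?X ?Z ?k ?m))"
      using im_sq_comp[OF 1 im_sq_assoc[OF I(3,1,4)]] by simp
    have 3: "im_sq ?f3 (MId M y \<otimes>\<^sub>m\<^bsub>M\<^esub> braiding x z) (im_ten ?Y (?X \<otimes>\<^bsub>?P\<^esub> ?Z) ?l (im_ten ?X ?Z ?k ?m)) ?t"
      using im_sq_ten[OF im_sq_id[OF I(3)] braiding_sq[of x z]] by simp
    have 4: "im_sq (?f3 \<cdot>\<^bsub>?P\<^esub> ?f2 \<cdot>\<^bsub>?P\<^esub> ?f1) ((MId M y \<otimes>\<^sub>m\<^bsub>M\<^esub> braiding x z) \<cdot>\<^bsub>M\<^esub> MAssoc M y x z \<cdot>\<^bsub>M\<^esub> (braiding x y \<otimes>\<^sub>m\<^bsub>M\<^esub> MId M z)) ?s ?t"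
      using im_sq_comp[OF 2 3] by simp
    let ?g1 = "MId ?P ?X \<otimes>\<^sub>m\<^bsub>?P\<^esub> ?j" and ?g2 = "minv ?P ?j \<otimes>\<^sub>m\<^bsub>?P\<^esub> MId ?P ?X"
    have 5: "im_sq ?g1 (MId M (x \<otimes>\<^bsub>M\<^esub> y \<otimes>\<^bsub>M\<^esub> z)) (im_ten ?X (?Y \<otimes>\<^bsub>?P\<^esub> ?Z) ?k (im_ten ?Y ?Z ?l ?m))
        (im_ten ?X (y \<otimes>\<^bsub>M\<^esub> z, ?E) ?k (\<rho> (y \<otimes>\<^bsub>M\<^esub> z)))"
      using im_sq_ten[OF im_sq_id[OF I(1)] \<rho>_ten_sq[of y z]] by simp
    have 6: "im_sq (minv ?P ?j) (MId M (y \<otimes>\<^bsub>M\<^esub> z)) (\<rho> (y \<otimes>\<^bsub>M\<^esub> z)) (im_ten ?Y ?Z ?l ?m)"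
      using im_sq_minv[OF \<rho>_ten_sq[of y z]] by simp
    have 7: "im_sq ?g2 (MId M ((y \<otimes>\<^bsub>M\<^esub> z) \<otimes>\<^bsub>M\<^esub> x)) (im_ten (y \<otimes>\<^bsub>M\<^esub> z, ?E) ?X (\<rho> (y \<otimes>\<^bsub>M\<^esub> z)) ?k)
        (im_ten (?Y \<otimes>\<^bsub>?P\<^esub> ?Z) ?X (im_ten ?Y ?Z ?l ?m) ?k)"
      using im_sq_ten[OF 6 im_sq_id[OF I(1)]] by simp
    have 8: "im_sq (?g1 \<cdot>\<^bsub>?P\<^esub> MAssoc ?P ?X ?Y ?Z) (MAssoc M x y z) ?s (im_ten ?X (y \<otimes>\<^bsub>M\<^esub> z, ?E) ?k (\<rho> (y \<otimes>\<^bsub>M\<^esub> z)))"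
      using im_sq_comp[OF im_sq_assoc[OF I(1,3,4)] 5] by simp
    have 9: "im_sq (swap x (y \<otimes>\<^bsub>M\<^esub> z) \<cdot>\<^bsub>?P\<^esub> ?g1 \<cdot>\<^bsub>?P\<^esub> MAssoc ?P ?X ?Y ?Z) (braiding x (y \<otimes>\<^bsub>M\<^esub> z) \<cdot>\<^bsub>M\<^esub> MAssoc M x y z) ?s
        (im_ten (y \<otimes>\<^bsub>M\<^esub> z, ?E) ?X (\<rho> (y \<otimes>\<^bsub>M\<^esub> z)) ?k)"
      using im_sq_comp[OF 8 braiding_sq[of x "y \<otimes>\<^bsub>M\<^esub> z"]] by simp
    have 10: "im_sq (?g2 \<cdot>\<^bsub>?P\<^esub> swap x (y \<otimes>\<^bsub>M\<^esub> z) \<cdot>\<^bsub>?P\<^esub> ?g1 \<cdot>\<^bsub>?P\<^esub> MAssoc ?P ?X ?Y ?Z) (braiding x (y \<otimes>\<^bsub>M\<^esub> z) \<cdot>\<^bsub>M\<^esub> MAssoc M x y z) ?s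
        (im_ten (?Y \<otimes>\<^bsub>?P\<^esub> ?Z) ?X (im_ten ?Y ?Z ?l ?m) ?k)"
      using im_sq_comp[OF 9 7] by simp
    have 11: "im_sq (MAssoc ?P ?Y ?Z ?X \<cdot>\<^bsub>?P\<^esub> ?g2 \<cdot>\<^bsub>?P\<^esub> swap x (y \<otimes>\<^bsub>M\<^esub> z) \<cdot>\<^bsub>?P\<^esub> ?g1 \<cdot>\<^bsub>?P\<^esub> MAssoc ?P ?X ?Y ?Z)
        (MAssoc M y z x \<cdot>\<^bsub>M\<^esub> braiding x (y \<otimes>\<^bsub>M\<^esub> z) \<cdot>\<^bsub>M\<^esub> MAssoc M x y z) ?s ?t"
      using im_sq_comp[OF 10 im_sq_assoc[OF I(3,4,1)]] by simp
    \<comment> \<open>Both composites run between \<open>?s\<close> and \<open>?t\<close>, so it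
      remains to compare them in the product category, one coordinate by each of the two unit swap
      lemmas.\<close>
    have "MAssoc ?P ?Y ?Z ?X \<cdot>\<^bsub>?P\<^esub> ?g2 \<cdot>\<^bsub>?P\<^esub> swap x (y \<otimes>\<^bsub>M\<^esub> z) \<cdot>\<^bsub>?P\<^esub> ?g1 \<cdot>\<^bsub>?P\<^esub> MAssoc ?P ?X ?Y ?Z
        = ?f3 \<cdot>\<^bsub>?P\<^esub> ?f2 \<cdot>\<^bsub>?P\<^esub> ?f1"
      using N.unit_swap_assoc1[of y z] N.unit_swap_assoc2[of x] by simp
    with 4 11 show ?thesis
      by (intro im_sq_unique) auto
  qed
  show "minv M (MAssoc M z x y) \<cdot>\<^bsub>M\<^esub> braiding (x \<otimes>\<^bsub>M\<^esub> y) z \<cdot>\<^bsub>M\<^esub> minv M (MAssoc M x y z)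
    = (braiding x z \<otimes>\<^sub>m\<^bsub>M\<^esub> MId M y) \<cdot>\<^bsub>M\<^esub> minv M (MAssoc M x z y) \<cdot>\<^bsub>M\<^esub> (MId M x \<otimes>\<^sub>m\<^bsub>M\<^esub> braiding y z)"
  proof -
    let ?X = "(?E, x)" and ?Y = "(?E, y)" and ?Z = "(z, ?E)" and ?k = "lam x" and ?l = "lam y" and ?m = "\<rho> z"
    let ?j = "(MLUnit M ?E, MId M (x \<otimes>\<^bsub>M\<^esub> y))"
    let ?s = "im_ten ?X (?Y \<otimes>\<^bsub>?P\<^esub> ?Z) ?k (im_ten ?Y ?Z ?l ?m)"
    let ?t = "im_ten (?Z \<otimes>\<^bsub>?P\<^esub> ?X) ?Y (im_ten ?Z ?X ?m ?k) ?l"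
    let ?A = "\<lambda>x y z. minv ?P (MAssoc ?P x y z)"
    let ?f1 = "MId ?P ?X \<otimes>\<^sub>m\<^bsub>?P\<^esub> swap y z" and ?f2 = "?A ?X ?Z ?Y" and ?f3 = "swap x z \<otimes>\<^sub>m\<^bsub>?P\<^esub> MId ?P ?Y"
    have 1: "im_sq ?f1 (MId M x \<otimes>\<^sub>m\<^bsub>M\<^esub> braiding y z) ?s (im_ten ?X (?Z \<otimes>\<^bsub>?P\<^esub> ?Y) ?k (im_ten ?Z ?Y ?m ?l))"
      using im_sq_ten[OF im_sq_id[OF I(1)] braiding_sq[of y z]] by simp
    have 2: "im_sq (?f2 \<cdot>\<^bsub>?P\<^esub> ?f1) (minv M (MAssoc M x z y) \<cdot>\<^bsub>M\<^esub> (MId M x \<otimes>\<^sub>m\<^bsub>M\<^esub> braiding y z)) ?s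
        (im_ten (?X \<otimes>\<^bsub>?P\<^esub> ?Z) ?Y (im_ten ?X ?Z ?k ?m) ?l)"
      using im_sq_comp[OF 1 im_sq_minv[OF im_sq_assoc[OF I(1,4,2)]]] by simp
    have 3: "im_sq ?f3 (braiding x z \<otimes>\<^sub>m\<^bsub>M\<^esub> MId M y) (im_ten (?X \<otimes>\<^bsub>?P\<^esub> ?Z) ?Y (im_ten ?X ?Z ?k ?m) ?l) ?t"
      using im_sq_ten[OF braiding_sq[of x z] im_sq_id[OF I(2)]] by simp
    have 4: "im_sq (?f3 \<cdot>\<^bsub>?P\<^esub> ?f2 \<cdot>\<^bsub>?P\<^esub> ?f1) ((braiding x z \<otimes>\<^sub>m\<^bsub>M\<^esub> MId M y) \<cdot>\<^bsub>M\<^esub> minv M (MAssoc M x z y) \<cdot>\<^bsub>M\<^esub> (MId M x \<otimes>\<^sub>m\<^bsub>M\<^esub> braiding y z)) ?s ?t"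
      using im_sq_comp[OF 2 3] by simp
    let ?g1 = "?j \<otimes>\<^sub>m\<^bsub>?P\<^esub> MId ?P ?Z" and ?g2 = "MId ?P ?Z \<otimes>\<^sub>m\<^bsub>?P\<^esub> minv ?P ?j"
    have 5: "im_sq ?g1 (MId M ((x \<otimes>\<^bsub>M\<^esub> y) \<otimes>\<^bsub>M\<^esub> z)) (im_ten (?X \<otimes>\<^bsub>?P\<^esub> ?Y) ?Z (im_ten ?X ?Y ?k ?l) ?m)
        (im_ten (?E, x \<otimes>\<^bsub>M\<^esub> y) ?Z (lam (x \<otimes>\<^bsub>M\<^esub> y)) ?m)"
      using im_sq_ten[OF lam_ten_sq[of x y] im_sq_id[OF I(4)]] by simp
    have 6: "im_sq (minv ?P ?j) (MId M (x \<otimes>\<^bsub>M\<^esub> y)) (lam (x \<otimes>\<^bsub>M\<^esub> y)) (im_ten ?X ?Y ?k ?l)"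
      using im_sq_minv[OF lam_ten_sq[of x y]] by simp
    have 7: "im_sq ?g2 (MId M (z \<otimes>\<^bsub>M\<^esub> x \<otimes>\<^bsub>M\<^esub> y)) (im_ten ?Z (?E, x \<otimes>\<^bsub>M\<^esub> y) ?m (lam (x \<otimes>\<^bsub>M\<^esub> y)))
        (im_ten ?Z (?X \<otimes>\<^bsub>?P\<^esub> ?Y) ?m (im_ten ?X ?Y ?k ?l))"
      using im_sq_ten[OF im_sq_id[OF I(4)] 6] by simp
    have 8: "im_sq (?g1 \<cdot>\<^bsub>?P\<^esub> ?A ?X ?Y ?Z) (minv M (MAssoc M x y z)) ?s (im_ten (?E, x \<otimes>\<^bsub>M\<^esub> y) ?Z (lam (x \<otimes>\<^bsub>M\<^esub> y)) ?m)"
      using im_sq_comp[OF im_sq_minv[OF im_sq_assoc[OF I(1,2,4)]] 5] by simp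
    have 9: "im_sq (swap (x \<otimes>\<^bsub>M\<^esub> y) z \<cdot>\<^bsub>?P\<^esub> ?g1 \<cdot>\<^bsub>?P\<^esub> ?A ?X ?Y ?Z) (braiding (x \<otimes>\<^bsub>M\<^esub> y) z \<cdot>\<^bsub>M\<^esub> minv M (MAssoc M x y z)) ?s
        (im_ten ?Z (?E, x \<otimes>\<^bsub>M\<^esub> y) ?m (lam (x \<otimes>\<^bsub>M\<^esub> y)))"
      using im_sq_comp[OF 8 braiding_sq[of "x \<otimes>\<^bsub>M\<^esub> y" z]] by simp
    have 10: "im_sq (?g2 \<cdot>\<^bsub>?P\<^esub> swap (x \<otimes>\<^bsub>M\<^esub> y) z \<cdot>\<^bsub>?P\<^esub> ?g1 \<cdot>\<^bsub>?P\<^esub> ?A ?X ?Y ?Z) (braiding (x \<otimes>\<^bsub>M\<^esub> y) z \<cdot>\<^bsub>M\<^esub> minv M (MAssoc M x y z)) ?s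
        (im_ten ?Z (?X \<otimes>\<^bsub>?P\<^esub> ?Y) ?m (im_ten ?X ?Y ?k ?l))"
      using im_sq_comp[OF 9 7] by simp
    have 11: "im_sq (?A ?Z ?X ?Y \<cdot>\<^bsub>?P\<^esub> ?g2 \<cdot>\<^bsub>?P\<^esub> swap (x \<otimes>\<^bsub>M\<^esub> y) z \<cdot>\<^bsub>?P\<^esub> ?g1 \<cdot>\<^bsub>?P\<^esub> ?A ?X ?Y ?Z)
        (minv M (MAssoc M z x y) \<cdot>\<^bsub>M\<^esub> braiding (x \<otimes>\<^bsub>M\<^esub> y) z \<cdot>\<^bsub>M\<^esub> minv M (MAssoc M x y z)) ?s ?t"
      using im_sq_comp[OF 10 im_sq_minv[OF im_sq_assoc[OF I(4,1,2)]]] by simp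
    \<comment> \<open>Compared with the first hexagon the coordinates exchange roles and all arrows
      are reversed: \<open>x\<close> and \<open>y\<close> swap with \<open>E\<close> in the second
      coordinate, while \<open>z\<close> passes two copies of \<open>E\<close> in the first.\<close>
    have "?A ?Z ?X ?Y \<cdot>\<^bsub>?P\<^esub> ?g2 \<cdot>\<^bsub>?P\<^esub> swap (x \<otimes>\<^bsub>M\<^esub> y) z \<cdot>\<^bsub>?P\<^esub> ?g1 \<cdot>\<^bsub>?P\<^esub> ?A ?X ?Y ?Z
        = ?f3 \<cdot>\<^bsub>?P\<^esub> ?f2 \<cdot>\<^bsub>?P\<^esub> ?f1"
      using arg_cong[OF N.unit_swap_assoc1[of x y], of "minv M"] arg_cong[OF N.unit_swap_assoc2[of z], of "minv M"]
      by simp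
    with 4 11 show ?thesis
      by (intro im_sq_unique) auto
  qed
qed

end

section \<open>Transformations with a conjugating object\<close>

text \<open>Associativity of the monoid \<open>E\<close> with product \<open>MLUnit M E\<close>,
  needed for the constant coordinate of \<open>ins_l\<close> and \<open>ins_r\<close>.\<close>

lemma (in monoidal_category) unit_assoc:
  "MLUnit M (MUnit M) \<cdot> (MLUnit M (MUnit M) \<otimes>\<^sub>m MId M (MUnit M))
    = MLUnit M (MUnit M) \<cdot> (MId M (MUnit M) \<otimes>\<^sub>m MLUnit M (MUnit M)) \<cdot> MAssoc M (MUnit M) (MUnit M) (MUnit M)"
  by (simp add: triangle) (simp add: lunit_unit)

lemma monoidal_functor_ins:
  assumes "monoidal_category M" "monoidal_category (M \<times>\<^sub>m M)"
  shows "monoidal_functor M (M \<times>\<^sub>m M) (ins_l M)" "monoidal_functor M (M \<times>\<^sub>m M) (ins_r M)"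
proof -
  interpret M: monoidal_category M by fact
  interpret P: monoidal_category "M \<times>\<^sub>m M" by fact
  show "monoidal_functor M (M \<times>\<^sub>m M) (ins_l M)"
    by unfold_locales (auto simp: ins_l_def M.mhom_iff M.mhom_ob M.lunit_unit M.unit_assoc[unfolded M.lunit_unit])
  show "monoidal_functor M (M \<times>\<^sub>m M) (ins_r M)"
    by unfold_locales (auto simp: ins_r_def M.mhom_iff M.mhom_ob M.lunit_unit M.unit_assoc[unfolded M.lunit_unit])
qed

section \<open>Composition of monoidal functors\<close>

lemma monoidal_functor_comp:
  assumes "monoidal_functor M N F" "monoidal_functor N P G"
  shows "monoidal_functor M P (mf_comp P G F)"
proof -
  interpret F: monoidal_functor M N F by fact
  interpret G: monoidal_functor N P G by fact
  show ?thesis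
  proof
    fix a b c a' b' u v
    show "a \<in> MOb M \<Longrightarrow> MF0 (mf_comp P G F) a \<in> MOb P"
      "u \<in> mhom M a b \<Longrightarrow> MF1 (mf_comp P G F) u \<in> mhom P (MF0 (mf_comp P G F) a) (MF0 (mf_comp P G F) b)"
      "a \<in> MOb M \<Longrightarrow> MF1 (mf_comp P G F) (MId M a) = MId P (MF0 (mf_comp P G F) a)"
      "\<lbrakk>v \<in> mhom M b c; u \<in> mhom M a b\<rbrakk>
        \<Longrightarrow> MF1 (mf_comp P G F) (v \<cdot>\<^bsub>M\<^esub> u) = MF1 (mf_comp P G F) v \<cdot>\<^bsub>P\<^esub> MF1 (mf_comp P G F) u"
      "\<lbrakk>a \<in> MOb M; b \<in> MOb M\<rbrakk> \<Longrightarrow> MFTen (mf_comp P G F) a b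
        \<in> mhom P (MF0 (mf_comp P G F) a \<otimes>\<^bsub>P\<^esub> MF0 (mf_comp P G F) b) (MF0 (mf_comp P G F) (a \<otimes>\<^bsub>M\<^esub> b))
          \<and> miso P (MFTen (mf_comp P G F) a b)"
      "MFUnit (mf_comp P G F) \<in> mhom P (MUnit P) (MF0 (mf_comp P G F) (MUnit M)) \<and> miso P (MFUnit (mf_comp P G F))"
      by (auto simp: mf_comp_def F.M.mhom_iff G.N.mhom_iff F.f1_comp' G.f1_comp' F.f1_id G.f1_id)
    show "MFTen (mf_comp P G F) a' b' \<cdot>\<^bsub>P\<^esub> (MF1 (mf_comp P G F) u \<otimes>\<^sub>m\<^bsub>P\<^esub> MF1 (mf_comp P G F) v)
      = MF1 (mf_comp P G F) (u \<otimes>\<^sub>m\<^bsub>M\<^esub> v) \<cdot>\<^bsub>P\<^esub> MFTen (mf_comp P G F) a b"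
      if uv: "u \<in> mhom M a a'" "v \<in> mhom M b b'"
    proof -
      note [simp] = uv[unfolded F.M.mhom_iff] F.M.mhom_ob[OF uv(1)] F.M.mhom_ob[OF uv(2)]
      have "MF1 G (MFTen F a' b') \<cdot>\<^bsub>P\<^esub> MFTen G (MF0 F a') (MF0 F b') \<cdot>\<^bsub>P\<^esub> (MF1 G (MF1 F u) \<otimes>\<^sub>m\<^bsub>P\<^esub> MF1 G (MF1 F v))
          = (MF1 G (MFTen F a' b') \<cdot>\<^bsub>P\<^esub> MF1 G (MF1 F u \<otimes>\<^sub>m\<^bsub>N\<^esub> MF1 F v)) \<cdot>\<^bsub>P\<^esub> MFTen G (MF0 F a) (MF0 F b)"
        using G.ften_natural[of "MF1 F u" "MF1 F v"] by simp
      also have "MF1 G (MFTen F a' b') \<cdot>\<^bsub>P\<^esub> MF1 G (MF1 F u \<otimes>\<^sub>m\<^bsub>N\<^esub> MF1 F v)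
          = MF1 G (MF1 F (u \<otimes>\<^sub>m\<^bsub>M\<^esub> v)) \<cdot>\<^bsub>P\<^esub> MF1 G (MFTen F a b)"
        using F.ften_natural[of u v] by (simp add: G.f1_comp'[symmetric])
      finally show ?thesis
        by (simp add: mf_comp_def)
    qed
    show "MF1 (mf_comp P G F) (MAssoc M a b c) \<cdot>\<^bsub>P\<^esub> MFTen (mf_comp P G F) (a \<otimes>\<^bsub>M\<^esub> b) c
          \<cdot>\<^bsub>P\<^esub> (MFTen (mf_comp P G F) a b \<otimes>\<^sub>m\<^bsub>P\<^esub> MId P (MF0 (mf_comp P G F) c))
        = MFTen (mf_comp P G F) a (b \<otimes>\<^bsub>M\<^esub> c) \<cdot>\<^bsub>P\<^esub> (MId P (MF0 (mf_comp P G F) a) \<otimes>\<^sub>m\<^bsub>P\<^esub> MFTen (mf_comp P G F) b c)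
            \<cdot>\<^bsub>P\<^esub> MAssoc P (MF0 (mf_comp P G F) a) (MF0 (mf_comp P G F) b) (MF0 (mf_comp P G F) c)"
      if [simp]: "a \<in> MOb M" "b \<in> MOb M" "c \<in> MOb M"
    proof -
      let ?a = "MF0 F a" and ?b = "MF0 F b" and ?c = "MF0 F c"
      have 1: "MFTen G (MF0 F (a \<otimes>\<^bsub>M\<^esub> b)) ?c \<cdot>\<^bsub>P\<^esub> (MF1 G (MFTen F a b) \<otimes>\<^sub>m\<^bsub>P\<^esub> MId P (MF0 G ?c)) \<cdot>\<^bsub>P\<^esub> (MFTen G ?a ?b \<otimes>\<^sub>m\<^bsub>P\<^esub> MId P (MF0 G ?c))
          = MF1 G (MFTen F a b \<otimes>\<^sub>m\<^bsub>N\<^esub> MId N ?c) \<cdot>\<^bsub>P\<^esub> MFTen G (?a \<otimes>\<^bsub>N\<^esub> ?b) ?c \<cdot>\<^bsub>P\<^esub> (MFTen G ?a ?b \<otimes>\<^sub>m\<^bsub>P\<^esub> MId P (MF0 G ?c))"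
        using G.ften_natural[of "MFTen F a b" "MId N ?c"] by (intro G.N.comp_reassoc2) (simp_all add: G.f1_id)
      have 2: "MFTen G ?a (MF0 F (b \<otimes>\<^bsub>M\<^esub> c)) \<cdot>\<^bsub>P\<^esub> (MId P (MF0 G ?a) \<otimes>\<^sub>m\<^bsub>P\<^esub> MF1 G (MFTen F b c)) \<cdot>\<^bsub>P\<^esub> (MId P (MF0 G ?a) \<otimes>\<^sub>m\<^bsub>P\<^esub> MFTen G ?b ?c)
            \<cdot>\<^bsub>P\<^esub> MAssoc P (MF0 G ?a) (MF0 G ?b) (MF0 G ?c)
          = MF1 G (MId N ?a \<otimes>\<^sub>m\<^bsub>N\<^esub> MFTen F b c) \<cdot>\<^bsub>P\<^esub> MFTen G ?a (?b \<otimes>\<^bsub>N\<^esub> ?c) \<cdot>\<^bsub>P\<^esub> (MId P (MF0 G ?a) \<otimes>\<^sub>m\<^bsub>P\<^esub> MFTen G ?b ?c)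
            \<cdot>\<^bsub>P\<^esub> MAssoc P (MF0 G ?a) (MF0 G ?b) (MF0 G ?c)"
        using G.ften_natural[of "MId N ?a" "MFTen F b c"] by (intro G.N.comp_reassoc2) (simp_all add: G.f1_id)
      have "MF1 G (MF1 F (MAssoc M a b c)) \<cdot>\<^bsub>P\<^esub> MF1 G (MFTen F (a \<otimes>\<^bsub>M\<^esub> b) c) \<cdot>\<^bsub>P\<^esub> MFTen G (MF0 F (a \<otimes>\<^bsub>M\<^esub> b)) ?c
             \<cdot>\<^bsub>P\<^esub> (MF1 G (MFTen F a b) \<otimes>\<^sub>m\<^bsub>P\<^esub> MId P (MF0 G ?c)) \<cdot>\<^bsub>P\<^esub> (MFTen G ?a ?b \<otimes>\<^sub>m\<^bsub>P\<^esub> MId P (MF0 G ?c))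
          = MF1 G (MF1 F (MAssoc M a b c) \<cdot>\<^bsub>N\<^esub> MFTen F (a \<otimes>\<^bsub>M\<^esub> b) c \<cdot>\<^bsub>N\<^esub> (MFTen F a b \<otimes>\<^sub>m\<^bsub>N\<^esub> MId N ?c))
             \<cdot>\<^bsub>P\<^esub> MFTen G (?a \<otimes>\<^bsub>N\<^esub> ?b) ?c \<cdot>\<^bsub>P\<^esub> (MFTen G ?a ?b \<otimes>\<^sub>m\<^bsub>P\<^esub> MId P (MF0 G ?c))"
        unfolding 1 by (simp add: G.f1_comp')
      also have "\<dots> = MF1 G (MFTen F a (b \<otimes>\<^bsub>M\<^esub> c)) \<cdot>\<^bsub>P\<^esub> MF1 G (MId N ?a \<otimes>\<^sub>m\<^bsub>N\<^esub> MFTen F b c)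
            \<cdot>\<^bsub>P\<^esub> MF1 G (MAssoc N ?a ?b ?c) \<cdot>\<^bsub>P\<^esub> MFTen G (?a \<otimes>\<^bsub>N\<^esub> ?b) ?c \<cdot>\<^bsub>P\<^esub> (MFTen G ?a ?b \<otimes>\<^sub>m\<^bsub>P\<^esub> MId P (MF0 G ?c))"
        by (simp add: F.fassoc G.f1_comp')
      also have "\<dots> = MF1 G (MFTen F a (b \<otimes>\<^bsub>M\<^esub> c)) \<cdot>\<^bsub>P\<^esub> MFTen G ?a (MF0 F (b \<otimes>\<^bsub>M\<^esub> c))
            \<cdot>\<^bsub>P\<^esub> (MId P (MF0 G ?a) \<otimes>\<^sub>m\<^bsub>P\<^esub> MF1 G (MFTen F b c)) \<cdot>\<^bsub>P\<^esub> (MId P (MF0 G ?a) \<otimes>\<^sub>m\<^bsub>P\<^esub> MFTen G ?b ?c)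
            \<cdot>\<^bsub>P\<^esub> MAssoc P (MF0 G ?a) (MF0 G ?b) (MF0 G ?c)"
        unfolding 2 by (simp add: G.fassoc)
      finally show ?thesis
        by (simp add: mf_comp_def G.N.ten_id_comp)
    qed
    show "MF1 (mf_comp P G F) (MLUnit M a) \<cdot>\<^bsub>P\<^esub> MFTen (mf_comp P G F) (MUnit M) a
          \<cdot>\<^bsub>P\<^esub> (MFUnit (mf_comp P G F) \<otimes>\<^sub>m\<^bsub>P\<^esub> MId P (MF0 (mf_comp P G F) a))
        = MLUnit P (MF0 (mf_comp P G F) a)"
      if [simp]: "a \<in> MOb M"
    proof -
      let ?a = "MF0 F a" and ?E = "MF0 F (MUnit M)"
      have 1: "MFTen G ?E ?a \<cdot>\<^bsub>P\<^esub> (MF1 G (MFUnit F) \<otimes>\<^sub>m\<^bsub>P\<^esub> MId P (MF0 G ?a)) \<cdot>\<^bsub>P\<^esub> (MFUnit G \<otimes>\<^sub>m\<^bsub>P\<^esub> MId P (MF0 G ?a))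
          = MF1 G (MFUnit F \<otimes>\<^sub>m\<^bsub>N\<^esub> MId N ?a) \<cdot>\<^bsub>P\<^esub> MFTen G (MUnit N) ?a \<cdot>\<^bsub>P\<^esub> (MFUnit G \<otimes>\<^sub>m\<^bsub>P\<^esub> MId P (MF0 G ?a))"
        using G.ften_natural[of "MFUnit F" "MId N ?a"] by (intro G.N.comp_reassoc2) (simp_all add: G.f1_id)
      have "MF1 G (MF1 F (MLUnit M a)) \<cdot>\<^bsub>P\<^esub> MF1 G (MFTen F (MUnit M) a) \<cdot>\<^bsub>P\<^esub> MFTen G ?E ?a
            \<cdot>\<^bsub>P\<^esub> (MF1 G (MFUnit F) \<otimes>\<^sub>m\<^bsub>P\<^esub> MId P (MF0 G ?a)) \<cdot>\<^bsub>P\<^esub> (MFUnit G \<otimes>\<^sub>m\<^bsub>P\<^esub> MId P (MF0 G ?a))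
          = MF1 G (MF1 F (MLUnit M a) \<cdot>\<^bsub>N\<^esub> MFTen F (MUnit M) a \<cdot>\<^bsub>N\<^esub> (MFUnit F \<otimes>\<^sub>m\<^bsub>N\<^esub> MId N ?a))
            \<cdot>\<^bsub>P\<^esub> MFTen G (MUnit N) ?a \<cdot>\<^bsub>P\<^esub> (MFUnit G \<otimes>\<^sub>m\<^bsub>P\<^esub> MId P (MF0 G ?a))"
        unfolding 1 by (simp add: G.f1_comp')
      also have "\<dots> = MLUnit P (MF0 G ?a)"
        by (simp add: F.flunit G.flunit)
      finally show ?thesis
        by (simp add: mf_comp_def G.N.ten_id_comp)
    qed
    show "MF1 (mf_comp P G F) (MRUnit M a) \<cdot>\<^bsub>P\<^esub> MFTen (mf_comp P G F) a (MUnit M)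
          \<cdot>\<^bsub>P\<^esub> (MId P (MF0 (mf_comp P G F) a) \<otimes>\<^sub>m\<^bsub>P\<^esub> MFUnit (mf_comp P G F))
        = MRUnit P (MF0 (mf_comp P G F) a)"
      if [simp]: "a \<in> MOb M"
    proof -
      let ?a = "MF0 F a" and ?E = "MF0 F (MUnit M)"
      have 1: "MFTen G ?a ?E \<cdot>\<^bsub>P\<^esub> (MId P (MF0 G ?a) \<otimes>\<^sub>m\<^bsub>P\<^esub> MF1 G (MFUnit F)) \<cdot>\<^bsub>P\<^esub> (MId P (MF0 G ?a) \<otimes>\<^sub>m\<^bsub>P\<^esub> MFUnit G)
          = MF1 G (MId N ?a \<otimes>\<^sub>m\<^bsub>N\<^esub> MFUnit F) \<cdot>\<^bsub>P\<^esub> MFTen G ?a (MUnit N) \<cdot>\<^bsub>P\<^esub> (MId P (MF0 G ?a) \<otimes>\<^sub>m\<^bsub>P\<^esub> MFUnit G)"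
        using G.ften_natural[of "MId N ?a" "MFUnit F"] by (intro G.N.comp_reassoc2) (simp_all add: G.f1_id)
      have "MF1 G (MF1 F (MRUnit M a)) \<cdot>\<^bsub>P\<^esub> MF1 G (MFTen F a (MUnit M)) \<cdot>\<^bsub>P\<^esub> MFTen G ?a ?E
            \<cdot>\<^bsub>P\<^esub> (MId P (MF0 G ?a) \<otimes>\<^sub>m\<^bsub>P\<^esub> MF1 G (MFUnit F)) \<cdot>\<^bsub>P\<^esub> (MId P (MF0 G ?a) \<otimes>\<^sub>m\<^bsub>P\<^esub> MFUnit G)
          = MF1 G (MF1 F (MRUnit M a) \<cdot>\<^bsub>N\<^esub> MFTen F a (MUnit M) \<cdot>\<^bsub>N\<^esub> (MId N ?a \<otimes>\<^sub>m\<^bsub>N\<^esub> MFUnit F))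
            \<cdot>\<^bsub>P\<^esub> MFTen G ?a (MUnit N) \<cdot>\<^bsub>P\<^esub> (MId P (MF0 G ?a) \<otimes>\<^sub>m\<^bsub>P\<^esub> MFUnit G)"
        unfolding 1 by (simp add: G.f1_comp')
      also have "\<dots> = MRUnit P (MF0 G ?a)"
        by (simp add: F.frunit G.frunit)
      finally show ?thesis
        by (simp add: mf_comp_def G.N.ten_id_comp)
    qed
  qed
qed

text \<open>What a pseudonatural transformation between one-object bicategories amounts to: its
  object component is \<open>R\<close>, its constraint is \<open>t\<close>. The axioms for
  composites and identities are put in the form of squares so that uniqueness of lifts can be
  applied to them.\<close>

locale conj_transformation = F: monoidal_functor M N F + G: monoidal_functor M N G
  for M :: "('a, 'm) mcat" and N :: "('b, 'n) mcat"
    and F :: "('a, 'm, 'b, 'n) mfun" and G :: "('a, 'm, 'b, 'n) mfun" +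
  fixes R :: 'b and t :: "'a \<Rightarrow> 'n"
  assumes comp_iso: "a \<in> MOb M \<Longrightarrow> F.N.conj_iso R (MF0 F a) (MF0 G a) (t a)"
    and comp_sq: "u \<in> MMor M \<Longrightarrow> F.N.conj_sq R (MF1 F u) (MF1 G u) (t (MDom M u)) (t (MCod M u))"
    and ten_sq: "\<lbrakk>a \<in> MOb M; b \<in> MOb M\<rbrakk> \<Longrightarrow> F.N.conj_sq R (MFTen F a b) (MFTen G a b)
      (F.N.conj_ten R (MF0 F a) (MF0 G a) (MF0 F b) (MF0 G b) (t a) (t b)) (t (a \<otimes>\<^bsub>M\<^esub> b))"
    and unit_sq: "F.N.conj_sq R (MFUnit F) (MFUnit G) (F.N.conj_unit R) (t (MUnit M))"

lemma (in conjugate_functor) conj_transformation: "conj_transformation M N F G R t"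
  by unfold_locales (simp_all add: t t_nat G_ten G_unit)

lemma (in conj_transformation) conj_transformation_precomp:
  assumes "monoidal_functor P M H"
  shows "conj_transformation P N (mf_comp N F H) (mf_comp N G H) R (\<lambda>a. t (MF0 H a))"
proof -
  interpret H: monoidal_functor P M H by fact
  interpret FH: monoidal_functor P N "mf_comp N F H"
    by (rule monoidal_functor_comp) unfold_locales
  interpret GH: monoidal_functor P N "mf_comp N G H"
    by (rule monoidal_functor_comp) unfold_locales
  show ?thesis
  proof
    fix a b
    assume [simp]: "a \<in> MOb P" "b \<in> MOb P"
    show "F.N.conj_sq R (MFTen (mf_comp N F H) a b) (MFTen (mf_comp N G H) a b)
      (F.N.conj_ten R (MF0 (mf_comp N F H) a) (MF0 (mf_comp N G H) a) (MF0 (mf_comp N F H) b) (MF0 (mf_comp N G H) b)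
        (t (MF0 H a)) (t (MF0 H b))) (t (MF0 H (a \<otimes>\<^bsub>P\<^esub> b)))"
      using F.N.conj_sq_comp[OF ten_sq[of "MF0 H a" "MF0 H b"], of "MF1 F (MFTen H a b)" "MF1 G (MFTen H a b)"]
        comp_sq[of "MFTen H a b"]
      by (simp add: mf_comp_def)
  next
    show "F.N.conj_sq R (MFUnit (mf_comp N F H)) (MFUnit (mf_comp N G H)) (F.N.conj_unit R) (t (MF0 H (MUnit P)))"
      using F.N.conj_sq_comp[OF unit_sq, of "MF1 F (MFUnit H)" "MF1 G (MFUnit H)"] comp_sq[of "MFUnit H"]
      by (simp add: mf_comp_def)
  next
    fix u
    assume [simp]: "u \<in> MMor P"
    show "F.N.conj_sq R (MF1 (mf_comp N F H) u) (MF1 (mf_comp N G H) u) (t (MF0 H (MDom P u))) (t (MF0 H (MCod P u)))"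
      using comp_sq[of "MF1 H u"] by (simp add: mf_comp_def)
  qed (simp add: mf_comp_def comp_iso)
qed

text \<open>Since \<open>G\<close> and \<open>G'\<close> are conjugates of the same \<open>F\<close>
  by the same \<open>R\<close>, the identity of \<open>F a\<close> lifts to a comparison
  \<open>\<theta> a\<close>. Each axiom of a monoidal transformation then equates two lifts of one
  morphism.\<close>

lemma conj_transformation_unique:
  assumes "invertible_object N R L \<epsilon> \<kappa>"
    "conj_transformation M N F G R t" "conj_transformation M N F G' R t'"
  shows "\<exists>\<theta>. invertible_monoidal_transformation M N G G' \<theta>"
proof -
  interpret N: invertible_object N R L \<epsilon> \<kappa> by fact
  interpret t: conj_transformation M N F G R t by fact
  interpret t': conj_transformation M N F G' R t' by fact
  define \<theta> where "\<theta> a = N.conj_lift (MId N (MF0 F a)) (MF0 G a) (MF0 G' a) (t a) (t' a)" for a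
  have \<theta>: "\<theta> a \<in> mhom N (MF0 G a) (MF0 G' a)" "N.conj_sq R (MId N (MF0 F a)) (\<theta> a) (t a) (t' a)" "miso N (\<theta> a)"
    if "a \<in> MOb M" for a
    using N.conj_lift[of "MId N (MF0 F a)" "MF0 G a" "t a" "MF0 G' a" "t' a"] t.comp_iso[OF that] t'.comp_iso[OF that] that
    by (simp_all add: \<theta>_def)
  note [simp] = \<theta>(1)[unfolded N.mhom_iff]
  have "invertible_monoidal_transformation M N G G' \<theta>"
  proof
    fix a b u
    show "a \<in> MOb M \<Longrightarrow> \<theta> a \<in> mhom N (MF0 G a) (MF0 G' a) \<and> miso N (\<theta> a)"
      using \<theta> by simp
    show "\<theta> b \<cdot>\<^bsub>N\<^esub> MF1 G u = MF1 G' u \<cdot>\<^bsub>N\<^esub> \<theta> a" if u: "u \<in> mhom M a b"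
    proof (rule N.conj_sq_unique)
      note [simp] = u[unfolded t.F.M.mhom_iff] t.F.M.mhom_ob[OF u]
      show "N.conj_sq R (MF1 F u) (\<theta> b \<cdot>\<^bsub>N\<^esub> MF1 G u) (t a) (t' b)"
        using N.conj_sq_comp[OF _ \<theta>(2)[of b], of "MF1 F u" "MF1 G u" "t a"] t.comp_sq[of u] by simp
      show "N.conj_sq R (MF1 F u) (MF1 G' u \<cdot>\<^bsub>N\<^esub> \<theta> a) (t a) (t' b)"
        using N.conj_sq_comp[OF \<theta>(2)[of a], of "MF1 F u" "MF1 G' u" "t' b"] t'.comp_sq[of u] by simp
    qed (use u t.F.M.mhom_ob[OF u] in \<open>auto simp: t.F.M.mhom_iff\<close>)
    show "\<theta> (a \<otimes>\<^bsub>M\<^esub> b) \<cdot>\<^bsub>N\<^esub> MFTen G a b = MFTen G' a b \<cdot>\<^bsub>N\<^esub> (\<theta> a \<otimes>\<^sub>m\<^bsub>N\<^esub> \<theta> b)"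
      if [simp]: "a \<in> MOb M" "b \<in> MOb M"
    proof (rule N.conj_sq_unique)
      let ?s = "N.conj_ten R (MF0 F a) (MF0 G a) (MF0 F b) (MF0 G b) (t a) (t b)"
      show "N.conj_sq R (MFTen F a b) (\<theta> (a \<otimes>\<^bsub>M\<^esub> b) \<cdot>\<^bsub>N\<^esub> MFTen G a b) ?s (t' (a \<otimes>\<^bsub>M\<^esub> b))"
        using N.conj_sq_comp[OF t.ten_sq \<theta>(2)[of "a \<otimes>\<^bsub>M\<^esub> b"]] by simp
      show "N.conj_sq R (MFTen F a b) (MFTen G' a b \<cdot>\<^bsub>N\<^esub> (\<theta> a \<otimes>\<^sub>m\<^bsub>N\<^esub> \<theta> b)) ?s (t' (a \<otimes>\<^bsub>M\<^esub> b))"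
        using N.conj_sq_comp[OF N.conj_sq_ten[OF \<theta>(2)[of a] \<theta>(2)[of b]], of "MFTen F a b" "MFTen G' a b"]
          t'.ten_sq[of a b] by simp
    qed auto
    show "\<theta> (MUnit M) \<cdot>\<^bsub>N\<^esub> MFUnit G = MFUnit G'"
    proof (rule N.conj_sq_unique[OF _ t'.unit_sq])
      show "N.conj_sq R (MFUnit F) (\<theta> (MUnit M) \<cdot>\<^bsub>N\<^esub> MFUnit G) (N.conj_unit R) (t' (MUnit M))"
        using N.conj_sq_comp[OF t.unit_sq \<theta>(2)] by simp
    qed auto
  qed
  then show ?thesis by blast
qed

section \<open>Replacing the source functor along an isomorphism\<close>

context monoidal_category
begin

lemma conj_sq_cancel:
  assumes "conj_sq R (g \<cdot> f) (g' \<cdot> f') s u" "conj_sq R g g' t u" "miso M g'"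
    "f \<in> MMor M" "f' \<in> MMor M" "MDom M g = MCod M f" "MDom M g' = MCod M f'"
  shows "conj_sq R f f' s t"
proof -
  note 1 = assms[unfolded conj_sq_def]
  have [simp]: "f \<in> MMor M" "f' \<in> MMor M" "g \<in> MMor M" "g' \<in> MMor M" "miso M g'" "MDom M g = MCod M f" "MDom M g' = MCod M f'"
    using 1 by auto
  have I: "conj_iso R (MDom M f) (MDom M f') s" "conj_iso R (MCod M f) (MCod M f') t" "conj_iso R (MCod M g) (MCod M g') u"
    using 1 by auto
  note [simp] = I[THEN conj_iso_simps(1)] I[THEN conj_iso_simps(4)] I[THEN conj_iso_simps(6)] I[THEN conj_iso_simps(7)]
  have "(g' \<otimes>\<^sub>m MId M R) \<cdot> (f' \<otimes>\<^sub>m MId M R) \<cdot> s = u \<cdot> (MId M R \<otimes>\<^sub>m g) \<cdot> (MId M R \<otimes>\<^sub>m f)"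
    using 1 by (simp add: ten_id_comp)
  also have "\<dots> = (g' \<otimes>\<^sub>m MId M R) \<cdot> t \<cdot> (MId M R \<otimes>\<^sub>m f)"
    using 1 by (intro comp_reassoc2) auto
  finally have "(f' \<otimes>\<^sub>m MId M R) \<cdot> s = t \<cdot> (MId M R \<otimes>\<^sub>m f)"
    by (rule miso_cancel_left[rotated]) simp_all
  then show ?thesis
    using I by (simp add: conj_sq_def)
qed

end

text \<open>Serves to pass from the unit monoid of the tricategory to the monoidal unit. The squares
  \<open>S\<close> pair \<open>h\<close> with an identity, so each square for \<open>F'\<close> is
  obtained from the one for \<open>F\<close> by cancelling such a square.\<close>

lemma (in conj_transformation) conj_transformation_iso:
  assumes "invertible_monoidal_transformation M N F' F h"
  shows "conj_transformation M N F' G R (\<lambda>a. t a \<cdot>\<^bsub>N\<^esub> (MId N R \<otimes>\<^sub>m\<^bsub>N\<^esub> h a))"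
proof -
  interpret h: invertible_monoidal_transformation M N F' F h by fact
  have h [simp]: "h a \<in> MMor N" "MDom N (h a) = MF0 F' a" "MCod N (h a) = MF0 F a" "miso N (h a)"
    if "a \<in> MOb M" for a
    using h.component[OF that] by (auto simp: F.N.mhom_iff)
  note [simp] = F.N.conj_iso_simps[OF comp_iso]
  have R [simp]: "R \<in> MOb N"
    using comp_iso[of "MUnit M"] by (simp add: F.N.conj_iso_def)
  let ?t = "\<lambda>a. t a \<cdot>\<^bsub>N\<^esub> (MId N R \<otimes>\<^sub>m\<^bsub>N\<^esub> h a)"
  have I: "F.N.conj_iso R (MF0 F' a) (MF0 G a) (?t a)" if "a \<in> MOb M" for a
    using that by (simp add: F.N.conj_iso_def)
  have S: "F.N.conj_sq R (h a) (MId N (MF0 G a)) (?t a) (t a)" if "a \<in> MOb M" for a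
    using that I[OF that] comp_iso[OF that] by (simp add: F.N.conj_sq_def)
  show ?thesis
  proof
    fix u
    assume [simp]: "u \<in> MMor M"
    have "h (MCod M u) \<cdot>\<^bsub>N\<^esub> MF1 F' u = MF1 F u \<cdot>\<^bsub>N\<^esub> h (MDom M u)"
      by (rule h.natural) (simp add: F.M.mhom_iff)
    then have "F.N.conj_sq R (h (MCod M u) \<cdot>\<^bsub>N\<^esub> MF1 F' u) (MId N (MF0 G (MCod M u)) \<cdot>\<^bsub>N\<^esub> MF1 G u) (?t (MDom M u)) (t (MCod M u))"
      using F.N.conj_sq_comp[OF S[of "MDom M u"] comp_sq[of u]] by simp
    then show "F.N.conj_sq R (MF1 F' u) (MF1 G u) (?t (MDom M u)) (?t (MCod M u))"
      by (rule F.N.conj_sq_cancel[OF _ S[of "MCod M u"]]) simp_all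
  next
    fix a b
    assume [simp]: "a \<in> MOb M" "b \<in> MOb M"
    let ?s = "F.N.conj_ten R (MF0 F' a) (MF0 G a) (MF0 F' b) (MF0 G b) (?t a) (?t b)"
    have "F.N.conj_sq R (h (a \<otimes>\<^bsub>M\<^esub> b) \<cdot>\<^bsub>N\<^esub> MFTen F' a b) (MId N (MF0 G (a \<otimes>\<^bsub>M\<^esub> b)) \<cdot>\<^bsub>N\<^esub> MFTen G a b) ?s (t (a \<otimes>\<^bsub>M\<^esub> b))"
      using F.N.conj_sq_comp[OF F.N.conj_sq_ten[OF S[of a] S[of b]], of "MFTen F a b" "MFTen G a b"]
        ten_sq[of a b] h.tensor[of a b] by simp
    then show "F.N.conj_sq R (MFTen F' a b) (MFTen G a b) ?s (?t (a \<otimes>\<^bsub>M\<^esub> b))"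
      by (rule F.N.conj_sq_cancel[OF _ S[of "a \<otimes>\<^bsub>M\<^esub> b"]]) simp_all
  next
    have "F.N.conj_sq R (h (MUnit M) \<cdot>\<^bsub>N\<^esub> MFUnit F') (MId N (MF0 G (MUnit M)) \<cdot>\<^bsub>N\<^esub> MFUnit G) (F.N.conj_unit R) (t (MUnit M))"
      using unit_sq h.unit by simp
    then show "F.N.conj_sq R (MFUnit F') (MFUnit G) (F.N.conj_unit R) (?t (MUnit M))"
      by (rule F.N.conj_sq_cancel[OF _ S[of "MUnit M"]]) simp_all
  qed (rule I)
qed

section \<open>Replacing the conjugating object along an isomorphism\<close>

context monoidal_category
begin

definition conj_change :: "'m \<Rightarrow> 'a \<Rightarrow> 'a \<Rightarrow> 'm \<Rightarrow> 'm" where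
  "conj_change \<sigma> a a' s = (MId M a' \<otimes>\<^sub>m \<sigma>) \<cdot> s \<cdot> (minv M \<sigma> \<otimes>\<^sub>m MId M a)"

lemma conj_iso_change:
  assumes "conj_iso L a a' s" "miso M \<sigma>" "MDom M \<sigma> = L" "MCod M \<sigma> = R"
  shows "conj_iso R a a' (conj_change \<sigma> a a' s)"
  using conj_iso_simps[OF assms(1)] assms(2-) miso_mor[OF assms(2)] cod_ob[of \<sigma>]
  by (simp add: conj_iso_def conj_change_def)

lemma conj_sq_change:
  assumes "conj_sq L f f' s t" "miso M \<sigma>" "MDom M \<sigma> = L" "MCod M \<sigma> = R"
  shows "conj_sq R f f' (conj_change \<sigma> (MDom M f) (MDom M f') s) (conj_change \<sigma> (MCod M f) (MCod M f') t)"
proof -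
  note 1 = assms(1)[unfolded conj_sq_def]
  have I: "conj_iso L (MDom M f) (MDom M f') s" "conj_iso L (MCod M f) (MCod M f') t"
    using 1 by auto
  note [simp] = assms(2-) miso_mor[OF assms(2)] I[THEN conj_iso_simps(4)] I[THEN conj_iso_simps(6)] I[THEN conj_iso_simps(7)]
  have [simp]: "f \<in> MMor M" "f' \<in> MMor M" "L \<in> MOb M" "R \<in> MOb M"
    using 1 conj_iso_simps(1)[OF I(1)] cod_ob[of \<sigma>] by auto
  have "(f' \<otimes>\<^sub>m MId M R) \<cdot> conj_change \<sigma> (MDom M f) (MDom M f') s
      = (MId M (MCod M f') \<otimes>\<^sub>m \<sigma>) \<cdot> (f' \<otimes>\<^sub>m MId M L) \<cdot> s \<cdot> (minv M \<sigma> \<otimes>\<^sub>m MId M (MDom M f))"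
    unfolding conj_change_def by (rule comp_reassoc2) (auto simp: ten_comp)
  also have "\<dots> = (MId M (MCod M f') \<otimes>\<^sub>m \<sigma>) \<cdot> (t \<cdot> (MId M L \<otimes>\<^sub>m f)) \<cdot> (minv M \<sigma> \<otimes>\<^sub>m MId M (MDom M f))"
    using 1 by (simp flip: comp_assoc')
  also have "\<dots> = conj_change \<sigma> (MCod M f) (MCod M f') t \<cdot> (MId M R \<otimes>\<^sub>m f)"
    by (simp add: conj_change_def ten_comp)
  finally show ?thesis
    using 1 conj_iso_change[OF I(1)] conj_iso_change[OF I(2)] by (simp add: conj_sq_def)
qed

lemma conj_unit_change:
  assumes [simp]: "miso M \<sigma>" "MDom M \<sigma> = L" "MCod M \<sigma> = R"
  shows "conj_change \<sigma> (MUnit M) (MUnit M) (conj_unit L) = conj_unit R"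
proof -
  note [simp] = miso_mor[OF assms(1)]
  have [simp]: "L \<in> MOb M" "R \<in> MOb M"
    using dom_ob[of \<sigma>] cod_ob[of \<sigma>] by auto
  have "(MId M (MUnit M) \<otimes>\<^sub>m \<sigma>) \<cdot> minv M (MLUnit M L) = minv M (MLUnit M R) \<cdot> \<sigma>"
    using lunit_natural[of \<sigma>] by (intro minv_shift[symmetric]) simp_all
  moreover have "MRUnit M L \<cdot> (minv M \<sigma> \<otimes>\<^sub>m MId M (MUnit M)) = minv M \<sigma> \<cdot> MRUnit M R"
    using runit_natural[of "minv M \<sigma>"] by simp
  moreover have "conj_change \<sigma> (MUnit M) (MUnit M) (conj_unit L)
      = ((MId M (MUnit M) \<otimes>\<^sub>m \<sigma>) \<cdot> minv M (MLUnit M L)) \<cdot> (MRUnit M L \<cdot> (minv M \<sigma> \<otimes>\<^sub>m MId M (MUnit M)))"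
    by (simp add: conj_change_def conj_unit_def)
  ultimately show ?thesis
    by (simp add: conj_unit_def)
qed

text \<open>In the tensor product of the transported isomorphisms, the copy of
  \<open>\<sigma>\<close> from the first meets the inverse from the second around the middle
  associator and cancels against it, which is equation \<open>3\<close>; only the outer copies
  remain.\<close>

lemma conj_ten_change:
  assumes "conj_iso L a a' s" "conj_iso L b b' t" "miso M \<sigma>" "MDom M \<sigma> = L" "MCod M \<sigma> = R"
  shows "conj_ten R a a' b b' (conj_change \<sigma> a a' s) (conj_change \<sigma> b b' t)
    = conj_change \<sigma> (a \<otimes> b) (a' \<otimes> b') (conj_ten L a a' b b' s t)"
proof -
  note [simp] = assms(3-) miso_mor[OF assms(3)] conj_iso_simps[OF assms(1)] conj_iso_simps[OF assms(2)]
  have [simp]: "R \<in> MOb M"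
    using cod_ob[of \<sigma>] by auto
  let ?i = "MId M" and ?A = "MAssoc M"
  have 1: "minv M (?A a' b' R) \<cdot> (?i a' \<otimes>\<^sub>m (?i b' \<otimes>\<^sub>m \<sigma>)) = (?i (a' \<otimes> b') \<otimes>\<^sub>m \<sigma>) \<cdot> minv M (?A a' b' L)"
    using assoc_inv_natural[of "?i a'" "?i b'" \<sigma>] by simp
  have 2: "(minv M \<sigma> \<otimes>\<^sub>m ?i a) \<otimes>\<^sub>m ?i b = minv M (?A L a b) \<cdot> (minv M \<sigma> \<otimes>\<^sub>m ?i (a \<otimes> b)) \<cdot> ?A R a b"
    using arg_cong[OF assoc_natural[of "minv M \<sigma>" "?i a" "?i b"], of "\<lambda>u. minv M (?A L a b) \<cdot> u"] by simp
  have 3: "(?i a' \<otimes>\<^sub>m (minv M \<sigma> \<otimes>\<^sub>m ?i b)) \<cdot> ?A a' R b \<cdot> ((?i a' \<otimes>\<^sub>m \<sigma>) \<otimes>\<^sub>m ?i b) = ?A a' L b"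
    using assoc_natural[of "?i a'" \<sigma> "?i b"] by (simp add: ten_comp comp_reassoc[OF ten_comp])
  have "conj_ten R a a' b b' (conj_change \<sigma> a a' s) (conj_change \<sigma> b b' t)
      = minv M (?A a' b' R) \<cdot> (?i a' \<otimes>\<^sub>m (?i b' \<otimes>\<^sub>m \<sigma>)) \<cdot> (?i a' \<otimes>\<^sub>m t)
        \<cdot> ((?i a' \<otimes>\<^sub>m (minv M \<sigma> \<otimes>\<^sub>m ?i b)) \<cdot> ?A a' R b \<cdot> ((?i a' \<otimes>\<^sub>m \<sigma>) \<otimes>\<^sub>m ?i b)) \<cdot> (s \<otimes>\<^sub>m ?i b)
        \<cdot> ((minv M \<sigma> \<otimes>\<^sub>m ?i a) \<otimes>\<^sub>m ?i b) \<cdot> minv M (?A R a b)"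
    by (simp add: conj_ten_def conj_change_def ten_id_comp)
  also have "\<dots> = (minv M (?A a' b' R) \<cdot> (?i a' \<otimes>\<^sub>m (?i b' \<otimes>\<^sub>m \<sigma>))) \<cdot> (?i a' \<otimes>\<^sub>m t) \<cdot> ?A a' L b \<cdot> (s \<otimes>\<^sub>m ?i b)
        \<cdot> minv M (?A L a b) \<cdot> (minv M \<sigma> \<otimes>\<^sub>m ?i (a \<otimes> b))"
    unfolding 3 unfolding 2 by simp
  also have "\<dots> = conj_change \<sigma> (a \<otimes> b) (a' \<otimes> b') (conj_ten L a a' b b' s t)"
    unfolding 1 by (simp add: conj_change_def conj_ten_def)
  finally show ?thesis .
qed

end

lemma (in conj_transformation) conj_transformation_change:
  assumes "miso N \<sigma>" "MDom N \<sigma> = R" "MCod N \<sigma> = R'"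
  shows "conj_transformation M N F G R' (\<lambda>a. F.N.conj_change \<sigma> (MF0 F a) (MF0 G a) (t a))"
proof
  fix a b u
  show "a \<in> MOb M \<Longrightarrow> F.N.conj_iso R' (MF0 F a) (MF0 G a) (F.N.conj_change \<sigma> (MF0 F a) (MF0 G a) (t a))"
    using F.N.conj_iso_change[OF comp_iso assms] by simp
  show "F.N.conj_sq R' (MF1 F u) (MF1 G u) (F.N.conj_change \<sigma> (MF0 F (MDom M u)) (MF0 G (MDom M u)) (t (MDom M u)))
      (F.N.conj_change \<sigma> (MF0 F (MCod M u)) (MF0 G (MCod M u)) (t (MCod M u)))" if "u \<in> MMor M"
    using F.N.conj_sq_change[OF comp_sq[OF that] assms] that by simp
  show "F.N.conj_sq R' (MFTen F a b) (MFTen G a b)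
      (F.N.conj_ten R' (MF0 F a) (MF0 G a) (MF0 F b) (MF0 G b)
        (F.N.conj_change \<sigma> (MF0 F a) (MF0 G a) (t a)) (F.N.conj_change \<sigma> (MF0 F b) (MF0 G b) (t b)))
      (F.N.conj_change \<sigma> (MF0 F (a \<otimes>\<^bsub>M\<^esub> b)) (MF0 G (a \<otimes>\<^bsub>M\<^esub> b)) (t (a \<otimes>\<^bsub>M\<^esub> b)))"
    if "a \<in> MOb M" "b \<in> MOb M"
    using F.N.conj_sq_change[OF ten_sq[OF that] assms] that
    by (simp add: F.N.conj_ten_change[OF comp_iso comp_iso assms])
  show "F.N.conj_sq R' (MFUnit F) (MFUnit G) (F.N.conj_unit R')
      (F.N.conj_change \<sigma> (MF0 F (MUnit M)) (MF0 G (MUnit M)) (t (MUnit M)))"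
    using F.N.conj_sq_change[OF unit_sq assms] by (simp add: F.N.conj_unit_change[OF assms])
qed

section \<open>The canonical conjugate by an invertible object\<close>

context invertible_object
begin

text \<open>The path from \<open>R a\<close> through \<open>R (a E)\<close>,
  \<open>R (a (L R))\<close> and \<open>R ((a L) R)\<close> to \<open>(R (a L)) R\<close>. It
  exhibits the prescribed object \<open>R \<otimes> (a \<otimes> L)\<close> as a conjugate of
  \<open>a\<close>.\<close>

definition unconj :: "'a \<Rightarrow> 'm" where
  "unconj a = minv M (MAssoc M R (a \<otimes> L) R)
    \<cdot> (MId M R \<otimes>\<^sub>m (minv M (MAssoc M a L R) \<cdot> (MId M a \<otimes>\<^sub>m minv M \<kappa>) \<cdot> minv M (MRUnit M a)))"

lemma conj_iso_unconj:
  assumes "a \<in> MOb M"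
  shows "conj_iso R a (R \<otimes> (a \<otimes> L)) (unconj a)"
  using assms \<kappa>_hom by (simp add: conj_iso_def unconj_def mhom_iff)

lemma conj_sq_unconj:
  assumes [simp]: "u \<in> MMor M"
  shows "conj_sq R u (MId M R \<otimes>\<^sub>m (u \<otimes>\<^sub>m MId M L)) (unconj (MDom M u)) (unconj (MCod M u))"
proof -
  note [simp] = \<kappa>_hom[unfolded mhom_iff]
  let ?i = "MId M" and ?A = "MAssoc M" and ?a = "MDom M u" and ?b = "MCod M u"
  have "((u \<otimes>\<^sub>m ?i L) \<otimes>\<^sub>m ?i R) \<cdot> minv M (?A ?a L R) \<cdot> (?i ?a \<otimes>\<^sub>m minv M \<kappa>) \<cdot> minv M (MRUnit M ?a)
      = minv M (?A ?b L R) \<cdot> (u \<otimes>\<^sub>m ?i (L \<otimes> R)) \<cdot> (?i ?a \<otimes>\<^sub>m minv M \<kappa>) \<cdot> minv M (MRUnit M ?a)"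
    using assoc_inv_natural[of u "?i L" "?i R"] by (intro comp_reassoc2) simp_all
  also have "(u \<otimes>\<^sub>m ?i (L \<otimes> R)) \<cdot> (?i ?a \<otimes>\<^sub>m minv M \<kappa>) \<cdot> minv M (MRUnit M ?a)
      = (?i ?b \<otimes>\<^sub>m minv M \<kappa>) \<cdot> (u \<otimes>\<^sub>m ?i (MUnit M)) \<cdot> minv M (MRUnit M ?a)"
    by (rule comp_reassoc2) (simp_all add: ten_comp)
  also have "(u \<otimes>\<^sub>m ?i (MUnit M)) \<cdot> minv M (MRUnit M ?a) = minv M (MRUnit M ?b) \<cdot> u"
    using runit_natural[of u] by (intro minv_shift[symmetric]) simp_all
  finally have 1: "((u \<otimes>\<^sub>m ?i L) \<otimes>\<^sub>m ?i R) \<cdot> minv M (?A ?a L R) \<cdot> (?i ?a \<otimes>\<^sub>m minv M \<kappa>) \<cdot> minv M (MRUnit M ?a)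
      = minv M (?A ?b L R) \<cdot> (?i ?b \<otimes>\<^sub>m minv M \<kappa>) \<cdot> minv M (MRUnit M ?b) \<cdot> u" .
  have "((?i R \<otimes>\<^sub>m (u \<otimes>\<^sub>m ?i L)) \<otimes>\<^sub>m ?i R) \<cdot> unconj ?a
      = minv M (?A R (?b \<otimes> L) R) \<cdot> (?i R \<otimes>\<^sub>m ((u \<otimes>\<^sub>m ?i L) \<otimes>\<^sub>m ?i R))
        \<cdot> (?i R \<otimes>\<^sub>m (minv M (?A ?a L R) \<cdot> (?i ?a \<otimes>\<^sub>m minv M \<kappa>) \<cdot> minv M (MRUnit M ?a)))"
    unfolding unconj_def using assoc_inv_natural[of "?i R" "u \<otimes>\<^sub>m ?i L" "?i R"]
    by (intro comp_reassoc2) simp_all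
  also have "\<dots> = unconj ?b \<cdot> (?i R \<otimes>\<^sub>m u)"
    unfolding unconj_def by (simp add: ten_comp 1)
  finally show ?thesis
    using conj_iso_unconj[of ?a] conj_iso_unconj[of ?b] by (simp add: conj_sq_def)
qed

lemma conjugate_functor:
  assumes "monoidal_functor P M F"
  shows "conjugate_functor P M F R L \<epsilon> \<kappa> (\<lambda>a. R \<otimes> (MF0 F a \<otimes> L))
    (\<lambda>u. MId M R \<otimes>\<^sub>m (MF1 F u \<otimes>\<^sub>m MId M L)) (\<lambda>a. unconj (MF0 F a))"
proof -
  interpret F: monoidal_functor P M F by fact
  show ?thesis
  proof
    fix u
    assume "u \<in> MMor P"
    then show "conj_sq R (MF1 F u) (MId M R \<otimes>\<^sub>m (MF1 F u \<otimes>\<^sub>m MId M L)) (unconj (MF0 F (MDom P u))) (unconj (MF0 F (MCod P u)))"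
      using conj_sq_unconj[of "MF1 F u"] by simp
  qed (simp_all add: mhom_iff conj_iso_unconj)
qed

end

lemma multiplication_exists:
  assumes "invertible_object M R L \<epsilon> \<kappa>" "monoidal_functor (M \<times>\<^sub>m M) M F"
    "conj_transformation M M (mf_comp M F (ins_l M)) (mf_id M) R s"
    "conj_transformation M M (mf_comp M F (ins_r M)) (mf_id M) R t"
  shows "\<exists>\<phi> \<rho> lam. multiplication M \<phi> \<rho> lam \<and> MF0 \<phi> = (\<lambda>a. R \<otimes>\<^bsub>M\<^esub> (MF0 F a \<otimes>\<^bsub>M\<^esub> L)) \<and>
    MF1 \<phi> = (\<lambda>u. MId M R \<otimes>\<^sub>m\<^bsub>M\<^esub> (MF1 F u \<otimes>\<^sub>m\<^bsub>M\<^esub> MId M L))"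
proof -
  interpret M: invertible_object M R L \<epsilon> \<kappa> by fact
  interpret F: monoidal_functor "M \<times>\<^sub>m M" M F by fact
  interpret C: conjugate_functor "M \<times>\<^sub>m M" M F R L \<epsilon> \<kappa> "\<lambda>a. R \<otimes>\<^bsub>M\<^esub> (MF0 F a \<otimes>\<^bsub>M\<^esub> L)"
    "\<lambda>u. MId M R \<otimes>\<^sub>m\<^bsub>M\<^esub> (MF1 F u \<otimes>\<^sub>m\<^bsub>M\<^esub> MId M L)" "\<lambda>a. M.unconj (MF0 F a)"
    by (rule M.conjugate_functor) fact
  interpret CT: conj_transformation "M \<times>\<^sub>m M" M F C.G R "\<lambda>a. M.unconj (MF0 F a)"
    by (rule C.conj_transformation)
  note ins = monoidal_functor_ins[OF M.monoidal_category_axioms F.M.monoidal_category_axioms]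
  \<comment> \<open>\<phi>(-,E) and the identity functor are both conjugates by \<open>R\<close> of
    \<open>F\<close> restricted to \<open>(-, E)\<close>; the next step is the same in the other
    variable.\<close>
  obtain \<rho> where \<rho>: "invertible_monoidal_transformation M M (mf_comp M C.G (ins_l M)) (mf_id M) \<rho>"
    using conj_transformation_unique[OF assms(1) CT.conj_transformation_precomp[OF ins(1)] assms(3)] by blast
  obtain lam where lam: "invertible_monoidal_transformation M M (mf_comp M C.G (ins_r M)) (mf_id M) lam"
    using conj_transformation_unique[OF assms(1) CT.conj_transformation_precomp[OF ins(2)] assms(4)] by blast
  have "multiplication M C.G \<rho> lam"
    by (intro multiplication.intro C.G.monoidal_functor_axioms \<rho> lam)
  then show ?thesis
    using C.G_simps by blast
qed

section \<open>Isomorphism classes of objects\<close>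

context monoidal_category
begin

text \<open>Bare existence is recorded because any isomorphism of \<open>L\<close> with
  \<open>R\<close> serves the construction; computing with isomorphism classes avoids all coherence
  conditions.\<close>

definition isomorphic :: "'a \<Rightarrow> 'a \<Rightarrow> bool" (infix "\<simeq>" 50) where
  "a \<simeq> b \<longleftrightarrow> (\<exists>u \<in> mhom M a b. miso M u)"

lemma isomorphicI: "\<lbrakk>u \<in> mhom M a b; miso M u\<rbrakk> \<Longrightarrow> a \<simeq> b"
  by (auto simp: isomorphic_def)

lemma isomorphic_refl: "a \<in> MOb M \<Longrightarrow> a \<simeq> a"
  by (rule isomorphicI[of "MId M a"]) (simp_all add: mhom_iff)

lemma isomorphic_sym: "a \<simeq> b \<Longrightarrow> b \<simeq> a"
  unfolding isomorphic_def by (metis mhom_iff minv_simps(1-3) miso_minv)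

lemma isomorphic_trans [trans]: "\<lbrakk>a \<simeq> b; b \<simeq> c\<rbrakk> \<Longrightarrow> a \<simeq> c"
  unfolding isomorphic_def by (metis mhom_iff comp_simps miso_comp(1))

lemma isomorphic_ten: "\<lbrakk>a \<simeq> b; c \<simeq> d\<rbrakk> \<Longrightarrow> a \<otimes> c \<simeq> b \<otimes> d"
  unfolding isomorphic_def by (metis mhom_iff ten_simps miso_ten(1))

lemma isomorphic_ten_left: "\<lbrakk>c \<simeq> d; a \<in> MOb M\<rbrakk> \<Longrightarrow> a \<otimes> c \<simeq> a \<otimes> d"
  and isomorphic_ten_right: "\<lbrakk>c \<simeq> d; a \<in> MOb M\<rbrakk> \<Longrightarrow> c \<otimes> a \<simeq> d \<otimes> a"
  by (auto intro: isomorphic_ten isomorphic_refl)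

lemma isomorphic_assoc: "\<lbrakk>a \<in> MOb M; b \<in> MOb M; c \<in> MOb M\<rbrakk> \<Longrightarrow> (a \<otimes> b) \<otimes> c \<simeq> a \<otimes> (b \<otimes> c)"
  by (rule isomorphicI[of "MAssoc M a b c"]) (simp_all add: mhom_iff)

lemma isomorphic_lunit: "a \<in> MOb M \<Longrightarrow> MUnit M \<otimes> a \<simeq> a"
  and isomorphic_runit: "a \<in> MOb M \<Longrightarrow> a \<otimes> MUnit M \<simeq> a"
  by (rule isomorphicI[of "MLUnit M a"], simp_all add: mhom_iff)
    (rule isomorphicI[of "MRUnit M a"], simp_all add: mhom_iff)

lemma conj_iso_isomorphic: "conj_iso R a a' s \<Longrightarrow> R \<otimes> a \<simeq> a' \<otimes> R"
  by (rule isomorphicI[of s]) (auto simp: conj_iso_def mhom_iff miso_mor)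

lemma isomorphic_cancel_left:
  assumes "x \<otimes> a \<simeq> x \<otimes> b" "y \<otimes> x \<simeq> MUnit M" "x \<in> MOb M" "y \<in> MOb M" "a \<in> MOb M" "b \<in> MOb M"
  shows "a \<simeq> b"
proof -
  have 1: "c \<simeq> y \<otimes> (x \<otimes> c)" if "c \<in> MOb M" for c
  proof -
    have "c \<simeq> MUnit M \<otimes> c"
      using that by (intro isomorphic_sym[OF isomorphic_lunit])
    also have "\<dots> \<simeq> (y \<otimes> x) \<otimes> c"
      using that assms by (intro isomorphic_ten_right isomorphic_sym[OF assms(2)])
    also have "\<dots> \<simeq> y \<otimes> (x \<otimes> c)"
      using that assms by (intro isomorphic_assoc)
    finally show ?thesis .
  qed
  have "a \<simeq> y \<otimes> (x \<otimes> a)"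
    by (rule 1) fact
  also have "\<dots> \<simeq> y \<otimes> (x \<otimes> b)"
    by (rule isomorphic_ten_left) fact+
  also have "\<dots> \<simeq> b"
    by (rule isomorphic_sym[OF 1]) fact
  finally show ?thesis .
qed

text \<open>In a tricategory with one object, \<open>mid\<close> is provided by the component of \<open>\<mu>\<close>, and \<open>left\<close>
  by that of \<open>\<lambda>\<close>, with \<open>A\<close> the component of the associator.\<close>

lemma unit_objects_isomorphic:
  fixes f :: "'a \<Rightarrow> 'a \<Rightarrow> 'a"
  assumes ob: "L \<in> MOb M" "L' \<in> MOb M" "R \<in> MOb M" "R' \<in> MOb M" "A \<in> MOb M"
      "\<And>x y. \<lbrakk>x \<in> MOb M; y \<in> MOb M\<rbrakk> \<Longrightarrow> f x y \<in> MOb M"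
    and L: "L' \<otimes> L \<simeq> MUnit M" "\<And>x. x \<in> MOb M \<Longrightarrow> L \<otimes> f (MUnit M) x \<simeq> x \<otimes> L"
    and R: "R' \<otimes> R \<simeq> MUnit M" "R \<otimes> R' \<simeq> MUnit M" "\<And>x. x \<in> MOb M \<Longrightarrow> R \<otimes> f x (MUnit M) \<simeq> x \<otimes> R"
    and mid: "f (MUnit M) L \<otimes> (A \<otimes> f R' (MUnit M)) \<simeq> MUnit M"
    and left: "f L (MUnit M) \<simeq> L \<otimes> A"
  shows "L \<simeq> R"
proof -
  let ?E = "MUnit M"
  \<comment> \<open>The assumption on \<open>L\<close> at \<open>x = L\<close> gives an isomorphism
    of \<open>L \<otimes> f E L\<close> with \<open>L \<otimes> L\<close>, from which
    \<open>L\<close> is cancelled.\<close>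
  have 1: "f ?E L \<simeq> L"
    by (rule isomorphic_cancel_left[OF L(2) L(1)]) (use ob in auto)
  \<comment> \<open>The assumption on \<open>R\<close> at \<open>x = R'\<close> yields
    \<open>R' \<otimes> R\<close>, which is exchanged for \<open>R \<otimes> R'\<close> because both
    are isomorphic to the unit; then \<open>R\<close> can be cancelled.\<close>
  have "R \<otimes> f R' ?E \<simeq> R' \<otimes> R"
    by (rule R(3)) fact
  also have "\<dots> \<simeq> ?E" by fact
  also have "\<dots> \<simeq> R \<otimes> R'"
    by (rule isomorphic_sym) fact
  finally have 2: "f R' ?E \<simeq> R'"
    by (rule isomorphic_cancel_left[OF _ R(1)]) (use ob in auto)
  have "f L ?E \<otimes> R' \<simeq> (L \<otimes> A) \<otimes> R'"
    using left ob by (intro isomorphic_ten_right)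
  also have "\<dots> \<simeq> L \<otimes> (A \<otimes> R')"
    using ob by (intro isomorphic_assoc)
  also have "\<dots> \<simeq> f ?E L \<otimes> (A \<otimes> f R' ?E)"
    using ob by (intro isomorphic_ten isomorphic_sym[OF 1] isomorphic_sym[OF 2] isomorphic_refl)
  also have "\<dots> \<simeq> ?E" by fact
  finally have 3: "f L ?E \<otimes> R' \<simeq> ?E" .
  \<comment> \<open>Insert \<open>R \<otimes> R'\<close>, move \<open>L\<close> across
    \<open>R\<close> by the assumption on \<open>R\<close> at \<open>x = L\<close>, and contract
    with \<open>3\<close>.\<close>
  have "L \<simeq> L \<otimes> ?E"
    using ob by (intro isomorphic_sym[OF isomorphic_runit])
  also have "\<dots> \<simeq> L \<otimes> (R \<otimes> R')"
    using ob by (intro isomorphic_ten_left isomorphic_sym[OF R(2)])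
  also have "\<dots> \<simeq> (L \<otimes> R) \<otimes> R'"
    using ob by (intro isomorphic_sym[OF isomorphic_assoc])
  also have "\<dots> \<simeq> (R \<otimes> f L ?E) \<otimes> R'"
    using ob by (intro isomorphic_ten_right isomorphic_sym[OF R(3)])
  also have "\<dots> \<simeq> R \<otimes> (f L ?E \<otimes> R')"
    using ob by (intro isomorphic_assoc) auto
  also have "\<dots> \<simeq> R \<otimes> ?E"
    using ob 3 by (intro isomorphic_ten_left)
  also have "\<dots> \<simeq> R"
    using ob by (intro isomorphic_runit)
  finally show ?thesis .
qed

end

section \<open>One-object bicategories as monoidal categories\<close>

lemma deloop_ops:
  "MOb (deloop B x) = Arr B" "MMor (deloop B x) = Cell B" "MDom (deloop B x) = Dom B"
  "MCod (deloop B x) = Cod B" "MId (deloop B x) = Id2 B" "MComp (deloop B x) = VComp B"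
  "MUnit (deloop B x) = Id1 B x" "MTen0 (deloop B x) = Comp1 B" "MTen1 (deloop B x) = HComp B"
  "MAssoc (deloop B x) = Assoc B" "MLUnit (deloop B x) = LUnit B" "MRUnit (deloop B x) = RUnit B"
  by (simp_all add: deloop_def)

lemma mhom_deloop: "mhom (deloop B x) = hom2 B"
  by (intro ext) (simp add: mhom_def hom2_def deloop_ops)

lemma minverse_deloop: "minverse (deloop B x) = inverse2 B"
  by (intro ext) (simp add: minverse_def inverse2_def deloop_ops mhom_deloop)

lemma miso_deloop: "miso (deloop B x) = iso2 B"
  by (intro ext) (simp add: miso_def iso2_def minverse_deloop)

lemma minv_deloop: "minv (deloop B x) = inv2 B"
  by (intro ext) (simp add: minv_def inv2_def minverse_deloop)

lemmas deloop_simps = deloop_ops mhom_deloop miso_deloop minv_deloop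

lemma deloop_prod: "deloop (A \<times>\<^sub>b B) (x, y) = deloop A x \<times>\<^sub>m deloop B y"
  by (simp add: deloop_def prod_mcat_def prod_bicat_def)

lemma (in bicategory) hom1_one_object: "\<lbrakk>Obj B = {x}; f \<in> Arr B\<rbrakk> \<Longrightarrow> f \<in> hom1 B x x"
  using src_tgt[of f] by (simp add: hom1_def)

lemma (in bicategory) monoidal_category_deloop:
  assumes "Obj B = {x}"
  shows "monoidal_category (deloop B x)"
proof -
  have h1: "f \<in> hom1 B x x \<longleftrightarrow> f \<in> Arr B" for f
    using hom1_one_object[OF assms] by (auto simp: hom1_def)
  have s: "Src B f = x" "Tgt B f = x" if "f \<in> Arr B" for f
    using src_tgt[OF that] assms by auto
  have d: "f \<in> Arr B" "g \<in> Arr B" if "u \<in> hom2 B f g" for u f g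
    using dom_cod[of u] that by (auto simp: hom2_def)
  show ?thesis
  proof
    show "u \<in> MMor (deloop B x) \<Longrightarrow> MDom (deloop B x) u \<in> MOb (deloop B x) \<and> MCod (deloop B x) u \<in> MOb (deloop B x)" for u
      using dom_cod by (simp add: deloop_simps)
  qed (simp_all add: deloop_simps, use id1[of x] comp1[of _ x x _ x] id2 vcomp vcomp_id vcomp_assoc hcomp hcomp_id[of _ x x _ x] interchange
      assoc[of _ x x _ x _ x] assoc_nat lunit[of _ x x] lunit_nat runit[of _ x x] runit_nat
      pentagon[of _ x x _ x _ x _ x] triangle[of _ x x _ x] assms s d in \<open>simp_all add: h1\<close>)
qed

definition deloop_fun :: "('o, 'f, 'c, 'p, 'g, 'd) psfun \<Rightarrow> 'o \<Rightarrow> ('f, 'c, 'g, 'd) mfun" where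
  "deloop_fun F x = \<lparr> MF0 = F1 F, MF1 = F2 F, MFTen = FComp F, MFUnit = FUnit F x \<rparr>"

lemma deloop_fun_ops:
  "MF0 (deloop_fun F x) = F1 F" "MF1 (deloop_fun F x) = F2 F" "MFTen (deloop_fun F x) = FComp F"
  "MFUnit (deloop_fun F x) = FUnit F x"
  by (simp_all add: deloop_fun_def)

lemma (in pseudofunctor) monoidal_functor_deloop:
  assumes "Obj S = {x}" "Obj T = {y}"
  shows "monoidal_functor (deloop S x) (deloop T y) (deloop_fun F x)"
proof -
  interpret MS: monoidal_category "deloop S x"
    by (rule S.monoidal_category_deloop) fact
  interpret MT: monoidal_category "deloop T y"
    by (rule T.monoidal_category_deloop) fact
  have h1: "f \<in> hom1 S x x \<longleftrightarrow> f \<in> Arr S" "g \<in> hom1 T y y \<longleftrightarrow> g \<in> Arr T" for f g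
    using S.hom1_one_object[OF assms(1)] T.hom1_one_object[OF assms(2)] by (auto simp: hom1_def)
  have s: "Src S f = x" "Tgt S f = x" if "f \<in> Arr S" for f
    using S.src_tgt[OF that] assms by auto
  have d: "f \<in> Arr S" "g \<in> Arr S" if "u \<in> hom2 S f g" for u f g
    using S.dom_cod[of u] that by (auto simp: hom2_def)
  have f0: "F0 F x = y"
    using f0[of x] assms by simp
  show ?thesis
    by (unfold_locales; simp add: deloop_simps deloop_fun_ops) (use f1[of _ x x] f2 f2_id f2_vcomp fcomp[of _ x x _ x] fcomp_nat funit[of x]
      fassoc[of _ x x _ x _ x] flunit[of _ x x] frunit[of _ x x] assms s d f0 in \<open>simp_all add: h1\<close>)
qed

text \<open>Composing \<open>tarr_comp\<close> with the inverse of the associator on its left side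
  produces exactly the formula of \<open>conj_ten\<close>; \<open>tarr_unit\<close> already has the
  form of \<open>conj_unit\<close>.\<close>

lemma (in pseudo_transformation) conj_transformation_deloop:
  assumes S: "Obj S = {x}" and T: "Obj T = {y}"
  shows "conj_transformation (deloop S x) (deloop T y) (deloop_fun F x) (deloop_fun G x) (TObj \<tau> x) (TArr \<tau>)"
proof -
  let ?M = "deloop S x" and ?N = "deloop T y" and ?F = "deloop_fun F x" and ?G = "deloop_fun G x" and ?R = "TObj \<tau> x"
  interpret MF: monoidal_functor ?M ?N ?F
    by (rule F.monoidal_functor_deloop) fact+
  interpret MG: monoidal_functor ?M ?N ?G
    by (rule G.monoidal_functor_deloop) fact+
  note d = deloop_simps deloop_fun_ops
  have h1: "f \<in> hom1 S x x" if "f \<in> MOb ?M" for f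
    using F.S.hom1_one_object[OF S, of f] that by (simp add: deloop_simps)
  have R [simp]: "?R \<in> MOb ?N"
    using tobj[of x] S by (simp add: hom1_def d)
  have I: "MF.N.conj_iso ?R (MF0 ?F f) (MF0 ?G f) (TArr \<tau> f)" if "f \<in> MOb ?M" for f
    using tarr[OF h1[OF that]] that MF.f0_ob[OF that] MG.f0_ob[OF that] R
    by (simp add: MF.N.conj_iso_def hom2_def d)
  note [simp] = MF.N.conj_iso_simps[OF I]
  show ?thesis
  proof
    show "MF.N.conj_iso ?R (MF0 ?F a) (MF0 ?G a) (TArr \<tau> a)" if "a \<in> MOb ?M" for a
      using I that by simp
    show "MF.N.conj_sq ?R (MF1 ?F u) (MF1 ?G u) (TArr \<tau> (MDom ?M u)) (TArr \<tau> (MCod ?M u))" if [simp]: "u \<in> MMor ?M" for u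
    proof -
      have "u \<in> hom2 S (MDom ?M u) (MCod ?M u)"
        using that by (simp add: d hom2_def)
      from tarr_nat[OF h1 this]
      have "TArr \<tau> (MCod ?M u) \<cdot>\<^bsub>?N\<^esub> (MId ?N ?R \<otimes>\<^sub>m\<^bsub>?N\<^esub> MF1 ?F u) = (MF1 ?G u \<otimes>\<^sub>m\<^bsub>?N\<^esub> MId ?N ?R) \<cdot>\<^bsub>?N\<^esub> TArr \<tau> (MDom ?M u)"
        using MF.M.dom_ob[OF that] by (simp add: d)
      then show ?thesis
        by (simp add: MF.N.conj_sq_def I)
    qed
    show "MF.N.conj_sq ?R (MFTen ?F a b) (MFTen ?G a b)
        (MF.N.conj_ten ?R (MF0 ?F a) (MF0 ?G a) (MF0 ?F b) (MF0 ?G b) (TArr \<tau> a) (TArr \<tau> b)) (TArr \<tau> (a \<otimes>\<^bsub>?M\<^esub> b))"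
      if [simp]: "a \<in> MOb ?M" "b \<in> MOb ?M" for a b
    proof -
      have 1: "TArr \<tau> (a \<otimes>\<^bsub>?M\<^esub> b) \<cdot>\<^bsub>?N\<^esub> (MId ?N ?R \<otimes>\<^sub>m\<^bsub>?N\<^esub> MFTen ?F a b) \<cdot>\<^bsub>?N\<^esub> MAssoc ?N ?R (MF0 ?F a) (MF0 ?F b)
        = (MFTen ?G a b \<otimes>\<^sub>m\<^bsub>?N\<^esub> MId ?N ?R) \<cdot>\<^bsub>?N\<^esub> minv ?N (MAssoc ?N (MF0 ?G a) (MF0 ?G b) ?R)
          \<cdot>\<^bsub>?N\<^esub> (MId ?N (MF0 ?G a) \<otimes>\<^sub>m\<^bsub>?N\<^esub> TArr \<tau> b) \<cdot>\<^bsub>?N\<^esub> MAssoc ?N (MF0 ?G a) ?R (MF0 ?F b)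
          \<cdot>\<^bsub>?N\<^esub> (TArr \<tau> a \<otimes>\<^sub>m\<^bsub>?N\<^esub> MId ?N (MF0 ?F b))"
        using tarr_comp[OF h1[of a] h1[of b]] that by (simp add: d)
      have "(MFTen ?G a b \<otimes>\<^sub>m\<^bsub>?N\<^esub> MId ?N ?R)
          \<cdot>\<^bsub>?N\<^esub> MF.N.conj_ten ?R (MF0 ?F a) (MF0 ?G a) (MF0 ?F b) (MF0 ?G b) (TArr \<tau> a) (TArr \<tau> b)
        = ((MFTen ?G a b \<otimes>\<^sub>m\<^bsub>?N\<^esub> MId ?N ?R) \<cdot>\<^bsub>?N\<^esub> minv ?N (MAssoc ?N (MF0 ?G a) (MF0 ?G b) ?R)
          \<cdot>\<^bsub>?N\<^esub> (MId ?N (MF0 ?G a) \<otimes>\<^sub>m\<^bsub>?N\<^esub> TArr \<tau> b) \<cdot>\<^bsub>?N\<^esub> MAssoc ?N (MF0 ?G a) ?R (MF0 ?F b)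
          \<cdot>\<^bsub>?N\<^esub> (TArr \<tau> a \<otimes>\<^sub>m\<^bsub>?N\<^esub> MId ?N (MF0 ?F b))) \<cdot>\<^bsub>?N\<^esub> minv ?N (MAssoc ?N ?R (MF0 ?F a) (MF0 ?F b))"
        by (simp add: MF.N.conj_ten_def)
      also have "\<dots> = TArr \<tau> (a \<otimes>\<^bsub>?M\<^esub> b) \<cdot>\<^bsub>?N\<^esub> (MId ?N ?R \<otimes>\<^sub>m\<^bsub>?N\<^esub> MFTen ?F a b)"
        unfolding 1[symmetric] by simp
      finally show ?thesis
        by (simp add: MF.N.conj_sq_def I MF.N.conj_iso_ten)
    qed
    have "TArr \<tau> (MUnit ?M) \<cdot>\<^bsub>?N\<^esub> (MId ?N ?R \<otimes>\<^sub>m\<^bsub>?N\<^esub> MFUnit ?F)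
        = (MFUnit ?G \<otimes>\<^sub>m\<^bsub>?N\<^esub> MId ?N ?R) \<cdot>\<^bsub>?N\<^esub> minv ?N (MLUnit ?N ?R) \<cdot>\<^bsub>?N\<^esub> MRUnit ?N ?R"
      using tarr_unit[of x] S by (simp add: d)
    then show "MF.N.conj_sq ?R (MFUnit ?F) (MFUnit ?G) (MF.N.conj_unit ?R) (TArr \<tau> (MUnit ?M))"
      using I[of "MUnit ?M"] MF.N.conj_iso_unit[of ?R] by (simp add: MF.N.conj_sq_def MF.N.conj_unit_def)
  qed
qed

text \<open>The functors \<open>F(-, i)\<close> and \<open>F(i, -)\<close> for a monoid \<open>i\<close> with multiplication \<open>m\<close> and unit \<open>\<iota>\<close>.\<close>

definition fix_right ::
    "('a, 'm) mcat \<Rightarrow> ('a \<times> 'a, 'm \<times> 'm, 'a, 'm) mfun \<Rightarrow> 'a \<Rightarrow> 'm \<Rightarrow> 'm \<Rightarrow> ('a, 'm, 'a, 'm) mfun" where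
  "fix_right M F i m \<iota> = \<lparr> MF0 = (\<lambda>a. MF0 F (a, i)), MF1 = (\<lambda>u. MF1 F (u, MId M i)),
    MFTen = (\<lambda>a b. MF1 F (MId M (a \<otimes>\<^bsub>M\<^esub> b), m) \<cdot>\<^bsub>M\<^esub> MFTen F (a, i) (b, i)),
    MFUnit = MF1 F (MId M (MUnit M), \<iota>) \<cdot>\<^bsub>M\<^esub> MFUnit F \<rparr>"

text \<open>Compatibility with the tensor product is the value of \<open>F\<close> at
  \<open>m_unit\<close>, which says that \<open>\<iota>\<close> respects the multiplications of
  \<open>E\<close> and \<open>i\<close>. This trades the functor \<open>F(-, i)\<close> occurring in
  \<open>r\<close> for the functor \<open>F(-, E)\<close> required by a multiplication.\<close>

lemma unit_transformation_right:
  assumes F: "monoidal_functor (M \<times>\<^sub>m M) M F" and K: "monoidal_functor M M (fix_right M F i m \<iota>)"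
    and \<iota>: "\<iota> \<in> mhom M (MUnit M) i" "miso M \<iota>" and m: "m \<in> mhom M (i \<otimes>\<^bsub>M\<^esub> i) i"
    and m_unit: "m \<cdot>\<^bsub>M\<^esub> (\<iota> \<otimes>\<^sub>m\<^bsub>M\<^esub> \<iota>) = \<iota> \<cdot>\<^bsub>M\<^esub> MLUnit M (MUnit M)"
  shows "invertible_monoidal_transformation M M (mf_comp M F (ins_l M)) (fix_right M F i m \<iota>) (\<lambda>a. MF1 F (MId M a, \<iota>))"
proof -
  interpret F: monoidal_functor "M \<times>\<^sub>m M" M F by fact
  interpret K: monoidal_functor M M "fix_right M F i m \<iota>" by fact
  interpret C: monoidal_functor M M "mf_comp M F (ins_l M)"
    by (intro monoidal_functor_comp[OF monoidal_functor_ins(1)]) unfold_locales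
  note [simp] = \<iota>[unfolded F.N.mhom_iff] m[unfolded F.N.mhom_iff] F.N.mhom_ob[OF \<iota>(1)]
  show ?thesis
  proof
    fix a b
    assume [simp]: "a \<in> MOb M" "b \<in> MOb M"
    have "MFTen F (a, i) (b, i) \<cdot>\<^bsub>M\<^esub> (MF1 F (MId M a, \<iota>) \<otimes>\<^sub>m\<^bsub>M\<^esub> MF1 F (MId M b, \<iota>))
        = MF1 F (MId M (a \<otimes>\<^bsub>M\<^esub> b), \<iota> \<otimes>\<^sub>m\<^bsub>M\<^esub> \<iota>) \<cdot>\<^bsub>M\<^esub> MFTen F (a, MUnit M) (b, MUnit M)"
      using F.ften_natural[of "(MId M a, \<iota>)" "(MId M b, \<iota>)"] by simp
    moreover have "MF1 F (MId M (a \<otimes>\<^bsub>M\<^esub> b), m) \<cdot>\<^bsub>M\<^esub> MF1 F (MId M (a \<otimes>\<^bsub>M\<^esub> b), \<iota> \<otimes>\<^sub>m\<^bsub>M\<^esub> \<iota>) \<cdot>\<^bsub>M\<^esub> MFTen F (a, MUnit M) (b, MUnit M)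
        = MF1 F (MId M (a \<otimes>\<^bsub>M\<^esub> b), \<iota>) \<cdot>\<^bsub>M\<^esub> MF1 F (MId M (a \<otimes>\<^bsub>M\<^esub> b), MLUnit M (MUnit M)) \<cdot>\<^bsub>M\<^esub> MFTen F (a, MUnit M) (b, MUnit M)"
      by (rule F.N.comp_reassoc2) (simp_all add: F.f1_comp'[symmetric] m_unit)
    ultimately show "MF1 F (MId M (a \<otimes>\<^bsub>M\<^esub> b), \<iota>) \<cdot>\<^bsub>M\<^esub> MFTen (mf_comp M F (ins_l M)) a b
        = MFTen (fix_right M F i m \<iota>) a b \<cdot>\<^bsub>M\<^esub> (MF1 F (MId M a, \<iota>) \<otimes>\<^sub>m\<^bsub>M\<^esub> MF1 F (MId M b, \<iota>))"
      by (simp add: fix_right_def mf_comp_def ins_l_def)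
  next
    show "MF1 F (MId M (MUnit M), \<iota>) \<cdot>\<^bsub>M\<^esub> MFUnit (mf_comp M F (ins_l M)) = MFUnit (fix_right M F i m \<iota>)"
      using F.f1_id[of "(MUnit M, MUnit M)"] by (simp add: fix_right_def mf_comp_def ins_l_def)
  next
    fix u a b
    assume u: "u \<in> mhom M a b"
    note [simp] = u[unfolded F.N.mhom_iff] F.N.mhom_ob[OF u]
    show "MF1 F (MId M b, \<iota>) \<cdot>\<^bsub>M\<^esub> MF1 (mf_comp M F (ins_l M)) u = MF1 (fix_right M F i m \<iota>) u \<cdot>\<^bsub>M\<^esub> MF1 F (MId M a, \<iota>)"
      by (simp add: fix_right_def mf_comp_def ins_l_def F.f1_comp'[symmetric])
  qed (simp add: F.N.mhom_iff fix_right_def mf_comp_def ins_l_def)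
qed

definition fix_left ::
    "('a, 'm) mcat \<Rightarrow> ('a \<times> 'a, 'm \<times> 'm, 'a, 'm) mfun \<Rightarrow> 'a \<Rightarrow> 'm \<Rightarrow> 'm \<Rightarrow> ('a, 'm, 'a, 'm) mfun" where
  "fix_left M F i m \<iota> = \<lparr> MF0 = (\<lambda>a. MF0 F (i, a)), MF1 = (\<lambda>u. MF1 F (MId M i, u)),
    MFTen = (\<lambda>a b. MF1 F (m, MId M (a \<otimes>\<^bsub>M\<^esub> b)) \<cdot>\<^bsub>M\<^esub> MFTen F (i, a) (i, b)),
    MFUnit = MF1 F (\<iota>, MId M (MUnit M)) \<cdot>\<^bsub>M\<^esub> MFUnit F \<rparr>"

lemma unit_transformation_left:
  assumes F: "monoidal_functor (M \<times>\<^sub>m M) M F" and K: "monoidal_functor M M (fix_left M F i m \<iota>)"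
    and \<iota>: "\<iota> \<in> mhom M (MUnit M) i" "miso M \<iota>" and m: "m \<in> mhom M (i \<otimes>\<^bsub>M\<^esub> i) i"
    and m_unit: "m \<cdot>\<^bsub>M\<^esub> (\<iota> \<otimes>\<^sub>m\<^bsub>M\<^esub> \<iota>) = \<iota> \<cdot>\<^bsub>M\<^esub> MLUnit M (MUnit M)"
  shows "invertible_monoidal_transformation M M (mf_comp M F (ins_r M)) (fix_left M F i m \<iota>) (\<lambda>a. MF1 F (\<iota>, MId M a))"
proof -
  interpret F: monoidal_functor "M \<times>\<^sub>m M" M F by fact
  interpret K: monoidal_functor M M "fix_left M F i m \<iota>" by fact
  interpret C: monoidal_functor M M "mf_comp M F (ins_r M)"
    by (intro monoidal_functor_comp[OF monoidal_functor_ins(2)]) unfold_locales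
  note [simp] = \<iota>[unfolded F.N.mhom_iff] m[unfolded F.N.mhom_iff] F.N.mhom_ob[OF \<iota>(1)]
  show ?thesis
  proof
    fix a b
    assume [simp]: "a \<in> MOb M" "b \<in> MOb M"
    have "MFTen F (i, a) (i, b) \<cdot>\<^bsub>M\<^esub> (MF1 F (\<iota>, MId M a) \<otimes>\<^sub>m\<^bsub>M\<^esub> MF1 F (\<iota>, MId M b))
        = MF1 F (\<iota> \<otimes>\<^sub>m\<^bsub>M\<^esub> \<iota>, MId M (a \<otimes>\<^bsub>M\<^esub> b)) \<cdot>\<^bsub>M\<^esub> MFTen F (MUnit M, a) (MUnit M, b)"
      using F.ften_natural[of "(\<iota>, MId M a)" "(\<iota>, MId M b)"] by simp
    moreover have "MF1 F (m, MId M (a \<otimes>\<^bsub>M\<^esub> b)) \<cdot>\<^bsub>M\<^esub> MF1 F (\<iota> \<otimes>\<^sub>m\<^bsub>M\<^esub> \<iota>, MId M (a \<otimes>\<^bsub>M\<^esub> b)) \<cdot>\<^bsub>M\<^esub> MFTen F (MUnit M, a) (MUnit M, b)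
        = MF1 F (\<iota>, MId M (a \<otimes>\<^bsub>M\<^esub> b)) \<cdot>\<^bsub>M\<^esub> MF1 F (MLUnit M (MUnit M), MId M (a \<otimes>\<^bsub>M\<^esub> b)) \<cdot>\<^bsub>M\<^esub> MFTen F (MUnit M, a) (MUnit M, b)"
      by (rule F.N.comp_reassoc2) (simp_all add: F.f1_comp'[symmetric] m_unit)
    ultimately show "MF1 F (\<iota>, MId M (a \<otimes>\<^bsub>M\<^esub> b)) \<cdot>\<^bsub>M\<^esub> MFTen (mf_comp M F (ins_r M)) a b
        = MFTen (fix_left M F i m \<iota>) a b \<cdot>\<^bsub>M\<^esub> (MF1 F (\<iota>, MId M a) \<otimes>\<^sub>m\<^bsub>M\<^esub> MF1 F (\<iota>, MId M b))"
      by (simp add: fix_left_def mf_comp_def ins_r_def)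
  next
    show "MF1 F (\<iota>, MId M (MUnit M)) \<cdot>\<^bsub>M\<^esub> MFUnit (mf_comp M F (ins_r M)) = MFUnit (fix_left M F i m \<iota>)"
      using F.f1_id[of "(MUnit M, MUnit M)"] by (simp add: fix_left_def mf_comp_def ins_r_def)
  next
    fix u a b
    assume u: "u \<in> mhom M a b"
    note [simp] = u[unfolded F.N.mhom_iff] F.N.mhom_ob[OF u]
    show "MF1 F (\<iota>, MId M b) \<cdot>\<^bsub>M\<^esub> MF1 (mf_comp M F (ins_r M)) u = MF1 (fix_left M F i m \<iota>) u \<cdot>\<^bsub>M\<^esub> MF1 F (\<iota>, MId M a)"
      by (simp add: fix_left_def mf_comp_def ins_r_def F.f1_comp'[symmetric])
  qed (simp add: F.N.mhom_iff fix_left_def mf_comp_def ins_r_def)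
qed

section \<open>Doubly degenerate tricategories\<close>

lemma invertible_modification_component:
  "\<lbrakk>invertible_modification \<sigma> \<tau> m; x \<in> Obj (PDom (TSrc \<sigma>))\<rbrakk>
    \<Longrightarrow> m x \<in> hom2 (PCod (TSrc \<sigma>)) (TObj \<sigma> x) (TObj \<tau> x) \<and> iso2 (PCod (TSrc \<sigma>)) (m x)"
  by (simp add: invertible_modification_def Let_def)

text \<open>A pseudofunctor from the terminal bicategory is a monoid \<open>i\<close> with
  invertible unit \<open>\<iota>\<close>. The last equation, that \<open>\<iota>\<close> is
  multiplicative, follows from the left unit law after factoring
  \<open>\<iota> \<otimes>\<^sub>m \<iota>\<close> through \<open>E \<otimes> i\<close>.\<close>

lemma unit_functor_monoid:
  assumes "pseudofunctor unit_bicat H U" "Obj H = {e}"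
  defines "i \<equiv> F1 U ()" and "m \<equiv> FComp U () ()" and "\<iota> \<equiv> FUnit U ()" and "B \<equiv> deloop H e"
  shows "F2 U () = MId B i" "\<iota> \<in> mhom B (MUnit B) i" "miso B \<iota>" "m \<in> mhom B (i \<otimes>\<^bsub>B\<^esub> i) i"
    "m \<cdot>\<^bsub>B\<^esub> (\<iota> \<otimes>\<^sub>m\<^bsub>B\<^esub> \<iota>) = \<iota> \<cdot>\<^bsub>B\<^esub> MLUnit B (MUnit B)"
proof -
  interpret U: pseudofunctor unit_bicat H U by fact
  interpret U: monoidal_functor "deloop unit_bicat ()" "deloop H e" "deloop_fun U ()"
    by (rule U.monoidal_functor_deloop) (use assms(2) in \<open>simp_all add: unit_bicat_def UNIV_unit\<close>)
  interpret B: monoidal_category B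
    unfolding B_def by unfold_locales
  have ob: "() \<in> MOb (deloop unit_bicat ())"
    by (simp add: deloop_simps unit_bicat_def)
  have ops: "MUnit (deloop unit_bicat ()) = ()" "x \<otimes>\<^bsub>deloop unit_bicat ()\<^esub> y = ()"
    "MLUnit (deloop unit_bicat ()) x = ()" "MId (deloop unit_bicat ()) x = ()" for x y
    by simp_all
  show id: "F2 U () = MId B i"
    using U.f1_id[OF ob] by (simp add: ops deloop_fun_ops B_def i_def)
  show \<iota>: "\<iota> \<in> mhom B (MUnit B) i" and \<iota>': "miso B \<iota>"
    using U.funit by (simp_all add: ops deloop_fun_ops B_def i_def \<iota>_def)
  show m: "m \<in> mhom B (i \<otimes>\<^bsub>B\<^esub> i) i"
    using U.ften[OF ob ob] by (simp add: ops deloop_fun_ops B_def i_def m_def)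
  note [simp] = \<iota>[unfolded B.mhom_iff] \<iota>' m[unfolded B.mhom_iff] B.mhom_ob[OF m] B.mhom_ob[OF \<iota>]
  have 1: "m \<cdot>\<^bsub>B\<^esub> (\<iota> \<otimes>\<^sub>m\<^bsub>B\<^esub> MId B i) = MLUnit B i"
    using U.flunit[OF ob] id by (simp add: ops deloop_fun_ops flip: B_def i_def m_def \<iota>_def)
  have "m \<cdot>\<^bsub>B\<^esub> (\<iota> \<otimes>\<^sub>m\<^bsub>B\<^esub> \<iota>) = m \<cdot>\<^bsub>B\<^esub> (\<iota> \<otimes>\<^sub>m\<^bsub>B\<^esub> MId B i) \<cdot>\<^bsub>B\<^esub> (MId B (MUnit B) \<otimes>\<^sub>m\<^bsub>B\<^esub> \<iota>)"
    by (simp add: B.ten_comp)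
  also have "\<dots> = MLUnit B i \<cdot>\<^bsub>B\<^esub> (MId B (MUnit B) \<otimes>\<^sub>m\<^bsub>B\<^esub> \<iota>)"
    by (rule B.comp_reassoc[OF 1]) simp_all
  finally show "m \<cdot>\<^bsub>B\<^esub> (\<iota> \<otimes>\<^sub>m\<^bsub>B\<^esub> \<iota>) = \<iota> \<cdot>\<^bsub>B\<^esub> MLUnit B (MUnit B)"
    using B.lunit_natural[of \<iota>] by simp
qed

text \<open>The values of \<open>\<phi>\<close> on objects and morphisms are prescribed, so that the
  quantifier ranges only over its monoidal constraints together with \<open>\<rho>\<close> and
  \<open>lam\<close>, as far as the behaviour on \<open>B\<close> is concerned.\<close>

theorem corollary2p9:
  fixes T :: "('o, 'f, 'g, 'h) tricat" and z :: 'o and e :: 'f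
  assumes "tricategory T" and "doubly_degenerate T z e"
  shows "let B = deloop (Hom T z z) e;
             L' = TObj (Bwd (LEq T z z)) e;
             R = TObj (Fwd (REq T z z)) e
         in \<exists>\<phi> \<rho> lam.
              multiplication B \<phi> \<rho> lam \<and>
              (\<forall>X \<in> MOb B. \<forall>Y \<in> MOb B.
                MF0 \<phi> (X, Y) = R \<otimes>\<^bsub>B\<^esub> (F1 (Ten T z z z) (X, Y) \<otimes>\<^bsub>B\<^esub> L')) \<and>
              (\<forall>u \<in> MMor B. \<forall>v \<in> MMor B.
                MF1 \<phi> (u, v) = MId B R \<otimes>\<^sub>m\<^bsub>B\<^esub> (F2 (Ten T z z z) (u, v) \<otimes>\<^sub>m\<^bsub>B\<^esub> MId B L')) \<and>
              braided_monoidal_category B (induced_braiding B \<phi> \<rho> lam)"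
proof -
  define H where "H = Hom T z z"
  define B where "B = deloop H e"
  define F where "F = deloop_fun (Ten T z z z) (e, e)"
  define i m \<iota> where "i = F1 (UnF T z) ()" and "m = FComp (UnF T z) () ()" and "\<iota> = FUnit (UnF T z) ()"
  define L L' R R' where "L = TObj (Fwd (LEq T z z)) e" and "L' = TObj (Bwd (LEq T z z)) e"
    and "R = TObj (Fwd (REq T z z)) e" and "R' = TObj (Bwd (REq T z z)) e"
  define A where "A = TObj (Fwd (AEq T z z z z)) (e, e, e)"
  define Fl Fr where "Fl = pten T z z z (punit T H z) (pid H)" and "Fr = pten T z z z (pid H) (punit T H z)"
  have z: "z \<in> TOb T" and e: "Obj H = {e}"
    using assms(2) by (auto simp: doubly_degenerate_def H_def)
  interpret T: tricategory T by fact
  interpret H: bicategory H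
    unfolding H_def by (rule T.hom_bicat) (rule z)+
  interpret B: monoidal_category B
    unfolding B_def by (rule H.monoidal_category_deloop) fact
  interpret Ten: pseudofunctor "H \<times>\<^sub>b H" H "Ten T z z z"
    unfolding H_def by (rule T.ten) (rule z)+
  have ee: "Obj (H \<times>\<^sub>b H) = {(e, e)}"
    using e by (auto simp: prod_bicat_def)
  interpret F: monoidal_functor "B \<times>\<^sub>m B" B F
    using Ten.monoidal_functor_deloop[OF ee e] by (simp add: deloop_prod B_def F_def)
  have U: "pseudofunctor unit_bicat H (UnF T z)"
    unfolding H_def by (rule T.un) (rule z)
  interpret U: pseudofunctor unit_bicat H "UnF T z" by fact
  have U0: "F0 (UnF T z) () = e"
    using U.f0[of "()"] e by (simp add: unit_bicat_def)
  have Ten0: "F0 (Ten T z z z) (e, e) = e"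
    using Ten.f0[of "(e, e)"] e ee by simp
  note monoid = unit_functor_monoid[OF U e, folded B_def i_def m_def \<iota>_def]
  interpret LE: adjoint_equivalence H H Fl "pid H" "LEq T z z"
    unfolding H_def Fl_def by (rule T.left_eq) (rule z)+
  interpret RE: adjoint_equivalence H H Fr "pid H" "REq T z z"
    unfolding H_def Fr_def by (rule T.right_eq) (rule z)+
  interpret AE: adjoint_equivalence "H \<times>\<^sub>b H \<times>\<^sub>b H" H "assoc_src T z z z z" "assoc_tgt T z z z z" "AEq T z z z z"
    unfolding H_def by (rule T.assoc_eq) (rule z)+

  \<comment> \<open>The unit functor enters \<open>Fl\<close> and \<open>Fr\<close> composed with
    the functor to the terminal bicategory, and this composition multiplies its constraints by the
    image of the only 2-cell, which is the identity of \<open>i\<close>.\<close>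
  have mi: "MId B i \<cdot>\<^bsub>B\<^esub> m = m" "MId B i \<cdot>\<^bsub>B\<^esub> \<iota> = \<iota>"
    using monoid(2,4) by (simp_all add: B.mhom_iff B.mhom_ob[OF monoid(2)])
  note composites = pten_def pcomp_def ppair_def punit_def pbang_def pid_def
  note B_ops = B_def deloop_simps
  have Fl: "deloop_fun Fl e = fix_left B F i m \<iota>" and Fr: "deloop_fun Fr e = fix_right B F i m \<iota>"
    using mi monoid(1)
    by (simp_all add: Fl_def Fr_def F_def deloop_fun_def fix_left_def fix_right_def composites Ten.pcod U.pcod U0
      B_ops flip: i_def m_def \<iota>_def)
  have id: "deloop_fun (pid H) e = mf_id B"
    by (simp add: deloop_fun_def pid_def mf_id_def B_def deloop_simps)
  interpret tl: conj_transformation B B "fix_left B F i m \<iota>" "mf_id B" L "TArr (Fwd (LEq T z z))"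
    using LE.fwd.conj_transformation_deloop[OF e e] by (simp add: Fl id B_def[symmetric] L_def)
  interpret tr: conj_transformation B B "fix_right B F i m \<iota>" "mf_id B" R "TArr (Fwd (REq T z z))"
    using RE.fwd.conj_transformation_deloop[OF e e] by (simp add: Fr id B_def[symmetric] R_def)
  \<comment> \<open>Transport along the isomorphism from \<open>E\<close> to \<open>i\<close> given
    by \<open>\<iota>\<close>: the conjugating object stays \<open>L\<close>, the source functor
    becomes the restriction of \<open>F\<close> to \<open>(E, -)\<close>.\<close>
  interpret tl': conj_transformation B B "mf_comp B F (ins_r B)" "mf_id B" L
      "\<lambda>a. TArr (Fwd (LEq T z z)) a \<cdot>\<^bsub>B\<^esub> (MId B L \<otimes>\<^sub>m\<^bsub>B\<^esub> MF1 F (\<iota>, MId B a))"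
    by (rule tl.conj_transformation_iso[OF unit_transformation_left])
      (intro F.monoidal_functor_axioms tl.F.monoidal_functor_axioms monoid)+
  interpret tr': conj_transformation B B "mf_comp B F (ins_l B)" "mf_id B" R
      "\<lambda>a. TArr (Fwd (REq T z z)) a \<cdot>\<^bsub>B\<^esub> (MId B R \<otimes>\<^sub>m\<^bsub>B\<^esub> MF1 F (MId B a, \<iota>))"
    by (rule tr.conj_transformation_iso[OF unit_transformation_right])
      (intro F.monoidal_functor_axioms tr.F.monoidal_functor_axioms monoid)+

  \<comment> \<open>The identity transformations of \<open>Fl\<close> and \<open>Fr\<close> have as
    components the identities at these values, so the units of the adjoint equivalences start at the
    monoidal unit.\<close>
  have Fl0: "F0 Fl e = e" and Fr0: "F0 Fr e = e"
    using U0 Ten0 by (simp_all add: Fl_def Fr_def composites)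
  have eeO: "e \<in> Obj H" "(e, e) \<in> Obj (H \<times>\<^sub>b H)" "(e, e, e) \<in> Obj (H \<times>\<^sub>b H \<times>\<^sub>b H)"
    using e by (simp_all add: prod_bicat_def)
  have ob: "L \<in> MOb B" "L' \<in> MOb B" "R \<in> MOb B" "R' \<in> MOb B" "A \<in> MOb B"
    using LE.fwd.tobj[OF eeO(1)] LE.bwd.tobj[OF eeO(1)] RE.fwd.tobj[OF eeO(1)] RE.bwd.tobj[OF eeO(1)] AE.fwd.tobj[OF eeO(3)]
    by (simp_all add: L_def L'_def R_def R'_def A_def B_ops hom1_def)
  have iso: "B.isomorphic a b" if "u \<in> hom2 H a b \<and> iso2 H u" for a b u
    by (rule B.isomorphicI[of u]) (use that in \<open>simp_all add: B_ops\<close>)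
  note component = invertible_modification_component
  note trans_simps = tid_def tcomp_def Let_def pid_def B_ops
  note L_simps = LE.fwd.F.pdom LE.fwd.F.pcod LE.fwd.tsrc LE.fwd.ttgt LE.bwd.tsrc LE.bwd.ttgt
  have LL: "B.isomorphic (MUnit B) (L' \<otimes>\<^bsub>B\<^esub> L)" "B.isomorphic (L \<otimes>\<^bsub>B\<^esub> L') (MUnit B)"
  proof -
    have "Eta (LEq T z z) e \<in> hom2 H (MUnit B) (L' \<otimes>\<^bsub>B\<^esub> L) \<and> iso2 H (Eta (LEq T z z) e)"
      using component[OF LE.eta, of e] eeO(1)
      by (simp add: trans_simps L_simps Fl0 flip: L_def L'_def)
    then show "B.isomorphic (MUnit B) (L' \<otimes>\<^bsub>B\<^esub> L)" by (rule iso)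
    have "Eps (LEq T z z) e \<in> hom2 H (L \<otimes>\<^bsub>B\<^esub> L') (MUnit B) \<and> iso2 H (Eps (LEq T z z) e)"
      using component[OF LE.eps, of e] eeO(1)
      by (simp add: trans_simps L_simps flip: L_def L'_def)
    then show "B.isomorphic (L \<otimes>\<^bsub>B\<^esub> L') (MUnit B)" by (rule iso)
  qed
  note R_simps = RE.fwd.F.pdom RE.fwd.F.pcod RE.fwd.tsrc RE.fwd.ttgt RE.bwd.tsrc RE.bwd.ttgt
  have RR: "B.isomorphic (MUnit B) (R' \<otimes>\<^bsub>B\<^esub> R)" "B.isomorphic (R \<otimes>\<^bsub>B\<^esub> R') (MUnit B)"
  proof -
    have "Eta (REq T z z) e \<in> hom2 H (MUnit B) (R' \<otimes>\<^bsub>B\<^esub> R) \<and> iso2 H (Eta (REq T z z) e)"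
      using component[OF RE.eta, of e] eeO(1)
      by (simp add: trans_simps R_simps Fr0 flip: R_def R'_def)
    then show "B.isomorphic (MUnit B) (R' \<otimes>\<^bsub>B\<^esub> R)" by (rule iso)
    have "Eps (REq T z z) e \<in> hom2 H (R \<otimes>\<^bsub>B\<^esub> R') (MUnit B) \<and> iso2 H (Eps (REq T z z) e)"
      using component[OF RE.eps, of e] eeO(1)
      by (simp add: trans_simps R_simps flip: R_def R'_def)
    then show "B.isomorphic (R \<otimes>\<^bsub>B\<^esub> R') (MUnit B)" by (rule iso)
  qed
  note ten_simps = tten_def tassoc_def twhisk_l_def twhisk_r_def tpair_def composites pfst_def psnd_def
    L_simps R_simps AE.fwd.tsrc AE.fwd.ttgt AE.fwd.F.pdom AE.fwd.F.pcod Ten.pdom Ten.pcod U.pdom U.pcod U0 Ten0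
    F_def deloop_fun_ops
  \<comment> \<open>Tensoring with an identity transformation puts \<open>E\<close> into the other
    argument of \<open>F\<close>. The unit 1-cell in the middle of the associator is
    \<open>e\<close> by \<open>U0\<close>, so the component there is \<open>A\<close>.\<close>
  have "TMu T z z z (e, e) \<in> hom2 H (MF0 F (MUnit B, L) \<otimes>\<^bsub>B\<^esub> (A \<otimes>\<^bsub>B\<^esub> MF0 F (R', MUnit B))) (MUnit B)
      \<and> iso2 H (TMu T z z z (e, e))"
    using component[OF T.mu[OF z z z], of "(e, e)"] eeO(2)
    by (simp add: mu_src_def mu_tgt_def trans_simps ten_simps flip: H_def L_def R'_def A_def)
  then have mu: "B.isomorphic (MF0 F (MUnit B, L) \<otimes>\<^bsub>B\<^esub> (A \<otimes>\<^bsub>B\<^esub> MF0 F (R', MUnit B))) (MUnit B)"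
    by (rule iso)
  \<comment> \<open>Here the associator has the unit 1-cell in its first place; as there is just one
    1-cell, its component is the same object \<open>A\<close> as before.\<close>
  have "TLam T z z z (e, e) \<in> hom2 H (MF0 F (L, MUnit B)) (L \<otimes>\<^bsub>B\<^esub> A) \<and> iso2 H (TLam T z z z (e, e))"
    using component[OF T.lam[OF z z z], of "(e, e)"] eeO(2)
    by (simp add: lam_src_def lam_tgt_def trans_simps ten_simps flip: H_def L_def A_def)
  then have lam: "B.isomorphic (MF0 F (L, MUnit B)) (L \<otimes>\<^bsub>B\<^esub> A)"
    by (rule iso)
  have "B.isomorphic L R"
  proof (rule B.unit_objects_isomorphic[OF ob, where f = "\<lambda>x y. MF0 F (x, y)"])
    show "B.isomorphic (L \<otimes>\<^bsub>B\<^esub> MF0 F (MUnit B, x)) (x \<otimes>\<^bsub>B\<^esub> L)" if "x \<in> MOb B" for x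
      using B.conj_iso_isomorphic[OF tl'.comp_iso[OF that]] by (simp add: mf_comp_def mf_id_def ins_r_def)
    show "B.isomorphic (R \<otimes>\<^bsub>B\<^esub> MF0 F (x, MUnit B)) (x \<otimes>\<^bsub>B\<^esub> R)" if "x \<in> MOb B" for x
      using B.conj_iso_isomorphic[OF tr'.comp_iso[OF that]] by (simp add: mf_comp_def mf_id_def ins_l_def)
  qed (use LL RR mu lam in \<open>simp_all add: B.isomorphic_sym\<close>)
  then obtain \<sigma> where \<sigma>: "\<sigma> \<in> mhom B L R" "miso B \<sigma>"
    by (auto simp: B.isomorphic_def)
  \<comment> \<open>Replacing \<open>R\<close> by \<open>L\<close> reduces this to the counit of
    \<open>l\<close>. Thus \<open>L'\<close>, given as dual of \<open>L\<close>, is an inverse of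
    \<open>R\<close>, and the prescribed formula is a conjugation by \<open>R\<close>.\<close>
  have "B.isomorphic (R \<otimes>\<^bsub>B\<^esub> L') (MUnit B)"
    using B.isomorphic_trans[OF B.isomorphic_ten_right[OF B.isomorphic_sym[OF \<open>B.isomorphic L R\<close>]] LL(2)] ob by blast
  then obtain \<epsilon> where \<epsilon>: "\<epsilon> \<in> mhom B (R \<otimes>\<^bsub>B\<^esub> L') (MUnit B)" "miso B \<epsilon>"
    by (auto simp: B.isomorphic_def)
  have "B.isomorphic (L' \<otimes>\<^bsub>B\<^esub> R) (MUnit B)"
    using B.isomorphic_trans[OF B.isomorphic_ten_left[OF B.isomorphic_sym[OF \<open>B.isomorphic L R\<close>]] B.isomorphic_sym[OF LL(1)]] ob by blast
  then obtain \<kappa> where \<kappa>: "\<kappa> \<in> mhom B (L' \<otimes>\<^bsub>B\<^esub> R) (MUnit B)" "miso B \<kappa>"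
    by (auto simp: B.isomorphic_def)
  have inv: "invertible_object B R L' \<epsilon> \<kappa>"
    by unfold_locales (use ob \<epsilon> \<kappa> in auto)
  \<comment> \<open>The conjugation by \<open>R\<close> coming from \<open>r\<close> is used as it
    stands, the one by \<open>L\<close> coming from \<open>l\<close> after transport along
    \<open>\<sigma>\<close>.\<close>
  obtain \<phi> \<rho> lam where \<phi>: "multiplication B \<phi> \<rho> lam" "MF0 \<phi> = (\<lambda>a. R \<otimes>\<^bsub>B\<^esub> (MF0 F a \<otimes>\<^bsub>B\<^esub> L'))"
      "MF1 \<phi> = (\<lambda>u. MId B R \<otimes>\<^sub>m\<^bsub>B\<^esub> (MF1 F u \<otimes>\<^sub>m\<^bsub>B\<^esub> MId B L'))"
    using multiplication_exists[OF inv F.monoidal_functor_axioms tr'.conj_transformation_axioms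
        tl'.conj_transformation_change[OF \<sigma>(2)]] \<sigma>(1) by (auto simp: B.mhom_iff)
  interpret \<phi>: multiplication B \<phi> \<rho> lam by fact
  have "braided_monoidal_category B (induced_braiding B \<phi> \<rho> lam)"
    by unfold_locales
  with \<phi> show ?thesis
    unfolding Let_def H_def[symmetric] B_def[symmetric] L'_def[symmetric] R_def[symmetric]
    by (intro exI[of _ \<phi>] exI[of _ \<rho>] exI[of _ lam]) (simp add: F_def deloop_fun_ops)
qed

end
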